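(* Let $E$ be an sc-Banach space and $V=[0,\infty)^l\times\mathbb R^{n-l}\subset\mathbb R^n$. If $f:\mathcal O(V\oplus E,0)\to(E,0)$ is an $\mathrm{sc}^0$-contraction germ which is, in addition, of class $\mathrm{sc}^k$, then the solution germ $\delta:\mathcal O(V,0)\to(E,0)$ satisfying $f(v,\delta(v))=0$ is also of class $\mathrm{sc}^k$.
   Context: An sc-Banach space is a Banach space $E$ with a nested sequence of Banach spaces $E=E_0\supset E_1\supset\cdots$ such that for $m<n$ the inclusion $E_n\to E_m$ is compact and $E_\infty=\bigcap E_m$ is dense in every $E_m$; $\|\cdot\|_m$ is the norm of $E_m$. Finite-dimensional spaces carry the constant structure, direct sums the levelwise one. Germs of neighborhoods $\mathcal O(C,0)$ are decreasing sequences $U_0\supset U_1\supset\cdots$ with $U_m$ a relatively open neighborhood of $0$ in $C\cap E_m$. An $\mathrm{sc}^0$-germ $f:\mathcal O(C,0)\to(F,0)$ is a continuous $f:U_0\to F_0$ with $f(0)=0$, $f(U_m)\subset F_m$ and $f:U_m\to F_m$ continuous for all $m$. It is $\mathrm{sc}^1$ if for each $x\in U_1$ there is $Df(x)\in\mathcal L(E_0,F_0)$ with $\|f(x+h)-f(x)-Df(x)h\|_0/\|h\|_1\to 0$ as $\|h\|_1\to0$ ($x+h\in U_1$), and the tangent map $Tf(x,h)=(f(x),Df(x)h)$ maps $U_{m+1}\oplus E_m$ into $F_{m+1}\oplus F_m$ and is an $\mathrm{sc}^0$-germ into $TF$ (the sc-Banach space $F_1\oplus F_0$ with levels $F_{m+1}\oplus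 F_m$). Inductively, $f$ is $\mathrm{sc}^k$ if it is $\mathrm{sc}^1$ and $Tf$ is $\mathrm{sc}^{k-1}$. An $\mathrm{sc}^0$-contraction germ is an $\mathrm{sc}^0$-germ $f:\mathcal O(V\oplus E,0)\to(E,0)$ of the form $f(v,u)=u-B(v,u)$ such that for every $m\ge0$ and $0<\varepsilon<1$, $\|B(v,u)-B(v,u')\|_m\le\varepsilon\|u-u'\|_m$ for all $(v,u),(v,u')$ sufficiently close to $(0,0)$ in $V\oplus E_m$; it has a unique $\mathrm{sc}^0$-solution germ $\delta$. *)

theory Defs
  imports "HOL-Analysis.Analysis"
begin

text \<open>An sc-structure on a Banach space type 'e is given by the level sets
  L m (the spaces E_m, as subsets of E = E_0) and their norms N m.\<close>

definition sc_banach :: "(nat \<Rightarrow> ('e::banach) set) \<Rightarrow> (nat \<Rightarrow> 'e \<Rightarrow> real) \<Rightarrow> bool" where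
  "sc_banach L N \<longleftrightarrow>
     L 0 = UNIV \<and> N 0 = norm \<and>
     (\<forall>m. L (Suc m) \<subseteq> L m) \<and>
     (\<forall>m. subspace (L m)) \<and>
     (\<forall>m. \<forall>x\<in>L m. 0 \<le> N m x \<and> (N m x = 0 \<longleftrightarrow> x = 0)) \<and>
     (\<forall>m. \<forall>x\<in>L m. \<forall>y\<in>L m. N m (x + y) \<le> N m x + N m y) \<and>
     (\<forall>m c. \<forall>x\<in>L m. N m (c *\<^sub>R x) = \<bar>c\<bar> * N m x) \<and>
     \<comment> \<open>each E_m is complete\<close>
     (\<forall>m (X :: nat \<Rightarrow> 'e). (\<forall>k. X k \<in> L m) \<and> (\<forall>e>0. \<exists>K. \<forall>i\<ge>K. \<forall>j\<ge>K. N m (X i - X j) < e)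
        \<longrightarrow> (\<exists>y\<in>L m. (\<lambda>k. N m (X k - y)) \<longlonglongrightarrow> 0)) \<and>
     \<comment> \<open>for m < n the inclusion E_n \<rightarrow> E_m is compact\<close>
     (\<forall>m n (X :: nat \<Rightarrow> 'e). m < n \<and> (\<forall>k. X k \<in> L n \<and> N n (X k) \<le> 1)
        \<longrightarrow> (\<exists>(r :: nat \<Rightarrow> nat) y. strict_mono r \<and> y \<in> L m \<and> (\<lambda>k. N m (X (r k) - y)) \<longlonglongrightarrow> 0)) \<and>
     \<comment> \<open>E_\<infinity> is dense in every E_m\<close>
     (\<forall>m. \<forall>x\<in>L m. \<forall>e>0. \<exists>y\<in>(\<Inter>j. L j). N m (y - x) < e)"

definition nbhd_germ :: "(nat \<Rightarrow> ('a::real_vector) set) \<Rightarrow> (nat \<Rightarrow> 'a \<Rightarrow> real) \<Rightarrow> 'a set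
    \<Rightarrow> (nat \<Rightarrow> 'a set) \<Rightarrow> bool" where
  "nbhd_germ L N C U \<longleftrightarrow>
     (\<forall>m. U (Suc m) \<subseteq> U m) \<and>
     (\<forall>m. 0 \<in> U m \<and> U m \<subseteq> C \<inter> L m \<and>
          (\<forall>x\<in>U m. \<exists>r>0. \<forall>y\<in>C \<inter> L m. N m (y - x) < r \<longrightarrow> y \<in> U m))"

text \<open>To iterate the tangent construction T(X) = X^1 \<oplus> X inside a single HOL type,
  points of T^j X are encoded as functions nat \<Rightarrow> 'a; a pair (x,h) is encoded by
  interleaving (x at even, h at odd indices).\<close>

definition padd :: "(nat \<Rightarrow> 'a::real_vector) \<Rightarrow> (nat \<Rightarrow> 'a) \<Rightarrow> nat \<Rightarrow> 'a" where
  "padd x y = (\<lambda>i. x i + y i)"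
definition psub :: "(nat \<Rightarrow> 'a::real_vector) \<Rightarrow> (nat \<Rightarrow> 'a) \<Rightarrow> nat \<Rightarrow> 'a" where
  "psub x y = (\<lambda>i. x i - y i)"
definition pscale :: "real \<Rightarrow> (nat \<Rightarrow> 'a::real_vector) \<Rightarrow> nat \<Rightarrow> 'a" where
  "pscale c x = (\<lambda>i. c *\<^sub>R x i)"
definition pzero :: "nat \<Rightarrow> 'a::real_vector" where
  "pzero = (\<lambda>i. 0)"

definition evn :: "(nat \<Rightarrow> 'a) \<Rightarrow> nat \<Rightarrow> 'a" where "evn x = (\<lambda>i. x (2 * i))"
definition odp :: "(nat \<Rightarrow> 'a) \<Rightarrow> nat \<Rightarrow> 'a" where "odp x = (\<lambda>i. x (2 * i + 1))"
definition ilv :: "(nat \<Rightarrow> 'a) \<Rightarrow> (nat \<Rightarrow> 'a) \<Rightarrow> nat \<Rightarrow> 'a" where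
  "ilv a b = (\<lambda>i. if even i then a (i div 2) else b (i div 2))"

record 'a scs =
  lev :: "nat \<Rightarrow> (nat \<Rightarrow> 'a) set"
  nrm :: "nat \<Rightarrow> (nat \<Rightarrow> 'a) \<Rightarrow> real"

definition sc0 :: "'a::real_vector scs \<Rightarrow> 'b::real_vector scs \<Rightarrow> (nat \<Rightarrow> (nat \<Rightarrow> 'a) set)
    \<Rightarrow> ((nat \<Rightarrow> 'a) \<Rightarrow> (nat \<Rightarrow> 'b)) \<Rightarrow> bool" where
  "sc0 S F U f \<longleftrightarrow> f pzero = pzero \<and>
     (\<forall>m. f ` U m \<subseteq> lev F m \<and>
        (\<forall>x\<in>U m. \<forall>e>0. \<exists>d>0. \<forall>y\<in>U m.
            nrm S m (psub y x) < d \<longrightarrow> nrm F m (psub (f y) (f x)) < e))"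

definition is_scD :: "'a::real_vector scs \<Rightarrow> 'b::real_vector scs \<Rightarrow> (nat \<Rightarrow> (nat \<Rightarrow> 'a) set)
    \<Rightarrow> ((nat \<Rightarrow> 'a) \<Rightarrow> (nat \<Rightarrow> 'b)) \<Rightarrow> (nat \<Rightarrow> 'a) \<Rightarrow> ((nat \<Rightarrow> 'a) \<Rightarrow> (nat \<Rightarrow> 'b)) \<Rightarrow> bool" where
  "is_scD S F U f x A \<longleftrightarrow>
     (\<forall>h\<in>lev S 0. A h \<in> lev F 0) \<and>
     (\<forall>h\<in>lev S 0. \<forall>k\<in>lev S 0. A (padd h k) = padd (A h) (A k)) \<and>
     (\<forall>c. \<forall>h\<in>lev S 0. A (pscale c h) = pscale c (A h)) \<and>
     (\<exists>K. \<forall>h\<in>lev S 0. nrm F 0 (A h) \<le> K * nrm S 0 h) \<and>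
     (\<forall>e>0. \<exists>d>0. \<forall>h. h \<in> lev S 1 \<and> padd x h \<in> U 1 \<and> 0 < nrm S 1 h \<and> nrm S 1 h < d
        \<longrightarrow> nrm F 0 (psub (psub (f (padd x h)) (f x)) (A h)) \<le> e * nrm S 1 h)"

definition Tscs :: "'a scs \<Rightarrow> 'a scs" where
  "Tscs S = \<lparr>lev = (\<lambda>m. {x. evn x \<in> lev S (Suc m) \<and> odp x \<in> lev S m}),
             nrm = (\<lambda>m x. nrm S (Suc m) (evn x) + nrm S m (odp x))\<rparr>"

definition Tgerm :: "'a scs \<Rightarrow> (nat \<Rightarrow> (nat \<Rightarrow> 'a) set) \<Rightarrow> nat \<Rightarrow> (nat \<Rightarrow> 'a) set" where
  "Tgerm S U = (\<lambda>m. {x. evn x \<in> U (Suc m) \<and> odp x \<in> lev S m})"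

definition Tmap :: "((nat \<Rightarrow> 'a) \<Rightarrow> (nat \<Rightarrow> 'b)) \<Rightarrow> ((nat \<Rightarrow> 'a) \<Rightarrow> (nat \<Rightarrow> 'a) \<Rightarrow> (nat \<Rightarrow> 'b))
    \<Rightarrow> (nat \<Rightarrow> 'a) \<Rightarrow> (nat \<Rightarrow> 'b)" where
  "Tmap f Df = (\<lambda>x. ilv (f (evn x)) (Df (evn x) (odp x)))"

definition sc1 :: "'a::real_vector scs \<Rightarrow> 'b::real_vector scs \<Rightarrow> (nat \<Rightarrow> (nat \<Rightarrow> 'a) set)
    \<Rightarrow> ((nat \<Rightarrow> 'a) \<Rightarrow> (nat \<Rightarrow> 'b)) \<Rightarrow> ((nat \<Rightarrow> 'a) \<Rightarrow> (nat \<Rightarrow> 'a) \<Rightarrow> (nat \<Rightarrow> 'b)) \<Rightarrow> bool" where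
  "sc1 S F U f Df \<longleftrightarrow> sc0 S F U f \<and> (\<forall>x\<in>U 1. is_scD S F U f x (Df x)) \<and>
     sc0 (Tscs S) (Tscs F) (Tgerm S U) (Tmap f Df)"

primrec tan_it :: "'a scs \<Rightarrow> 'b scs \<Rightarrow> (nat \<Rightarrow> (nat \<Rightarrow> 'a) set) \<Rightarrow> ((nat \<Rightarrow> 'a) \<Rightarrow> (nat \<Rightarrow> 'b))
    \<Rightarrow> (nat \<Rightarrow> (nat \<Rightarrow> 'a) \<Rightarrow> (nat \<Rightarrow> 'a) \<Rightarrow> (nat \<Rightarrow> 'b)) \<Rightarrow> nat
    \<Rightarrow> 'a scs \<times> 'b scs \<times> (nat \<Rightarrow> (nat \<Rightarrow> 'a) set) \<times> ((nat \<Rightarrow> 'a) \<Rightarrow> (nat \<Rightarrow> 'b))" where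
  "tan_it S F U f Ds 0 = (S, F, U, f)"
| "tan_it S F U f Ds (Suc j) =
     (case tan_it S F U f Ds j of (S', F', U', f') \<Rightarrow>
        (Tscs S', Tscs F', Tgerm S' U', Tmap f' (Ds j)))"

text \<open>f is sc^k iff f is sc^0 and T^j f is sc^1 for all j < k
  (equivalently: f sc^1 and Tf sc^(k-1)).\<close>
definition scK :: "nat \<Rightarrow> 'a::real_vector scs \<Rightarrow> 'b::real_vector scs \<Rightarrow> (nat \<Rightarrow> (nat \<Rightarrow> 'a) set)
    \<Rightarrow> ((nat \<Rightarrow> 'a) \<Rightarrow> (nat \<Rightarrow> 'b)) \<Rightarrow> bool" where
  "scK k S F U f \<longleftrightarrow> sc0 S F U f \<and>
     (\<exists>Ds. \<forall>j<k. case tan_it S F U f Ds j of (S', F', U', f') \<Rightarrow> sc1 S' F' U' f' (Ds j))"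

definition lift_scs :: "(nat \<Rightarrow> ('a::zero) set) \<Rightarrow> (nat \<Rightarrow> 'a \<Rightarrow> real) \<Rightarrow> 'a scs" where
  "lift_scs L N = \<lparr>lev = (\<lambda>m. {x. x 0 \<in> L m \<and> (\<forall>i>0. x i = 0)}), nrm = (\<lambda>m x. N m (x 0))\<rparr>"

definition lift_germ :: "(nat \<Rightarrow> ('a::zero) set) \<Rightarrow> nat \<Rightarrow> (nat \<Rightarrow> 'a) set" where
  "lift_germ U = (\<lambda>m. {x. x 0 \<in> U m \<and> (\<forall>i>0. x i = 0)})"

definition lift_fun :: "('a \<Rightarrow> 'b::zero) \<Rightarrow> (nat \<Rightarrow> 'a) \<Rightarrow> nat \<Rightarrow> 'b" where
  "lift_fun f = (\<lambda>x i. if i = 0 then f (x 0) else 0)"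

definition is_sc :: "nat \<Rightarrow> (nat \<Rightarrow> ('a::real_vector) set) \<Rightarrow> (nat \<Rightarrow> 'a \<Rightarrow> real)
    \<Rightarrow> (nat \<Rightarrow> ('b::real_vector) set) \<Rightarrow> (nat \<Rightarrow> 'b \<Rightarrow> real) \<Rightarrow> (nat \<Rightarrow> 'a set) \<Rightarrow> ('a \<Rightarrow> 'b) \<Rightarrow> bool" where
  "is_sc k L N L' N' U f = scK k (lift_scs L N) (lift_scs L' N') (lift_germ U) (lift_fun f)"

definition constL :: "nat \<Rightarrow> 'a set" where "constL = (\<lambda>m. UNIV)"
definition constN :: "nat \<Rightarrow> 'a::real_normed_vector \<Rightarrow> real" where "constN = (\<lambda>m. norm)"
definition sumL :: "(nat \<Rightarrow> 'e set) \<Rightarrow> nat \<Rightarrow> ('v \<times> 'e) set" where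
  "sumL L = (\<lambda>m. UNIV \<times> L m)"
definition sumN :: "(nat \<Rightarrow> 'e \<Rightarrow> real) \<Rightarrow> nat \<Rightarrow> ('v::real_normed_vector \<times> 'e) \<Rightarrow> real" where
  "sumN N = (\<lambda>m (v, u). norm v + N m u)"

text \<open>Partial quadrant: coordinates in J are nonnegative (for J = first l
  coordinates this is [0,\<infinity>)^l \<times> R^(n-l)).\<close>
definition quadrant :: "'n::finite set \<Rightarrow> (real^'n) set" where
  "quadrant J = {v. \<forall>i\<in>J. 0 \<le> v $ i}"

text \<open>sc^0-contraction germ f(v,u) = u - B(v,u) on the germ U of V \<oplus> E.\<close>
definition sc0_contraction_germ :: "(nat \<Rightarrow> ('e::banach) set) \<Rightarrow> (nat \<Rightarrow> 'e \<Rightarrow> real) \<Rightarrow> ('v::real_normed_vector) set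
    \<Rightarrow> (nat \<Rightarrow> ('v \<times> 'e) set) \<Rightarrow> ('v \<times> 'e \<Rightarrow> 'e) \<Rightarrow> bool" where
  "sc0_contraction_germ L N V U f \<longleftrightarrow>
     nbhd_germ (sumL L) (sumN N) (V \<times> UNIV) U \<and>
     is_sc 0 (sumL L) (sumN N) L N U f \<and>
     (\<forall>m e. 0 < e \<and> e < 1 \<longrightarrow> (\<exists>r>0. \<forall>v u u'.
        (v, u) \<in> U m \<and> (v, u') \<in> U m \<and> norm v + N m u < r \<and> norm v + N m u' < r
        \<longrightarrow> N m ((u - f (v, u)) - (u' - f (v, u'))) \<le> e * N m (u - u')))"

end

theory Submission
  imports Defs "HOL-Library.Function_Algebras"
begin

text \<open>
  Differentiability of \<open>\<delta>\<close> is obtained without a chain rule. If \<open>y\<close> solves the linearized equation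
  \<open>Df(v, \<delta> v)(w, y) = 0\<close>, approximate \<open>y\<close> by \<open>z\<^sub>n\<close> of higher regularity; differentiability of \<open>f\<close> makes
  \<open>\<delta> v + t\<^sub>n z\<^sub>n\<close> an \<open>o(t\<^sub>n)\<close>-approximate solution over \<open>v + t\<^sub>n w\<close>, and the contraction property shows that
  \<open>o(t\<^sub>n)\<close>-approximate solutions are \<open>o(t\<^sub>n)\<close>-close to \<open>\<delta>\<close>. For the higher derivatives one iterates on the
  equation \<open>Tf(v, T\<delta>(v)) = 0\<close>. The map \<open>Tf\<close> is no longer a contraction in the fibre variable, but two weaker
  properties pass from \<open>f\<close> to \<open>Tf\<close>: \<open>o(t\<^sub>n)\<close>-approximate solutions are \<open>o(t\<^sub>n)\<close>-close to the solution
  germ, and the fibre derivative along the graph of the solution germ is onto and sequentially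
  proper. Both follow from the triangular form of \<open>Tf\<close> and its derivative.
\<close>

section \<open>Scales and levelwise convergence\<close>

text \<open>The obstacle is that class sc^1 gives no continuity of Df in operator norm. The map (x,
  h) \<mapsto> Df(x)h is only jointly continuous, with x on level m+1 and h on level m, and the
  remainder of the derivative is small relative to the strong norm of the increment. A linearized
  solution y is therefore not regular enough to serve as an increment of f. Its replacements z_n may
  blow up in the strong norm, as long as t_n z_n tends to 0 there. This is also why all estimates
  are phrased with sequences: joint continuity is used along convergent sequences of points and
  directions. Since V has finite dimension, directions subconverge, and limits along convergent
  directions become Frechet estimates.

  Levels are the currency of the induction. The base component of Tf lives one level higher, so an
  argument for Tf on level m needs the estimates for f on level m+1, whereas the definition of sc^1
  differentiates on level 0 only. The missing levels come from higher tangents: T^(j+m) f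
  differentiable on level 0 makes T^j f differentiable on level m, whenever j + m < k.\<close>

instantiation "fun" :: (type, real_vector) real_vector
begin

definition "scaleR_fun c f = (\<lambda>x. c *\<^sub>R f x)"

instance
  by standard (auto simp: scaleR_fun_def fun_eq_iff scaleR_add_left scaleR_add_right)

end

section \<open>Pairs of sequences: interleaved for tangents, componentwise for direct sums\<close>

lemma scaleR_fun_apply [simp]: "(c *\<^sub>R f) x = c *\<^sub>R f x"
  by (simp add: scaleR_fun_def)

lemma padd_eq [simp]: "padd x y = x + y"
  by (simp add: padd_def fun_eq_iff)

lemma psub_eq [simp]: "psub x y = x - y"
  by (simp add: psub_def fun_eq_iff)

lemma pscale_eq [simp]: "pscale c x = c *\<^sub>R x"
  by (simp add: pscale_def fun_eq_iff)

lemma pzero_eq [simp]: "pzero = 0"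
  by (simp add: pzero_def fun_eq_iff)

lemma evn_linear [simp]:
  "evn 0 = 0" "evn (x + y) = evn x + evn y" "evn (x - y) = evn x - evn y" "evn (c *\<^sub>R x) = c *\<^sub>R evn x"
  by (simp_all add: evn_def fun_eq_iff)

lemma odp_linear [simp]:
  "odp 0 = 0" "odp (x + y) = odp x + odp y" "odp (x - y) = odp x - odp y" "odp (c *\<^sub>R x) = c *\<^sub>R odp x"
  by (simp_all add: odp_def fun_eq_iff)

lemma evn_ilv [simp]: "evn (ilv a b) = a"
  by (simp add: evn_def ilv_def)

lemma odp_ilv [simp]: "odp (ilv a b) = b"
  by (simp add: odp_def ilv_def)

lemma ilv_eqI: "evn x = evn y \<Longrightarrow> odp x = odp y \<Longrightarrow> x = y"
proof
  fix i
  assume "evn x = evn y" "odp x = odp y"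
  then have "x (2 * j) = y (2 * j)" "x (2 * j + 1) = y (2 * j + 1)" for j
    by (simp_all add: evn_def odp_def fun_eq_iff)
  then show "x i = y i"
    by (cases "even i") (auto elim!: evenE oddE)
qed

text \<open>Pairing entry by entry commutes with interleaving. Hence T(V \<oplus> E) and TV \<oplus>
  TE become literally equal (\<open>Tscs_prs\<close>), and the tangent problem has again the form of
  a problem on a direct sum, without any identification map.\<close>

definition pairf :: "(nat \<Rightarrow> 'v) \<Rightarrow> (nat \<Rightarrow> 'e) \<Rightarrow> nat \<Rightarrow> 'v \<times> 'e" where
  "pairf v u = (\<lambda>i. (v i, u i))"

definition fstf :: "(nat \<Rightarrow> 'v \<times> 'e) \<Rightarrow> nat \<Rightarrow> 'v" where
  "fstf x = (\<lambda>i. fst (x i))"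

definition sndf :: "(nat \<Rightarrow> 'v \<times> 'e) \<Rightarrow> nat \<Rightarrow> 'e" where
  "sndf x = (\<lambda>i. snd (x i))"

lemma fstf_simps [simp]:
  "fstf (pairf v u) = v" "fstf 0 = 0" "fstf (x + y) = fstf x + fstf y" "fstf (x - y) = fstf x - fstf y"
  "fstf (c *\<^sub>R x) = c *\<^sub>R fstf x"
  by (simp_all add: fstf_def pairf_def fun_eq_iff)

lemma sndf_simps [simp]:
  "sndf (pairf v u) = u" "sndf 0 = 0" "sndf (x + y) = sndf x + sndf y" "sndf (x - y) = sndf x - sndf y"
  "sndf (c *\<^sub>R x) = c *\<^sub>R sndf x"
  by (simp_all add: sndf_def pairf_def fun_eq_iff)

lemma evn_odp_fstf [simp]: "evn (fstf x) = fstf (evn x)" "odp (fstf x) = fstf (odp x)"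
  by (simp_all add: evn_def odp_def fstf_def)

lemma evn_odp_sndf [simp]: "evn (sndf x) = sndf (evn x)" "odp (sndf x) = sndf (odp x)"
  by (simp_all add: evn_def odp_def sndf_def)

lemma evn_odp_pairf [simp]:
  "evn (pairf v u) = pairf (evn v) (evn u)" "odp (pairf v u) = pairf (odp v) (odp u)"
  by (simp_all add: evn_def odp_def pairf_def)

lemma pairf_eqI: "fstf x = fstf y \<Longrightarrow> sndf x = sndf y \<Longrightarrow> x = y"
  by (simp add: fstf_def sndf_def fun_eq_iff prod_eq_iff)

lemma pairf_zero [simp]: "pairf 0 0 = 0"
  by (rule pairf_eqI) simp_all

lemma pairf_add: "pairf v u + pairf v' u' = (pairf (v + v') (u + u') :: nat \<Rightarrow> 'v::real_vector \<times> 'e::real_vector)"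
  by (rule pairf_eqI) simp_all

lemma pairf_diff: "pairf v u - pairf v' u' = (pairf (v - v') (u - u') :: nat \<Rightarrow> 'v::real_vector \<times> 'e::real_vector)"
  by (rule pairf_eqI) simp_all

lemma pairf_scaleR: "c *\<^sub>R pairf v u = pairf (c *\<^sub>R v) (c *\<^sub>R u)"
  by (rule pairf_eqI) simp_all

declare plus_fun_apply [simp del] zero_fun_apply [simp del] scaleR_fun_apply [simp del] minus_apply [simp del]

definition prs :: "'v scs \<Rightarrow> 'e scs \<Rightarrow> ('v \<times> 'e) scs" where
  "prs V F = \<lparr>lev = (\<lambda>m. {x. fstf x \<in> lev V m \<and> sndf x \<in> lev F m}),
              nrm = (\<lambda>m x. nrm V m (fstf x) + nrm F m (sndf x))\<rparr>"

lemma prs_simps [simp]: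
  "x \<in> lev (prs V F) m \<longleftrightarrow> fstf x \<in> lev V m \<and> sndf x \<in> lev F m"
  "nrm (prs V F) m x = nrm V m (fstf x) + nrm F m (sndf x)"
  by (simp_all add: prs_def)

lemma Tscs_simps [simp]:
  "x \<in> lev (Tscs S) m \<longleftrightarrow> evn x \<in> lev S (Suc m) \<and> odp x \<in> lev S m"
  "nrm (Tscs S) m x = nrm S (Suc m) (evn x) + nrm S m (odp x)"
  by (simp_all add: Tscs_def)

lemma Tgerm_simps [simp]: "x \<in> Tgerm S U m \<longleftrightarrow> evn x \<in> U (Suc m) \<and> odp x \<in> lev S m"
  by (simp add: Tgerm_def)

lemma Tmap_simps [simp]:
  "evn (Tmap f A x) = f (evn x)" "odp (Tmap f A x) = A (evn x) (odp x)"
  by (simp_all add: Tmap_def)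

lemma Tscs_prs: "Tscs (prs V F) = prs (Tscs V) (Tscs F)"
  by (simp add: Tscs_def prs_def fun_eq_iff add_ac set_eq_iff conj_ac)

text \<open>A level norm has no meaning outside its level, so membership is part of convergence. It
  is demanded only eventually because openness of a germ puts sequences into it only for large
  indices.\<close>

definition tends :: "'a::real_vector scs \<Rightarrow> nat \<Rightarrow> (nat \<Rightarrow> nat \<Rightarrow> 'a) \<Rightarrow> (nat \<Rightarrow> 'a) \<Rightarrow> bool" where
  "tends S m X x \<longleftrightarrow> x \<in> lev S m \<and> (\<forall>\<^sub>F n in sequentially. X n \<in> lev S m) \<and>
     (\<lambda>n. nrm S m (X n - x)) \<longlonglongrightarrow> 0"

lemma tends_lev: "tends S m X x \<Longrightarrow> x \<in> lev S m"
  and tends_ev: "tends S m X x \<Longrightarrow> \<forall>\<^sub>F n in sequentially. X n \<in> lev S m"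
  and tends_lim: "tends S m X x \<Longrightarrow> (\<lambda>n. nrm S m (X n - x)) \<longlonglongrightarrow> 0"
  by (simp_all add: tends_def)

lemma tends_cong:
  assumes "tends S m X x" and "\<forall>\<^sub>F n in sequentially. X n = Y n"
  shows "tends S m Y x"
proof -
  have "\<forall>\<^sub>F n in sequentially. Y n \<in> lev S m"
    using tends_ev[OF assms(1)] assms(2) by eventually_elim simp
  moreover have "(\<lambda>n. nrm S m (Y n - x)) \<longlonglongrightarrow> 0"
    using tends_lim[OF assms(1)] by (rule Lim_transform_eventually)
      (use assms(2) in eventually_elim, simp)
  ultimately show ?thesis
    using assms(1) by (simp add: tends_def)
qed

lemma tends_subseq: "tends S m X x \<Longrightarrow> strict_mono r \<Longrightarrow> tends S m (\<lambda>n. X (r n)) x"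
  unfolding tends_def
  by (auto dest: LIMSEQ_subseq_LIMSEQ simp: o_def intro: eventually_subseq)

text \<open>The properties used at every tangent stage; all are inherited by \<open>Tscs\<close> and
  \<open>prs\<close>. Completeness and compact inclusions are assumed separately in
  \<open>sc_contraction\<close>, where the initial problem is treated.\<close>

locale sc_scale =
  fixes S :: "'a::real_vector scs"
  assumes sub: "subspace (lev S m)"
    and decr: "lev S (Suc m) \<subseteq> lev S m"
    and nonneg [simp]: "x \<in> lev S m \<Longrightarrow> 0 \<le> nrm S m x"
    and definite: "x \<in> lev S m \<Longrightarrow> nrm S m x = 0 \<Longrightarrow> x = 0"
    and triangle: "x \<in> lev S m \<Longrightarrow> y \<in> lev S m \<Longrightarrow> nrm S m (x + y) \<le> nrm S m x + nrm S m y"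
    and homog: "x \<in> lev S m \<Longrightarrow> nrm S m (c *\<^sub>R x) = \<bar>c\<bar> * nrm S m x"
    and embed: "\<exists>c. \<forall>x\<in>lev S (Suc m). nrm S m x \<le> c * nrm S (Suc m) x"
    and dense: "x \<in> lev S m \<Longrightarrow> 0 < e \<Longrightarrow> \<exists>y\<in>lev S (Suc m). nrm S m (y - x) < e"
begin

lemma lev_zero [simp]: "0 \<in> lev S m"
  and lev_add [simp]: "x \<in> lev S m \<Longrightarrow> y \<in> lev S m \<Longrightarrow> x + y \<in> lev S m"
  and lev_diff [simp]: "x \<in> lev S m \<Longrightarrow> y \<in> lev S m \<Longrightarrow> x - y \<in> lev S m"
  and lev_scaleR [simp]: "x \<in> lev S m \<Longrightarrow> c *\<^sub>R x \<in> lev S m"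
  using sub by (simp_all add: subspace_0 subspace_add subspace_diff subspace_scale)

lemma lev_uminus [simp]: "x \<in> lev S m \<Longrightarrow> - x \<in> lev S m"
  using lev_diff[of 0 m x] by simp

lemma lev_Suc: "x \<in> lev S (Suc m) \<Longrightarrow> x \<in> lev S m"
  using decr by auto

lemma lev_le: "m \<le> n \<Longrightarrow> x \<in> lev S n \<Longrightarrow> x \<in> lev S m"
  using lift_Suc_antimono_le[of "lev S" m n] decr by blast

lemma nrm_zero [simp]: "nrm S m 0 = 0"
  using homog[of 0 m 0] by simp

lemma nrm_uminus: "x \<in> lev S m \<Longrightarrow> nrm S m (- x) = nrm S m x"
  using homog[of x m "-1"] by simp

lemma nrm_minus_commute: "x \<in> lev S m \<Longrightarrow> y \<in> lev S m \<Longrightarrow> nrm S m (x - y) = nrm S m (y - x)"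
  using nrm_uminus[of "x - y" m] by simp

lemma nrm_diff_le: "x \<in> lev S m \<Longrightarrow> y \<in> lev S m \<Longrightarrow> nrm S m (x - y) \<le> nrm S m x + nrm S m y"
  using triangle[of x m "- y"] nrm_uminus[of y m] by simp

lemma nrm_triangle3:
  "x \<in> lev S m \<Longrightarrow> y \<in> lev S m \<Longrightarrow> z \<in> lev S m \<Longrightarrow> nrm S m (x - z) \<le> nrm S m (x - y) + nrm S m (y - z)"
  using triangle[of "x - y" m "y - z"] by simp

lemma tendsI:
  assumes "x \<in> lev S m" "\<forall>\<^sub>F n in sequentially. X n \<in> lev S m"
    and "\<And>n. X n \<in> lev S m \<Longrightarrow> nrm S m (X n - x) \<le> g n" "g \<longlonglongrightarrow> 0"
  shows "tends S m X x"
proof -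
  have "\<forall>\<^sub>F n in sequentially. norm (nrm S m (X n - x)) \<le> g n"
    using assms(2) by eventually_elim (use assms in auto)
  then show ?thesis
    unfolding tends_def using assms by (auto intro: Lim_null_comparison)
qed

lemma tends_evI:
  assumes "x \<in> lev S m" "\<forall>\<^sub>F n in sequentially. X n \<in> lev S m \<and> nrm S m (X n - x) \<le> g n" "g \<longlonglongrightarrow> 0"
  shows "tends S m X x"
proof -
  have "\<forall>\<^sub>F n in sequentially. X n \<in> lev S m"
    using assms(2) by eventually_elim auto
  moreover have "\<forall>\<^sub>F n in sequentially. norm (nrm S m (X n - x)) \<le> g n"
    using assms(2) by eventually_elim (use assms in auto)
  ultimately show ?thesis
    unfolding tends_def using assms by (auto intro: Lim_null_comparison)
qed

lemma tends_const: "x \<in> lev S m \<Longrightarrow> tends S m (\<lambda>n. x) x"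
  by (simp add: tends_def)

lemma tends_add:
  assumes "tends S m X x" "tends S m Y y"
  shows "tends S m (\<lambda>n. X n + Y n) (x + y)"
proof (rule tends_evI)
  show "x + y \<in> lev S m"
    using assms[THEN tends_lev] by simp
  show "\<forall>\<^sub>F n in sequentially. X n + Y n \<in> lev S m \<and>
      nrm S m (X n + Y n - (x + y)) \<le> nrm S m (X n - x) + nrm S m (Y n - y)"
    using tends_ev[OF assms(1)] tends_ev[OF assms(2)]
  proof eventually_elim
    case (elim n)
    then show ?case
      using triangle[of "X n - x" m "Y n - y"] assms[THEN tends_lev] by (simp add: algebra_simps)
  qed
  show "(\<lambda>n. nrm S m (X n - x) + nrm S m (Y n - y)) \<longlonglongrightarrow> 0"
    using tendsto_add[OF tends_lim[OF assms(1)] tends_lim[OF assms(2)]] by simp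
qed

lemma tends_scaleR:
  assumes "c \<longlonglongrightarrow> a" "tends S m X x"
  shows "tends S m (\<lambda>n. c n *\<^sub>R X n) (a *\<^sub>R x)"
proof (rule tends_evI)
  show "a *\<^sub>R x \<in> lev S m"
    using assms by (auto dest: tends_lev)
  show "\<forall>\<^sub>F n in sequentially. c n *\<^sub>R X n \<in> lev S m \<and>
      nrm S m (c n *\<^sub>R X n - a *\<^sub>R x) \<le> \<bar>c n\<bar> * nrm S m (X n - x) + \<bar>c n - a\<bar> * nrm S m x"
    using tends_ev[OF assms(2)]
  proof eventually_elim
    case (elim n)
    then show ?case
      using triangle[of "c n *\<^sub>R (X n - x)" m "(c n - a) *\<^sub>R x"] tends_lev[OF assms(2)]
        homog[of "X n - x" m "c n"] homog[of x m "c n - a"]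
      by (simp add: scaleR_diff_right scaleR_diff_left)
  qed
  have "(\<lambda>n. c n - a) \<longlonglongrightarrow> 0"
    using assms(1) by (rule LIM_zero)
  then have "(\<lambda>n. \<bar>c n\<bar> * nrm S m (X n - x) + \<bar>c n - a\<bar> * nrm S m x) \<longlonglongrightarrow> \<bar>a\<bar> * 0 + \<bar>0\<bar> * nrm S m x"
    by (intro tendsto_intros tends_lim[OF assms(2)] assms)
  then show "(\<lambda>n. \<bar>c n\<bar> * nrm S m (X n - x) + \<bar>c n - a\<bar> * nrm S m x) \<longlonglongrightarrow> 0"
    by simp
qed

lemma tends_diff:
  assumes "tends S m X x" "tends S m Y y"
  shows "tends S m (\<lambda>n. X n - Y n) (x - y)"
  using tends_add[OF assms(1) tends_scaleR[OF tendsto_const assms(2), of "-1"]] by simp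

lemma tends_unique:
  assumes "tends S m X x" "tends S m X y"
  shows "x = y"
proof -
  have "tends S m (\<lambda>n. 0) (x - y)"
    using tends_diff[OF assms] by simp
  then have "nrm S m (- (x - y)) = 0" "x - y \<in> lev S m"
    by (auto simp: tends_def LIMSEQ_const_iff)
  then show ?thesis
    using definite[of "x - y" m] nrm_uminus[of "x - y" m] by simp
qed

lemma tends_Suc:
  assumes "tends S (Suc m) X x"
  shows "tends S m X x"
proof -
  obtain c where c: "nrm S m x \<le> c * nrm S (Suc m) x" if "x \<in> lev S (Suc m)" for x
    using embed by blast
  show ?thesis
  proof (rule tends_evI)
    show "x \<in> lev S m"
      using tends_lev[OF assms] by (rule lev_Suc)
    show "\<forall>\<^sub>F n in sequentially. X n \<in> lev S m \<and> nrm S m (X n - x) \<le> c * nrm S (Suc m) (X n - x)"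
      using tends_ev[OF assms] by eventually_elim (use tends_lev[OF assms] c lev_Suc in auto)
    show "(\<lambda>n. c * nrm S (Suc m) (X n - x)) \<longlonglongrightarrow> 0"
      using tendsto_mult_left[OF tends_lim[OF assms], of c] by simp
  qed
qed

lemma tends_le: "m \<le> n \<Longrightarrow> tends S n X x \<Longrightarrow> tends S m X x"
  by (induction rule: inc_induct) (auto intro: tends_Suc)

lemma tends_nrm:
  assumes "tends S m X x"
  shows "(\<lambda>n. nrm S m (X n)) \<longlonglongrightarrow> nrm S m x"
proof (rule LIM_zero_cancel, rule Lim_null_comparison)
  show "\<forall>\<^sub>F n in sequentially. norm (nrm S m (X n) - nrm S m x) \<le> nrm S m (X n - x)"
    using tends_ev[OF assms]
  proof eventually_elim
    case (elim n)
    then show ?case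
      using triangle[of "X n - x" m x] triangle[of "x - X n" m "X n"] tends_lev[OF assms]
        nrm_minus_commute[of "X n" m x] by auto
  qed
qed (rule tends_lim[OF assms])

lemma tends_zero_iff:
  "tends S m X 0 \<longleftrightarrow> (\<forall>\<^sub>F n in sequentially. X n \<in> lev S m) \<and> (\<lambda>n. nrm S m (X n)) \<longlonglongrightarrow> 0"
  by (simp add: tends_def)

lemma dense_seq:
  assumes "x \<in> lev S m"
  obtains X where "\<And>n. X n \<in> lev S (Suc m)" "tends S m X x"
proof -
  have "\<forall>n. \<exists>y\<in>lev S (Suc m). nrm S m (y - x) < 1 / real (Suc n)"
    using dense[OF assms] by simp
  then obtain X where X: "\<And>n. X n \<in> lev S (Suc m)" "\<And>n. nrm S m (X n - x) < 1 / real (Suc n)"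
    by metis
  have "tends S m X x"
  proof (rule tendsI[OF assms])
    show "(\<lambda>n. 1 / real (Suc n)) \<longlonglongrightarrow> 0"
      by (rule LIMSEQ_Suc[OF lim_1_over_n])
    show "nrm S m (X n - x) \<le> 1 / real (Suc n)" for n
      using X(2) by (rule less_imp_le)
  qed (use X lev_Suc in \<open>auto intro!: always_eventually\<close>)
  then show ?thesis
    using X that by blast
qed

end

section \<open>Tangent scales, products and Hadamard differentiability\<close>

text \<open>Abstracts the finite-dimensional parameter space and its tangents: levels do not matter,
  and bounded sequences subconverge. The latter turns statements about convergent directions into
  uniform ones (\<open>D_bounded\<close>, \<open>sol_frechet\<close>).\<close>

locale const_scale = sc_scale S for S :: "'a::real_vector scs" +
  assumes lev_const: "lev S m = lev S n"
    and nrm_const: "nrm S m = nrm S n"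
    and compact: "(\<And>n. X n \<in> lev S 0 \<and> nrm S 0 (X n) \<le> K) \<Longrightarrow>
      \<exists>r x. strict_mono (r :: nat \<Rightarrow> nat) \<and> tends S 0 (\<lambda>n. X (r n)) x"
begin

lemma tends_level: "tends S m X x \<Longrightarrow> tends S n X x"
  using lev_const[of m n] nrm_const[of m n] by (simp add: tends_def)

lemma lev_level: "x \<in> lev S m \<Longrightarrow> x \<in> lev S n"
  using lev_const[of m n] by simp

end

lemma sc_scale_Tscs:
  assumes "sc_scale S"
  shows "sc_scale (Tscs S)"
proof -
  interpret sc_scale S by fact
  show ?thesis
  proof
    fix m and x y :: "nat \<Rightarrow> 'a" and c :: real
    show "subspace (lev (Tscs S) m)"
      unfolding subspace_def by simp
    show "lev (Tscs S) (Suc m) \<subseteq> lev (Tscs S) m"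
      by (auto intro: lev_Suc)
    {
      assume x: "x \<in> lev (Tscs S) m"
      show "0 \<le> nrm (Tscs S) m x"
        using x by (simp add: add_nonneg_nonneg)
      show "x = 0" if "nrm (Tscs S) m x = 0"
      proof (rule ilv_eqI)
        have "nrm S (Suc m) (evn x) = 0 \<and> nrm S m (odp x) = 0"
          using that x by (simp add: add_nonneg_eq_0_iff)
        then show "evn x = evn 0" "odp x = odp 0"
          using x definite by auto
      qed
      show "nrm (Tscs S) m (x + y) \<le> nrm (Tscs S) m x + nrm (Tscs S) m y" if "y \<in> lev (Tscs S) m"
        using x that triangle[of "evn x" "Suc m" "evn y"] triangle[of "odp x" m "odp y"] by simp
      show "nrm (Tscs S) m (c *\<^sub>R x) = \<bar>c\<bar> * nrm (Tscs S) m x"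
        using x by (simp add: homog distrib_left)
      fix e :: real
      assume "0 < e"
      then obtain a b where "a \<in> lev S (Suc (Suc m))" "nrm S (Suc m) (a - evn x) < e / 2"
        "b \<in> lev S (Suc m)" "nrm S m (b - odp x) < e / 2"
        using dense[of "evn x" "Suc m" "e / 2"] dense[of "odp x" m "e / 2"] x by auto
      then show "\<exists>y\<in>lev (Tscs S) (Suc m). nrm (Tscs S) m (y - x) < e"
        by (intro bexI[of _ "ilv a b"]) auto
    }
    obtain c1 c2 where c: "\<And>x. x \<in> lev S (Suc (Suc m)) \<Longrightarrow> nrm S (Suc m) x \<le> c1 * nrm S (Suc (Suc m)) x"
      "\<And>x. x \<in> lev S (Suc m) \<Longrightarrow> nrm S m x \<le> c2 * nrm S (Suc m) x"
      using embed by metis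
    show "\<exists>c. \<forall>x\<in>lev (Tscs S) (Suc m). nrm (Tscs S) m x \<le> c * nrm (Tscs S) (Suc m) x"
    proof (intro exI[of _ "\<bar>c1\<bar> + \<bar>c2\<bar>"] ballI)
      fix x
      assume x: "x \<in> lev (Tscs S) (Suc m)"
      let ?p = "nrm S (Suc (Suc m)) (evn x)" and ?q = "nrm S (Suc m) (odp x)"
      have pq: "0 \<le> ?p" "0 \<le> ?q"
        using x by simp_all
      have "c1 * ?p \<le> \<bar>c1\<bar> * ?p" "c2 * ?q \<le> \<bar>c2\<bar> * ?q" "0 \<le> \<bar>c1\<bar> * ?q" "0 \<le> \<bar>c2\<bar> * ?p"
        using pq by (auto intro: mult_right_mono)
      then show "nrm (Tscs S) m x \<le> (\<bar>c1\<bar> + \<bar>c2\<bar>) * nrm (Tscs S) (Suc m) x"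
        using c(1)[of "evn x"] c(2)[of "odp x"] x unfolding Tscs_simps distrib_left distrib_right by linarith
    qed
  qed
qed

lemma sc_scale_prs:
  assumes "sc_scale V" "sc_scale F"
  shows "sc_scale (prs V F)"
proof -
  interpret V: sc_scale V by fact
  interpret F: sc_scale F by fact
  show ?thesis
  proof
    fix m and x y :: "nat \<Rightarrow> 'a \<times> 'b" and c :: real
    show "subspace (lev (prs V F) m)"
      unfolding subspace_def by simp
    show "lev (prs V F) (Suc m) \<subseteq> lev (prs V F) m"
      by (auto intro: V.lev_Suc F.lev_Suc)
    {
      assume x: "x \<in> lev (prs V F) m"
      show "0 \<le> nrm (prs V F) m x"
        using x by (simp add: add_nonneg_nonneg)
      show "x = 0" if "nrm (prs V F) m x = 0"
      proof (rule pairf_eqI)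
        have "nrm V m (fstf x) = 0 \<and> nrm F m (sndf x) = 0"
          using that x by (simp add: add_nonneg_eq_0_iff)
        then show "fstf x = fstf 0" "sndf x = sndf 0"
          using x V.definite F.definite by auto
      qed
      show "nrm (prs V F) m (x + y) \<le> nrm (prs V F) m x + nrm (prs V F) m y" if "y \<in> lev (prs V F) m"
        using x that V.triangle[of "fstf x" m "fstf y"] F.triangle[of "sndf x" m "sndf y"] by simp
      show "nrm (prs V F) m (c *\<^sub>R x) = \<bar>c\<bar> * nrm (prs V F) m x"
        using x by (simp add: V.homog F.homog distrib_left)
      fix e :: real
      assume "0 < e"
      then obtain a b where "a \<in> lev V (Suc m)" "nrm V m (a - fstf x) < e / 2"
        "b \<in> lev F (Suc m)" "nrm F m (b - sndf x) < e / 2"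
        using V.dense[of "fstf x" m "e / 2"] F.dense[of "sndf x" m "e / 2"] x by auto
      then show "\<exists>y\<in>lev (prs V F) (Suc m). nrm (prs V F) m (y - x) < e"
        by (intro bexI[of _ "pairf a b"]) auto
    }
    obtain c1 c2 where c: "\<And>x. x \<in> lev V (Suc m) \<Longrightarrow> nrm V m x \<le> c1 * nrm V (Suc m) x"
      "\<And>x. x \<in> lev F (Suc m) \<Longrightarrow> nrm F m x \<le> c2 * nrm F (Suc m) x"
      using V.embed F.embed by metis
    show "\<exists>c. \<forall>x\<in>lev (prs V F) (Suc m). nrm (prs V F) m x \<le> c * nrm (prs V F) (Suc m) x"
    proof (intro exI[of _ "\<bar>c1\<bar> + \<bar>c2\<bar>"] ballI)
      fix x
      assume x: "x \<in> lev (prs V F) (Suc m)"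
      let ?p = "nrm V (Suc m) (fstf x)" and ?q = "nrm F (Suc m) (sndf x)"
      have pq: "0 \<le> ?p" "0 \<le> ?q"
        using x by simp_all
      have "c1 * ?p \<le> \<bar>c1\<bar> * ?p" "c2 * ?q \<le> \<bar>c2\<bar> * ?q" "0 \<le> \<bar>c1\<bar> * ?q" "0 \<le> \<bar>c2\<bar> * ?p"
        using pq by (auto intro: mult_right_mono)
      then show "nrm (prs V F) m x \<le> (\<bar>c1\<bar> + \<bar>c2\<bar>) * nrm (prs V F) (Suc m) x"
        using c(1)[of "fstf x"] c(2)[of "sndf x"] x unfolding prs_simps distrib_left distrib_right by linarith
    qed
  qed
qed

lemma tends_Tscs:
  assumes "sc_scale S"
  shows "tends (Tscs S) m X x \<longleftrightarrow> tends S (Suc m) (\<lambda>n. evn (X n)) (evn x) \<and> tends S m (\<lambda>n. odp (X n)) (odp x)"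
    (is "?L \<longleftrightarrow> ?R")
proof -
  interpret S: sc_scale S by fact
  interpret T: sc_scale "Tscs S"
    using assms by (rule sc_scale_Tscs)
  show ?thesis
  proof
    assume L: ?L
    then have "\<forall>\<^sub>F n in sequentially. evn (X n) \<in> lev S (Suc m) \<and>
        nrm S (Suc m) (evn (X n) - evn x) \<le> nrm (Tscs S) m (X n - x)"
      "\<forall>\<^sub>F n in sequentially. odp (X n) \<in> lev S m \<and>
        nrm S m (odp (X n) - odp x) \<le> nrm (Tscs S) m (X n - x)"
      using tends_ev[OF L] by (auto elim!: eventually_mono dest!: tends_lev)
    with L show ?R
      by (auto intro!: S.tends_evI[of _ _ _ "\<lambda>n. nrm (Tscs S) m (X n - x)"] dest: tends_lev tends_lim)
  next
    assume R: ?R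
    then have "\<forall>\<^sub>F n in sequentially. X n \<in> lev (Tscs S) m"
      by (auto simp: eventually_conj_iff dest!: tends_ev)
    moreover have "(\<lambda>n. nrm S (Suc m) (evn (X n) - evn x) + nrm S m (odp (X n) - odp x)) \<longlonglongrightarrow> 0 + 0"
      using R by (intro tendsto_add) (auto dest: tends_lim)
    ultimately show ?L
      using R unfolding tends_def[of "Tscs S"] by (simp add: tends_def)
  qed
qed

lemma tends_prs:
  assumes "sc_scale V" "sc_scale F"
  shows "tends (prs V F) m X x \<longleftrightarrow> tends V m (\<lambda>n. fstf (X n)) (fstf x) \<and> tends F m (\<lambda>n. sndf (X n)) (sndf x)"
    (is "?L \<longleftrightarrow> ?R")
proof -
  interpret V: sc_scale V by fact
  interpret F: sc_scale F by fact
  show ?thesis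
  proof
    assume L: ?L
    then have "\<forall>\<^sub>F n in sequentially. fstf (X n) \<in> lev V m \<and>
        nrm V m (fstf (X n) - fstf x) \<le> nrm (prs V F) m (X n - x)"
      "\<forall>\<^sub>F n in sequentially. sndf (X n) \<in> lev F m \<and>
        nrm F m (sndf (X n) - sndf x) \<le> nrm (prs V F) m (X n - x)"
      using tends_ev[OF L] by (auto elim!: eventually_mono dest!: tends_lev)
    with L show ?R
      by (auto intro!: V.tends_evI[of _ _ _ "\<lambda>n. nrm (prs V F) m (X n - x)"]
          F.tends_evI[of _ _ _ "\<lambda>n. nrm (prs V F) m (X n - x)"] dest: tends_lev tends_lim)
  next
    assume R: ?R
    then have "\<forall>\<^sub>F n in sequentially. X n \<in> lev (prs V F) m"
      by (auto simp: eventually_conj_iff dest!: tends_ev)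
    moreover have "(\<lambda>n. nrm V m (fstf (X n) - fstf x) + nrm F m (sndf (X n) - sndf x)) \<longlonglongrightarrow> 0 + 0"
      using R by (intro tendsto_add) (auto dest: tends_lim)
    ultimately show ?L
      using R unfolding tends_def[of "prs V F"] by (simp add: tends_def)
  qed
qed

lemma const_scale_Tscs:
  assumes "const_scale S"
  shows "const_scale (Tscs S)"
proof -
  interpret const_scale S by fact
  interpret T: sc_scale "Tscs S"
    by (rule sc_scale_Tscs) unfold_locales
  show ?thesis
  proof
    fix m n X K
    show "lev (Tscs S) m = lev (Tscs S) n"
      using lev_const[of "Suc m" "Suc n"] lev_const[of m n] by auto
    show "nrm (Tscs S) m = nrm (Tscs S) n"
      using nrm_const[of "Suc m" "Suc n"] nrm_const[of m n] by auto
    assume "\<And>n::nat. X n \<in> lev (Tscs S) 0 \<and> nrm (Tscs S) 0 (X n) \<le> K"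
    then have X: "evn (X n) \<in> lev S 0" "odp (X n) \<in> lev S 0" "nrm S 0 (evn (X n)) + nrm S 0 (odp (X n)) \<le> K" for n
      using lev_const[of "Suc 0" 0] nrm_const[of "Suc 0" 0] by simp_all
    have "evn (X n) \<in> lev S 0 \<and> nrm S 0 (evn (X n)) \<le> K" for n
      using X[of n] nonneg[of "odp (X n)" 0] by linarith
    then obtain r x where r: "strict_mono (r :: nat \<Rightarrow> nat)" "tends S 0 (\<lambda>n. evn (X (r n))) x"
      using compact[of "\<lambda>n. evn (X n)" K] by blast
    have "odp (X (r n)) \<in> lev S 0 \<and> nrm S 0 (odp (X (r n))) \<le> K" for n
      using X[of "r n"] nonneg[of "evn (X (r n))" 0] by linarith
    then obtain s y where s: "strict_mono (s :: nat \<Rightarrow> nat)" "tends S 0 (\<lambda>n. odp (X (r (s n)))) y"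
      using compact[of "\<lambda>n. odp (X (r n))" K] by blast
    have "tends (Tscs S) 0 (\<lambda>n. X (r (s n))) (ilv x y)"
      using s tends_subseq[OF r(2) s(1)] sc_scale_axioms
      by (auto simp: tends_Tscs intro: tends_level)
    moreover have "strict_mono (\<lambda>n. r (s n))"
      using strict_mono_o[OF r(1) s(1)] by (simp add: o_def)
    ultimately show "\<exists>r x. strict_mono (r :: nat \<Rightarrow> nat) \<and> tends (Tscs S) 0 (\<lambda>n. X (r n)) x"
      by blast
  qed
qed

section \<open>Sc^0 maps and convergent sequences\<close>

lemma sc0_lev: "sc0 S F U f \<Longrightarrow> x \<in> U m \<Longrightarrow> f x \<in> lev F m"
  unfolding sc0_def by blast

lemma sc0_cont:
  "sc0 S F U f \<Longrightarrow> x \<in> U m \<Longrightarrow> 0 < e \<Longrightarrow>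
    \<exists>d>0. \<forall>y\<in>U m. nrm S m (y - x) < d \<longrightarrow> nrm F m (f y - f x) < e"
  by (simp add: sc0_def)

lemma sc0_tends:
  assumes f: "sc0 S F U f" and X: "tends S m X x" and x: "x \<in> U m"
    and ev: "\<forall>\<^sub>F n in sequentially. X n \<in> U m" and F: "sc_scale F"
  shows "tends F m (\<lambda>n. f (X n)) (f x)"
proof -
  interpret F: sc_scale F by fact
  have "(\<lambda>n. nrm F m (f (X n) - f x)) \<longlonglongrightarrow> 0"
  proof (rule tendstoI)
    fix e :: real
    assume "0 < e"
    then obtain d where d: "d > 0" "\<And>y. y \<in> U m \<Longrightarrow> nrm S m (y - x) < d \<Longrightarrow> nrm F m (f y - f x) < e"
      using sc0_cont[OF f x] by blast
    show "\<forall>\<^sub>F n in sequentially. dist (nrm F m (f (X n) - f x)) 0 < e"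
      using order_tendstoD(2)[OF tends_lim[OF X] d(1)] ev
    proof eventually_elim
      case (elim n)
      then show ?case
        using d(2)[of "X n"] F.nonneg[of "f (X n) - f x" m] sc0_lev[OF f] x by (simp add: dist_real_def)
    qed
  qed
  then show ?thesis
    unfolding tends_def using ev x sc0_lev[OF f] by (auto elim: eventually_mono)
qed

text \<open>If the epsilon-delta condition failed at x, choosing a bad point at distance below
  1/(n+1) for each n would give a sequence tending to x whose images do not tend to f x.\<close>

lemma sc0I_tends:
  assumes "f 0 = 0" and U: "\<And>m x. x \<in> U m \<Longrightarrow> x \<in> lev S m"
    and lev: "\<And>m x. x \<in> U m \<Longrightarrow> f x \<in> lev F m"
    and tends: "\<And>m x X. x \<in> U m \<Longrightarrow> (\<And>n. X n \<in> U m) \<Longrightarrow> tends S m X x \<Longrightarrow> tends F m (\<lambda>n. f (X n)) (f x)"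
    and S: "sc_scale S"
  shows "sc0 S F U f"
proof -
  interpret S: sc_scale S by fact
  have "\<exists>d>0. \<forall>y\<in>U m. nrm S m (y - x) < d \<longrightarrow> nrm F m (f y - f x) < e" if x: "x \<in> U m" and e: "0 < e" for m x e
  proof (rule ccontr)
    assume "\<not> ?thesis"
    then have "\<forall>n. \<exists>y\<in>U m. nrm S m (y - x) < 1 / real (Suc n) \<and> \<not> nrm F m (f y - f x) < e"
      by (metis zero_less_divide_1_iff of_nat_0_less_iff zero_less_Suc)
    then obtain X where X: "\<And>n. X n \<in> U m" "\<And>n. nrm S m (X n - x) < 1 / real (Suc n)"
      "\<And>n. \<not> nrm F m (f (X n) - f x) < e"
      by metis
    have "tends S m X x"
    proof (rule S.tendsI)
      show "(\<lambda>n. 1 / real (Suc n)) \<longlonglongrightarrow> 0"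
        by (rule LIMSEQ_Suc[OF lim_1_over_n])
      show "nrm S m (X n - x) \<le> 1 / real (Suc n)" for n
        using X(2) by (rule less_imp_le)
    qed (use X x U in auto)
    from tends[OF x X(1) this] have "(\<lambda>n. nrm F m (f (X n) - f x)) \<longlonglongrightarrow> 0"
      by (rule tends_lim)
    from order_tendstoD(2)[OF this e] show False
      using X(3) by (simp add: eventually_sequentially)
  qed
  then show ?thesis
    unfolding sc0_def using assms(1) lev by (auto simp: image_subset_iff)
qed

text \<open>For each e > 0, the estimate with slope M + e over an interval [a, b] is additive under
  concatenation and holds on short intervals around any point by differentiability there. Bisection
  (\<open>Bolzano\<close>) extends it to [0, 1].\<close>

lemma (in sc_scale) mean_value:
  assumes phi: "\<And>s. s \<in> {0..1} \<Longrightarrow> \<phi> s \<in> lev S m" and phi': "\<And>s. s \<in> {0..1} \<Longrightarrow> \<phi>' s \<in> lev S m"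
    and c: "c \<in> lev S m"
    and deriv: "\<And>s e. s \<in> {0..1} \<Longrightarrow> 0 < e \<Longrightarrow> \<exists>d>0. \<forall>s'\<in>{0..1}. \<bar>s' - s\<bar> < d \<longrightarrow>
      nrm S m (\<phi> s' - \<phi> s - (s' - s) *\<^sub>R \<phi>' s) \<le> e * \<bar>s' - s\<bar>"
    and bound: "\<And>s. s \<in> {0..1::real} \<Longrightarrow> nrm S m (\<phi>' s - c) \<le> M"
  shows "nrm S m (\<phi> 1 - \<phi> 0 - c) \<le> M"
proof (rule field_le_epsilon)
  fix e :: real
  assume e: "0 < e"
  define P where "P a b \<longleftrightarrow> (0 \<le> a \<longrightarrow> a \<le> b \<longrightarrow> b \<le> 1 \<longrightarrow>
    nrm S m (\<phi> b - \<phi> a - (b - a) *\<^sub>R c) \<le> (M + e) * (b - a))" for a b :: real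
  have "P 0 1"
    using zero_le_one[where 'a = real]
  proof (induction rule: Bolzano[where P = P])
    case (trans a b d)
    show ?case
      unfolding P_def
    proof (intro impI)
      assume h: "0 \<le> a" "a \<le> d" "d \<le> 1"
      have eq: "\<phi> d - \<phi> a - (d - a) *\<^sub>R c = (\<phi> b - \<phi> a - (b - a) *\<^sub>R c) + (\<phi> d - \<phi> b - (d - b) *\<^sub>R c)"
        by (simp add: scaleR_diff_left algebra_simps)
      have "nrm S m (\<phi> d - \<phi> a - (d - a) *\<^sub>R c) \<le> nrm S m (\<phi> b - \<phi> a - (b - a) *\<^sub>R c) + nrm S m (\<phi> d - \<phi> b - (d - b) *\<^sub>R c)"
        unfolding eq by (rule triangle) (use phi c h trans in auto)
      also have "\<dots> \<le> (M + e) * (b - a) + (M + e) * (d - b)"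
        using trans h by (intro add_mono) (auto simp: P_def)
      finally show "nrm S m (\<phi> d - \<phi> a - (d - a) *\<^sub>R c) \<le> (M + e) * (d - a)"
        by (simp add: algebra_simps)
    qed
  next
    case (local x)
    then obtain d where d: "d > 0" "\<And>s'. s' \<in> {0..1} \<Longrightarrow> \<bar>s' - x\<bar> < d \<Longrightarrow>
        nrm S m (\<phi> s' - \<phi> x - (s' - x) *\<^sub>R \<phi>' x) \<le> e * \<bar>s' - x\<bar>"
      using deriv[of x e] e by auto
    have "P a b" if ab: "a \<le> x" "x \<le> b" "b - a < d" for a b
      unfolding P_def
    proof (intro impI)
      assume h: "0 \<le> a" "a \<le> b" "b \<le> 1"
      have lev: "\<phi> a \<in> lev S m" "\<phi> b \<in> lev S m" "\<phi> x \<in> lev S m" "\<phi>' x \<in> lev S m"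
        using h local phi phi' by auto
      \<comment> \<open>Splitting at x gives two remainders of the derivative at x, one for each
        endpoint, plus the deviation of that derivative from c.\<close>
      have eq: "\<phi> b - \<phi> a - (b - a) *\<^sub>R c = (\<phi> b - \<phi> x - (b - x) *\<^sub>R \<phi>' x)
          - (\<phi> a - \<phi> x - (a - x) *\<^sub>R \<phi>' x) + (b - a) *\<^sub>R (\<phi>' x - c)"
        by (simp add: scaleR_diff_left scaleR_diff_right algebra_simps)
      have "nrm S m (\<phi> b - \<phi> a - (b - a) *\<^sub>R c) \<le> nrm S m (\<phi> b - \<phi> x - (b - x) *\<^sub>R \<phi>' x)
          + nrm S m (\<phi> a - \<phi> x - (a - x) *\<^sub>R \<phi>' x) + nrm S m ((b - a) *\<^sub>R (\<phi>' x - c))"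
        unfolding eq by (rule order_trans[OF triangle add_right_mono[OF nrm_diff_le]]) (use lev c in auto)
      also have "\<dots> \<le> e * (b - x) + e * (x - a) + (b - a) * M"
      proof (intro add_mono)
        show "nrm S m (\<phi> b - \<phi> x - (b - x) *\<^sub>R \<phi>' x) \<le> e * (b - x)"
          using d(2)[of b] ab h by auto
        show "nrm S m (\<phi> a - \<phi> x - (a - x) *\<^sub>R \<phi>' x) \<le> e * (x - a)"
          using d(2)[of a] ab h by auto
        show "nrm S m ((b - a) *\<^sub>R (\<phi>' x - c)) \<le> (b - a) * M"
          using bound[of x] local lev c h by (auto simp: homog intro: mult_left_mono)
      qed
      finally show "nrm S m (\<phi> b - \<phi> a - (b - a) *\<^sub>R c) \<le> (M + e) * (b - a)"
        by (simp add: algebra_simps)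
    qed
    then show ?case
      using d(1) by blast
  qed
  then show "nrm S m (\<phi> 1 - \<phi> 0 - c) \<le> M + e"
    by (simp add: P_def)
qed

text \<open>The remainder clause of \<open>is_scD\<close>, with every level raised by m. The class
  sc^1 supplies it for m = 0; larger m are obtained from higher tangent maps through
  \<open>frech_up\<close>.\<close>

definition frech :: "'a::real_vector scs \<Rightarrow> 'b::real_vector scs \<Rightarrow> (nat \<Rightarrow> (nat \<Rightarrow> 'a) set)
    \<Rightarrow> ((nat \<Rightarrow> 'a) \<Rightarrow> (nat \<Rightarrow> 'b)) \<Rightarrow> ((nat \<Rightarrow> 'a) \<Rightarrow> (nat \<Rightarrow> 'a) \<Rightarrow> (nat \<Rightarrow> 'b)) \<Rightarrow> nat \<Rightarrow> bool" where
  "frech S F U f A m \<longleftrightarrow> (\<forall>x\<in>U (Suc m). \<forall>e>0. \<exists>d>0. \<forall>h.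
     h \<in> lev S (Suc m) \<and> x + h \<in> U (Suc m) \<and> 0 < nrm S (Suc m) h \<and> nrm S (Suc m) h < d
     \<longrightarrow> nrm F m (f (x + h) - f x - A x h) \<le> e * nrm S (Suc m) h)"

text \<open>\<open>C\<close> is a convex cone, initially the partial quadrant. Convexity keeps
  segments inside the domain for the mean value estimate. Since \<open>C\<close> spans, a linear
  derivative is determined by inward directions, also at boundary points.\<close>

locale sc_map = V: const_scale V + F: sc_scale F
  for V :: "'v::real_vector scs" and F :: "'e::real_vector scs" +
  fixes C :: "(nat \<Rightarrow> 'v) set" and U :: "nat \<Rightarrow> (nat \<Rightarrow> 'v \<times> 'e) set"
    and f :: "(nat \<Rightarrow> 'v \<times> 'e) \<Rightarrow> nat \<Rightarrow> 'e" and A :: "(nat \<Rightarrow> 'v \<times> 'e) \<Rightarrow> (nat \<Rightarrow> 'v \<times> 'e) \<Rightarrow> nat \<Rightarrow> 'e"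
  assumes C_add: "a \<in> C \<Longrightarrow> b \<in> C \<Longrightarrow> a + b \<in> C"
    and C_scaleR: "0 \<le> t \<Longrightarrow> a \<in> C \<Longrightarrow> t *\<^sub>R a \<in> C"
    and C_span: "v \<in> lev V 0 \<Longrightarrow> \<exists>a\<in>lev V 0 \<inter> C. \<exists>b\<in>lev V 0 \<inter> C. v = a - b"
    and U_C: "x \<in> U m \<Longrightarrow> fstf x \<in> C"
    and U_lev: "x \<in> U m \<Longrightarrow> x \<in> lev (prs V F) m"
    and U_decr: "U (Suc m) \<subseteq> U m"
    and U_open: "x \<in> U m \<Longrightarrow>
      \<exists>r>0. \<forall>y\<in>lev (prs V F) m. fstf y \<in> C \<longrightarrow> nrm (prs V F) m (y - x) < r \<longrightarrow> y \<in> U m"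
    and sc1: "sc1 (prs V F) F U f A"
begin

sublocale S: sc_scale "prs V F"
  by (rule sc_scale_prs) unfold_locales

lemma U_Suc: "x \<in> U (Suc m) \<Longrightarrow> x \<in> U m"
  using U_decr by auto

lemma U_Suc_0: "x \<in> U (Suc m) \<Longrightarrow> x \<in> U (Suc 0)"
  using lift_Suc_antimono_le[of U "Suc 0" "Suc m"] U_decr by auto

lemma sc0_f: "sc0 (prs V F) F U f"
  and sc0_T: "sc0 (Tscs (prs V F)) (Tscs F) (Tgerm (prs V F) U) (Tmap f A)"
  and scD: "x \<in> U (Suc 0) \<Longrightarrow> is_scD (prs V F) F U f x (A x)"
  using sc1 by (simp_all add: sc1_def)

lemma A_add: "x \<in> U (Suc m) \<Longrightarrow> h \<in> lev (prs V F) 0 \<Longrightarrow> k \<in> lev (prs V F) 0 \<Longrightarrow> A x (h + k) = A x h + A x k"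
  and A_scaleR: "x \<in> U (Suc m) \<Longrightarrow> h \<in> lev (prs V F) 0 \<Longrightarrow> A x (c *\<^sub>R h) = c *\<^sub>R A x h"
  using scD[OF U_Suc_0[of x m]] unfolding is_scD_def by auto

lemma A_diff: "x \<in> U (Suc m) \<Longrightarrow> h \<in> lev (prs V F) 0 \<Longrightarrow> k \<in> lev (prs V F) 0 \<Longrightarrow> A x (h - k) = A x h - A x k"
  using A_add[of x m h "(-1) *\<^sub>R k"] A_scaleR[of x m k "-1"] S.lev_scaleR[of k 0 "-1"] by simp

lemma A_zero: "x \<in> U (Suc m) \<Longrightarrow> A x 0 = 0"
  using A_scaleR[of x m 0 0] by simp

lemma frech_0: "frech (prs V F) F U f A 0"
  unfolding frech_def using scD by (auto simp: is_scD_def)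

lemma A_lev:
  assumes "x \<in> U (Suc m)" "h \<in> lev (prs V F) m"
  shows "A x h \<in> lev F m"
  using sc0_lev[OF sc0_T, of "ilv x h" m] assms by simp

lemma f_lev: "x \<in> U m \<Longrightarrow> f x \<in> lev F m"
  using sc0_lev[OF sc0_f] by simp

text \<open>This is continuity of the second component of Tf: points converge on level m+1 and
  directions on level m. It is weaker than convergence of the operators \<open>A (X n)\<close> in
  norm, and it is the form of continuity of the derivative that class sc^1 provides.\<close>

lemma A_tends:
  assumes "tends (prs V F) (Suc m) X x" "x \<in> U (Suc m)" "\<forall>\<^sub>F n in sequentially. X n \<in> U (Suc m)"
    "tends (prs V F) m H h"
  shows "tends F m (\<lambda>n. A (X n) (H n)) (A x h)"
proof -
  have "tends (Tscs (prs V F)) m (\<lambda>n. ilv (X n) (H n)) (ilv x h)"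
    using assms S.sc_scale_axioms by (simp add: tends_Tscs del: prs_simps)
  moreover have "ilv x h \<in> Tgerm (prs V F) U m"
    using assms by (simp add: tends_lev del: prs_simps)
  moreover have "\<forall>\<^sub>F n in sequentially. ilv (X n) (H n) \<in> Tgerm (prs V F) U m"
    using assms(3) tends_ev[OF assms(4)] by eventually_elim simp
  ultimately have "tends (Tscs F) m (\<lambda>n. Tmap f A (ilv (X n) (H n))) (Tmap f A (ilv x h))"
    by (rule sc0_tends[OF sc0_T]) (rule sc_scale_Tscs, unfold_locales)
  then show ?thesis
    using F.sc_scale_axioms by (simp add: tends_Tscs)
qed

lemma U_open_tends:
  assumes "tends (prs V F) m X x" "x \<in> U m" "\<forall>\<^sub>F n in sequentially. fstf (X n) \<in> C"
  shows "\<forall>\<^sub>F n in sequentially. X n \<in> U m"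
proof -
  obtain r where r: "r > 0" "\<And>y. y \<in> lev (prs V F) m \<Longrightarrow> fstf y \<in> C \<Longrightarrow> nrm (prs V F) m (y - x) < r \<Longrightarrow> y \<in> U m"
    using U_open[OF assms(2)] by blast
  show ?thesis
    using order_tendstoD(2)[OF tends_lim[OF assms(1)] r(1)] tends_ev[OF assms(1)] assms(3)
    by eventually_elim (rule r(2))
qed

text \<open>A Hadamard-type differentiability: the increments only need to be small in the strong norm,
  whereas their directions converge in the weak norm.\<close>

lemma hadamard:
  assumes D: "frech (prs V F) F U f A m" and x: "x \<in> U (Suc m)"
    and X: "tends (prs V F) (Suc m) X x" and H: "tends (prs V F) (Suc m) H 0"
    and XU: "\<forall>\<^sub>F n in sequentially. X n \<in> U (Suc m)"
    and XHU: "\<forall>\<^sub>F n in sequentially. X n + H n \<in> U (Suc m)"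
    and t: "\<And>n. 0 < t n"
    and h: "tends (prs V F) m (\<lambda>n. (1 / t n) *\<^sub>R H n) h"
  shows "tends F m (\<lambda>n. (1 / t n) *\<^sub>R (f (X n + H n) - f (X n))) (A x h)"
proof -
  have Axh: "A x h \<in> lev F m"
    using A_lev x h tends_lev by blast
  have lev: "\<forall>\<^sub>F n in sequentially. (1 / t n) *\<^sub>R (f (X n + H n) - f (X n)) \<in> lev F m"
    using XU XHU by eventually_elim (intro F.lev_scaleR F.lev_diff f_lev[OF U_Suc])
  have "(\<lambda>n. nrm F m ((1 / t n) *\<^sub>R (f (X n + H n) - f (X n)) - A x h)) \<longlonglongrightarrow> 0"
  proof (rule tendstoI)
    fix e' :: real
    assume "0 < e'"
    define e where "e = e' / 2"
    have e: "0 < e" "e < e'"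
      using \<open>0 < e'\<close> by (simp_all add: e_def)
    obtain r where r: "r > 0" "\<And>y. y \<in> lev (prs V F) (Suc m) \<Longrightarrow> fstf y \<in> C \<Longrightarrow>
        nrm (prs V F) (Suc m) (y - x) < r \<Longrightarrow> y \<in> U (Suc m)"
      using U_open[OF x] by blast
    have "ilv x h \<in> Tgerm (prs V F) U m"
      using x tends_lev[OF h] by simp
    from sc0_cont[OF sc0_T this e(1)]
    obtain d where d: "d > 0" "\<And>y. y \<in> Tgerm (prs V F) U m \<Longrightarrow> nrm (Tscs (prs V F)) m (y - ilv x h) < d
        \<Longrightarrow> nrm (Tscs F) m (Tmap f A y - Tmap f A (ilv x h)) < e"
      by blast
    have dd: "nrm F m (A y k - A x h) \<le> e"
      if "y \<in> U (Suc m)" "k \<in> lev (prs V F) m" "nrm (prs V F) (Suc m) (y - x) + nrm (prs V F) m (k - h) < d" for y k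
    proof -
      have "nrm (Tscs F) m (Tmap f A (ilv y k) - Tmap f A (ilv x h)) < e"
        using that by (intro d(2)) simp_all
      moreover have "0 \<le> nrm F (Suc m) (f y - f x)"
        using that(1) x by (intro F.nonneg F.lev_diff f_lev)
      ultimately show ?thesis
        by simp
    qed
    have rd: "0 < min r (d / 2)" "0 < d / 2"
      using r(1) d(1) by simp_all
    have lim1: "(\<lambda>n. nrm (prs V F) (Suc m) (X n - x) + nrm (prs V F) (Suc m) (H n)) \<longlonglongrightarrow> 0"
      using tendsto_add[OF tends_lim[OF X] tends_lim[OF H]] by simp
    show "\<forall>\<^sub>F n in sequentially. dist (nrm F m ((1 / t n) *\<^sub>R (f (X n + H n) - f (X n)) - A x h)) 0 < e'"
      using order_tendstoD(2)[OF lim1 rd(1)] order_tendstoD(2)[OF tends_lim[OF h] rd(2)]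
        XU XHU tends_ev[OF X] tends_ev[OF H] tends_ev[OF h] lev
    proof eventually_elim
      case (elim n)
      let ?S = "prs V F" and ?X = "X n" and ?H = "H n" and ?t = "t n"
      have xlev: "x \<in> lev ?S (Suc m)"
        using tends_lev[OF X] .
      have H0: "?H \<in> lev ?S 0"
        using S.lev_le[of 0 "Suc m"] elim(6) by blast
      \<comment> \<open>Convexity of the cone handles the first component. Smallness is measured
        from the limit point x, so that one radius serves all large n.\<close>
      have seg: "?X + s *\<^sub>R ?H \<in> U (Suc m)"
        and segn: "nrm ?S (Suc m) (?X + s *\<^sub>R ?H - x) < d / 2" if s: "s \<in> {0..1}" for s
      proof -
        have "nrm ?S (Suc m) ((?X - x) + s *\<^sub>R ?H) \<le> nrm ?S (Suc m) (?X - x) + s * nrm ?S (Suc m) ?H"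
          using S.triangle[of "?X - x" "Suc m" "s *\<^sub>R ?H"] S.homog[of ?H "Suc m" s] elim(5,6) xlev s by auto
        also have "\<dots> \<le> nrm ?S (Suc m) (?X - x) + nrm ?S (Suc m) ?H"
          using s S.nonneg[OF elim(6)] by (intro add_left_mono mult_left_le_one_le) auto
        also have "\<dots> < min r (d / 2)"
          by (rule elim(1))
        finally have *: "nrm ?S (Suc m) (?X + s *\<^sub>R ?H - x) < min r (d / 2)"
          by (simp only: add_diff_eq diff_add_eq)
        then show "nrm ?S (Suc m) (?X + s *\<^sub>R ?H - x) < d / 2"
          by simp
        have "fstf (?X + s *\<^sub>R ?H) = (1 - s) *\<^sub>R fstf ?X + s *\<^sub>R fstf (?X + ?H)"
          by (simp add: algebra_simps)
        then have "fstf (?X + s *\<^sub>R ?H) \<in> C"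
          using U_C elim(3,4) s by (auto intro!: C_add C_scaleR simp del: fstf_simps)
        then show "?X + s *\<^sub>R ?H \<in> U (Suc m)"
          using * elim(5,6) by (intro r(2)) (auto simp del: prs_simps)
      qed
      have tH: "?t *\<^sub>R ((1 / ?t) *\<^sub>R ?H) = ?H"
        using t[of n] by simp
      have Hl: "(1 / ?t) *\<^sub>R ?H \<in> lev ?S m" "(1 / ?t) *\<^sub>R ?H \<in> lev ?S 0"
        using elim(7) H0 by (auto simp del: prs_simps)
      \<comment> \<open>The path s \<mapsto> f(X + s H) has derivative A(X + s H)H = t A(X + s H)(H
        / t). Since H / t is close to h on level m, this stays within t e of t A x h.\<close>
      have "nrm F m (f (?X + 1 *\<^sub>R ?H) - f (?X + 0 *\<^sub>R ?H) - ?t *\<^sub>R A x h) \<le> ?t * e"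
      proof (rule F.mean_value[where \<phi>' = "\<lambda>s. A (?X + s *\<^sub>R ?H) ?H"])
        fix s :: real
        assume s: "s \<in> {0..1}"
        show "f (?X + s *\<^sub>R ?H) \<in> lev F m"
          using seg[OF s] by (intro f_lev[OF U_Suc])
        show "A (?X + s *\<^sub>R ?H) ?H \<in> lev F m"
          using seg[OF s] S.lev_Suc[OF elim(6)] by (rule A_lev)
        have AH: "A (?X + s *\<^sub>R ?H) ?H = ?t *\<^sub>R A (?X + s *\<^sub>R ?H) ((1 / ?t) *\<^sub>R ?H)"
          using A_scaleR[OF seg[OF s] Hl(2), of ?t] unfolding tH .
        have "nrm F m (A (?X + s *\<^sub>R ?H) ((1 / ?t) *\<^sub>R ?H) - A x h) \<le> e"
          using seg[OF s] segn[OF s] elim(2) Hl by (intro dd) auto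
        then show "nrm F m (A (?X + s *\<^sub>R ?H) ?H - ?t *\<^sub>R A x h) \<le> ?t * e"
          unfolding AH scaleR_diff_right[symmetric] using t[of n] Axh A_lev[OF seg[OF s] Hl(1)]
          by (simp add: F.homog)
        fix e1 :: real
        assume e1: "0 < e1"
        \<comment> \<open>Adding 1 keeps the divisor positive when the increment vanishes.\<close>
        define N where "N = nrm ?S (Suc m) ?H + 1"
        have N: "0 < N" "nrm ?S (Suc m) ?H \<le> N"
          using S.nonneg[OF elim(6)] by (simp_all add: N_def)
        obtain d1 where d1: "d1 > 0" "\<And>k. k \<in> lev ?S (Suc m) \<Longrightarrow> ?X + s *\<^sub>R ?H + k \<in> U (Suc m) \<Longrightarrow>
            0 < nrm ?S (Suc m) k \<Longrightarrow> nrm ?S (Suc m) k < d1 \<Longrightarrow>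
            nrm F m (f (?X + s *\<^sub>R ?H + k) - f (?X + s *\<^sub>R ?H) - A (?X + s *\<^sub>R ?H) k) \<le> e1 / N * nrm ?S (Suc m) k"
          using D seg[OF s] divide_pos_pos[OF e1 N(1)] unfolding frech_def by blast
        show "\<exists>d>0. \<forall>s'\<in>{0..1}. \<bar>s' - s\<bar> < d \<longrightarrow>
          nrm F m (f (?X + s' *\<^sub>R ?H) - f (?X + s *\<^sub>R ?H) - (s' - s) *\<^sub>R A (?X + s *\<^sub>R ?H) ?H) \<le> e1 * \<bar>s' - s\<bar>"
        proof (intro exI[of _ "d1 / N"] conjI ballI impI)
          show "0 < d1 / N"
            using d1 N by simp
          fix s' :: real
          assume s': "s' \<in> {0..1}" "\<bar>s' - s\<bar> < d1 / N"
          let ?k = "(s' - s) *\<^sub>R ?H"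
          have eq: "?X + s *\<^sub>R ?H + ?k = ?X + s' *\<^sub>R ?H"
            by (simp add: algebra_simps)
          have nk: "nrm ?S (Suc m) ?k = \<bar>s' - s\<bar> * nrm ?S (Suc m) ?H"
            using elim(6) by (rule S.homog)
          have nk': "nrm ?S (Suc m) ?k \<le> \<bar>s' - s\<bar> * N"
            unfolding nk using N by (simp add: mult_left_mono)
          have Ak: "A (?X + s *\<^sub>R ?H) ?k = (s' - s) *\<^sub>R A (?X + s *\<^sub>R ?H) ?H"
            using seg[OF s] H0 by (rule A_scaleR)
          have klev: "?k \<in> lev ?S (Suc m)"
            using elim(6) by (rule S.lev_scaleR)
          show "nrm F m (f (?X + s' *\<^sub>R ?H) - f (?X + s *\<^sub>R ?H) - (s' - s) *\<^sub>R A (?X + s *\<^sub>R ?H) ?H) \<le> e1 * \<bar>s' - s\<bar>"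
          \<comment> \<open>\<open>frech\<close> speaks of nonzero increments only, whereas k = 0
            does occur, for s' = s or H = 0.\<close>
          proof (cases "nrm ?S (Suc m) ?k = 0")
            case True
            then have "?k = 0"
              using S.definite klev by blast
            then have "(s' - s) *\<^sub>R A (?X + s *\<^sub>R ?H) ?H = 0" "?X + s' *\<^sub>R ?H = ?X + s *\<^sub>R ?H"
              using Ak eq A_zero[OF seg[OF s]] by auto
            then have "f (?X + s' *\<^sub>R ?H) - f (?X + s *\<^sub>R ?H) - (s' - s) *\<^sub>R A (?X + s *\<^sub>R ?H) ?H = 0"
              by (simp only: diff_self)
            then show ?thesis
              using e1 by (simp only: F.nrm_zero) simp
          next
            case False
            then have "0 < nrm ?S (Suc m) ?k"
              using S.nonneg[OF klev] by linarith
            moreover have "nrm ?S (Suc m) ?k < d1"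
              using nk' s'(2) N(1) by (simp add: pos_less_divide_eq)
            ultimately have "nrm F m (f (?X + s' *\<^sub>R ?H) - f (?X + s *\<^sub>R ?H) - (s' - s) *\<^sub>R A (?X + s *\<^sub>R ?H) ?H)
                \<le> e1 / N * nrm ?S (Suc m) ?k"
              using d1(2)[OF klev] seg[OF s'(1)] unfolding eq Ak by blast
            also have "\<dots> \<le> e1 / N * (\<bar>s' - s\<bar> * N)"
              using nk' e1 N by (intro mult_left_mono) auto
            finally show ?thesis
              using N by simp
          qed
        qed
      qed (rule F.lev_scaleR[OF Axh])
      then have *: "nrm F m (f (?X + ?H) - f ?X - ?t *\<^sub>R A x h) \<le> ?t * e"
        by simp
      have "f (?X + ?H) - f ?X - ?t *\<^sub>R A x h = ?t *\<^sub>R ((1 / ?t) *\<^sub>R (f (?X + ?H) - f ?X) - A x h)"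
        using t[of n] by (simp add: scaleR_diff_right)
      then have "nrm F m (f (?X + ?H) - f ?X - ?t *\<^sub>R A x h) = ?t * nrm F m ((1 / ?t) *\<^sub>R (f (?X + ?H) - f ?X) - A x h)"
        using t[of n] elim(8) Axh F.homog[of "(1 / ?t) *\<^sub>R (f (?X + ?H) - f ?X) - A x h" m ?t] by simp
      with * have "nrm F m ((1 / ?t) *\<^sub>R (f (?X + ?H) - f ?X) - A x h) \<le> e"
        using t[of n] by simp
      then show ?case
        using e elim(8) Axh F.nonneg[of "(1 / ?t) *\<^sub>R (f (?X + ?H) - f ?X) - A x h" m]
        by (simp add: dist_real_def)
    qed
  qed
  then show ?thesis
    unfolding tends_def using Axh lev by simp
qed

end

section \<open>The derivative of the solution germ\<close>

text \<open>\<open>Z n\<close> is chosen within 1/(n+1) of the infimum of ||z - y||_m + t_n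
  ||z||_(m+1), a K-functional as in interpolation theory. Testing with a fixed z close to y shows
  that the infimum tends to 0, and both summands at \<open>Z n\<close> go with it.\<close>

lemma (in sc_scale) dense_scaled:
  assumes y: "y \<in> lev S m" and t: "\<And>n. 0 < t n" "t \<longlonglongrightarrow> 0"
  obtains Z where "tends S m Z y" "tends S (Suc m) (\<lambda>n. t n *\<^sub>R Z n) 0"
proof -
  define g where "g n z = nrm S m (z - y) + t n * nrm S (Suc m) z" for n z
  have g0: "0 \<le> nrm S m (z - y)" "0 \<le> t n * nrm S (Suc m) z" if "z \<in> lev S (Suc m)" for n z
    using that t(1)[of n] y lev_Suc[OF that] by simp_all
  then have bdd: "bdd_below (g n ` lev S (Suc m))" for n
    by (intro bdd_belowI[of _ 0]) (auto simp: g_def)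
  have ne: "lev S (Suc m) \<noteq> {}"
    using lev_zero[of "Suc m"] by blast
  have "\<exists>z\<in>lev S (Suc m). g n z < (INF z\<in>lev S (Suc m). g n z) + 1 / real (Suc n)" for n
    using cInf_lessD[of "g n ` lev S (Suc m)" "(INF z\<in>lev S (Suc m). g n z) + 1 / real (Suc n)"]
      ne by auto
  then obtain Z where Z: "\<And>n. Z n \<in> lev S (Suc m)"
    "\<And>n. g n (Z n) < (INF z\<in>lev S (Suc m). g n z) + 1 / real (Suc n)"
    by metis
  have lim: "(\<lambda>n. g n (Z n)) \<longlonglongrightarrow> 0"
  proof (rule tendstoI)
    fix e :: real
    assume e: "0 < e"
    obtain z where z: "z \<in> lev S (Suc m)" "nrm S m (z - y) < e / 2"
      using dense[OF y half_gt_zero[OF e]] by blast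
    have "(\<lambda>n. t n * nrm S (Suc m) z + 1 / real (Suc n)) \<longlonglongrightarrow> 0 * nrm S (Suc m) z + 0"
      by (intro tendsto_intros t LIMSEQ_Suc[OF lim_1_over_n])
    moreover have "0 * nrm S (Suc m) z + 0 < e / 2"
      using e by (simp only: mult_zero_left add_0 half_gt_zero)
    ultimately have "\<forall>\<^sub>F n in sequentially. t n * nrm S (Suc m) z + 1 / real (Suc n) < e / 2"
      by (rule order_tendstoD(2))
    then show "\<forall>\<^sub>F n in sequentially. dist (g n (Z n)) 0 < e"
    proof eventually_elim
      case (elim n)
      have "(INF z\<in>lev S (Suc m). g n z) \<le> g n z"
        using bdd z(1) by (rule cINF_lower)
      then have "g n (Z n) < e"
        using Z(2)[of n] z(2) elim by (simp add: g_def)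
      moreover have "0 \<le> g n (Z n)"
        using g0[OF Z(1)[of n]] by (simp add: g_def)
      ultimately show ?case
        by (simp add: dist_real_def)
    qed
  qed
  have "tends S m Z y"
    by (rule tendsI[OF y _ _ lim]) (use Z g0 lev_Suc in \<open>auto simp: g_def\<close>)
  moreover have "tends S (Suc m) (\<lambda>n. t n *\<^sub>R Z n) 0"
  proof (rule tendsI[OF _ _ _ lim])
    show "nrm S (Suc m) (t n *\<^sub>R Z n - 0) \<le> g n (Z n)" for n
      using t(1)[of n] g0[OF Z(1)[of n]] homog[OF Z(1)[of n], of "t n"] by (simp add: g_def)
  qed (use Z in auto)
  ultimately show ?thesis
    using that by blast
qed

text \<open>Implicit differentiation of f(v, \<delta> v) = 0. The choice is made on level 0, where
  the solution is unique under the assumptions of \<open>sc_problem\<close>; its regularity on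
  higher levels is recovered in \<open>D_lev\<close>.\<close>

definition sol_D :: "'e::real_vector scs \<Rightarrow> ((nat \<Rightarrow> 'v::real_vector \<times> 'e) \<Rightarrow> (nat \<Rightarrow> 'v \<times> 'e) \<Rightarrow> nat \<Rightarrow> 'e) \<Rightarrow>
    ((nat \<Rightarrow> 'v) \<Rightarrow> nat \<Rightarrow> 'e) \<Rightarrow> (nat \<Rightarrow> 'v) \<Rightarrow> (nat \<Rightarrow> 'v) \<Rightarrow> nat \<Rightarrow> 'e" where
  "sol_D F A \<delta> v w = (SOME y. y \<in> lev F 0 \<and> A (pairf v (\<delta> v)) (pairf w y) = 0)"

text \<open>The induction hypothesis over tangent stages, modelled on what a contraction provides
  but without the contraction. The number \<open>p\<close> limits the levels on which f is known to
  be differentiable and approximate solutions are controlled. A tangent step lowers it by one,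
  because \<open>T_proper\<close> on level m calls \<open>proper\<close> on level m + 1.\<close>

locale sc_problem = sc_map V F C U f A
  for V :: "'v::real_vector scs" and F :: "'e::real_vector scs" and C U f A +
  fixes W :: "nat \<Rightarrow> (nat \<Rightarrow> 'v) set" and \<delta> :: "(nat \<Rightarrow> 'v) \<Rightarrow> nat \<Rightarrow> 'e" and p :: nat
  assumes zero_W: "0 \<in> W m"
    and W_lev: "v \<in> W m \<Longrightarrow> v \<in> lev V m"
    and W_decr: "W (Suc m) \<subseteq> W m"
    and graph_U: "v \<in> W m \<Longrightarrow> pairf v (\<delta> v) \<in> U m"
    and graph_zero: "v \<in> W 0 \<Longrightarrow> f (pairf v (\<delta> v)) = 0"
    and sc0_sol: "sc0 V F W \<delta>"
    and frech: "m < p \<Longrightarrow> frech (prs V F) F U f A m"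
    and proper: "m < p \<Longrightarrow> v \<in> W (Suc m) \<Longrightarrow> \<forall>\<^sub>F n in sequentially. X n \<in> W (Suc m) \<Longrightarrow> tends V m X v \<Longrightarrow>
      tends F (Suc m) Y (\<delta> v) \<Longrightarrow> \<forall>\<^sub>F n in sequentially. pairf (X n) (Y n) \<in> U (Suc m) \<Longrightarrow>
      (\<And>n. 0 < t n) \<Longrightarrow> tends F m (\<lambda>n. (1 / t n) *\<^sub>R f (pairf (X n) (Y n))) 0 \<Longrightarrow>
      tends F m (\<lambda>n. (1 / t n) *\<^sub>R (Y n - \<delta> (X n))) 0"
    and lin_proper: "v \<in> W (Suc m) \<Longrightarrow> \<forall>\<^sub>F n in sequentially. X n \<in> W (Suc m) \<Longrightarrow> tends V m X v \<Longrightarrow>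
      \<forall>\<^sub>F n in sequentially. Y n \<in> lev F m \<Longrightarrow>
      tends F m (\<lambda>n. A (pairf (X n) (\<delta> (X n))) (pairf 0 (Y n))) 0 \<Longrightarrow> tends F m Y 0"
    and lin_surj: "v \<in> W (Suc m) \<Longrightarrow> b \<in> lev F m \<Longrightarrow> \<exists>y\<in>lev F m. A (pairf v (\<delta> v)) (pairf 0 y) = b"
begin

abbreviation D where "D \<equiv> sol_D F A \<delta>"

abbreviation gr where "gr v \<equiv> pairf v (\<delta> v)"

lemma W_Suc: "v \<in> W (Suc m) \<Longrightarrow> v \<in> W m"
  using W_decr by auto

lemma W_0: "v \<in> W m \<Longrightarrow> v \<in> W 0"
  using lift_Suc_antimono_le[of W 0 m] W_decr by auto

lemma W_Suc_0: "v \<in> W (Suc m) \<Longrightarrow> v \<in> W (Suc 0)"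
  using lift_Suc_antimono_le[of W "Suc 0" "Suc m"] W_decr by auto

lemma W_V: "v \<in> W m \<Longrightarrow> v \<in> lev V n"
  using W_lev V.lev_level by blast

lemma sol_lev: "v \<in> W m \<Longrightarrow> \<delta> v \<in> lev F m"
  using sc0_lev[OF sc0_sol] .

lemma sol_tends:
  assumes "v \<in> W m" "\<forall>\<^sub>F n in sequentially. X n \<in> W m" "tends V k X v"
  shows "tends F m (\<lambda>n. \<delta> (X n)) (\<delta> v)"
  using sc0_tends[OF sc0_sol V.tends_level[OF assms(3)] assms(1,2)] F.sc_scale_axioms by blast

lemma gr_tends:
  assumes "v \<in> W m" "\<forall>\<^sub>F n in sequentially. X n \<in> W m" "tends V k X v"
  shows "tends (prs V F) m (\<lambda>n. gr (X n)) (gr v)"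
  using sol_tends[OF assms] V.tends_level[OF assms(3)] V.sc_scale_axioms F.sc_scale_axioms
  by (simp add: tends_prs)

section \<open>The linearized solution operator \<open>D\<close> and its continuity\<close>

lemma A_split:
  assumes "x \<in> U (Suc m)" "w \<in> lev V 0" "y \<in> lev F 0"
  shows "A x (pairf w y) = A x (pairf w 0) + A x (pairf 0 y)"
  using A_add[OF assms(1), of "pairf w 0" "pairf 0 y"] assms(2,3) by (simp add: pairf_add)

text \<open>A kernel vector, read as a constant sequence, tends to 0 by
  \<open>lin_proper\<close>.\<close>

lemma lin_inj:
  assumes "v \<in> W (Suc m)" "y \<in> lev F m" "A (gr v) (pairf 0 y) = 0"
  shows "y = 0"
proof (rule F.tends_unique)
  show "tends F m (\<lambda>n. y) 0"
  proof (rule lin_proper[OF assms(1)])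
    show "tends V m (\<lambda>n. v) v"
      using W_V[OF assms(1)] by (rule V.tends_const)
    show "tends F m (\<lambda>n. A (gr v) (pairf 0 y)) 0"
      unfolding assms(3) by (rule F.tends_const) simp
  qed (use assms in simp_all)
  show "tends F m (\<lambda>n. y) y"
    using assms(2) by (rule F.tends_const)
qed

lemma D_exists:
  assumes v: "v \<in> W (Suc m)" and w: "w \<in> lev V k"
  shows "\<exists>y\<in>lev F m. A (gr v) (pairf w y) = 0"
proof -
  have w': "w \<in> lev V n" for n
    using w by (rule V.lev_level)
  have "- A (gr v) (pairf w 0) \<in> lev F m"
    using graph_U[OF v] w' by (intro F.lev_uminus A_lev) auto
  then obtain y where y: "y \<in> lev F m" "A (gr v) (pairf 0 y) = - A (gr v) (pairf w 0)"
    using lin_surj[OF v] by blast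
  then have "A (gr v) (pairf w y) = 0"
    using A_split[OF graph_U[OF v] w'[of 0], of y] F.lev_le[of 0 m y] by simp
  with y(1) show ?thesis
    by blast
qed

text \<open>Uniqueness on level 0 identifies the solutions that \<open>lin_surj\<close> produces on
  the various levels, so that one operator \<open>D\<close> serves them all.\<close>

lemma D_eq:
  assumes v: "v \<in> W (Suc m)" and w: "w \<in> lev V k" and y: "y \<in> lev F 0" "A (gr v) (pairf w y) = 0"
  shows "D v w = y"
proof -
  have w': "w \<in> lev V 0"
    using w by (rule V.lev_level)
  have uniq: "z = y" if z: "z \<in> lev F 0" "A (gr v) (pairf w z) = 0" for z
  proof -
    have "A (gr v) (pairf 0 (z - y)) = 0"
      using A_diff[OF graph_U[OF v], of "pairf w z" "pairf w y"] w' y z by (simp add: pairf_diff)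
    then show ?thesis
      using lin_inj[OF W_Suc_0[OF v], of "z - y"] z y by simp
  qed
  show ?thesis
    unfolding sol_D_def by (rule some_equality) (use y uniq in blast)+
qed

lemma
  assumes "v \<in> W (Suc m)" "w \<in> lev V k"
  shows D_lev: "D v w \<in> lev F m"
    and D_zero: "A (gr v) (pairf w (D v w)) = 0"
proof -
  obtain y where y: "y \<in> lev F m" "A (gr v) (pairf w y) = 0"
    using D_exists[OF assms] by blast
  then have "D v w = y"
    using D_eq[OF assms] F.lev_le[of 0 m y] by blast
  with y show "D v w \<in> lev F m" "A (gr v) (pairf w (D v w)) = 0"
    by simp_all
qed

lemma D_add:
  assumes "v \<in> W (Suc m)" "w \<in> lev V k" "w' \<in> lev V k"
  shows "D v (w + w') = D v w + D v w'"
proof (rule D_eq[OF assms(1)])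
  have lev: "w \<in> lev V 0" "w' \<in> lev V 0" "D v w \<in> lev F 0" "D v w' \<in> lev F 0"
    by (rule V.lev_level[OF assms(2)] V.lev_level[OF assms(3)] D_lev[OF W_Suc_0[OF assms(1)] assms(2)]
      D_lev[OF W_Suc_0[OF assms(1)] assms(3)])+
  then show "w + w' \<in> lev V 0" "D v w + D v w' \<in> lev F 0"
    by simp_all
  show "A (gr v) (pairf (w + w') (D v w + D v w')) = 0"
    using A_add[OF graph_U[OF assms(1)], of "pairf w (D v w)" "pairf w' (D v w')"] lev
    by (simp only: pairf_add prs_simps fstf_simps sndf_simps D_zero[OF assms(1,2)] D_zero[OF assms(1,3)] simp_thms add_0)
qed

lemma D_scaleR:
  assumes "v \<in> W (Suc m)" "w \<in> lev V k"
  shows "D v (c *\<^sub>R w) = c *\<^sub>R D v w"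
proof (rule D_eq[OF assms(1)])
  have lev: "w \<in> lev V 0" "D v w \<in> lev F 0"
    by (rule V.lev_level[OF assms(2)] D_lev[OF W_Suc_0[OF assms(1)] assms(2)])+
  then show "c *\<^sub>R w \<in> lev V 0" "c *\<^sub>R D v w \<in> lev F 0"
    by simp_all
  show "A (gr v) (pairf (c *\<^sub>R w) (c *\<^sub>R D v w)) = 0"
    using A_scaleR[OF graph_U[OF assms(1)], of "pairf w (D v w)" c] lev
      D_zero[OF assms] by (simp add: pairf_scaleR)
qed

text \<open>Freeze y = D v w. Then A(gr(X n))(H n, y) tends to A(gr v)(w, y) = 0. Subtracting the
  equation of D (X n) (H n) leaves the fibre derivative of the difference y - D (X n) (H n), to
  which \<open>lin_proper\<close> applies.\<close>

lemma D_tends: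
  assumes v: "v \<in> W (Suc m)" "\<forall>\<^sub>F n in sequentially. X n \<in> W (Suc m)" "tends V j X v"
    and w: "tends V k H w"
  shows "tends F m (\<lambda>n. D (X n) (H n)) (D v w)"
proof -
  have w': "w \<in> lev V n" for n
    using tends_lev[OF w] by (rule V.lev_level)
  have y: "D v w \<in> lev F m"
    using v(1) w' by (rule D_lev)
  have evH: "\<forall>\<^sub>F n in sequentially. H n \<in> lev V k"
    using w by (rule tends_ev)
  have HY: "tends (prs V F) m (\<lambda>n. pairf (H n) (D v w)) (pairf w (D v w))"
    using V.tends_level[OF w] y V.sc_scale_axioms F.sc_scale_axioms by (simp add: tends_prs F.tends_const)
  have "tends F m (\<lambda>n. A (gr (X n)) (pairf (H n) (D v w))) (A (gr v) (pairf w (D v w)))"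
    using v graph_U by (intro A_tends gr_tends HY) (auto elim: eventually_mono)
  then have lim: "tends F m (\<lambda>n. A (gr (X n)) (pairf (H n) (D v w))) 0"
    unfolding D_zero[OF v(1) w'] .
  have "tends F m (\<lambda>n. D v w - D (X n) (H n)) 0"
  proof (rule lin_proper[OF v(1,2)])
    show "tends V m X v"
      using v(3) by (rule V.tends_level)
    show "\<forall>\<^sub>F n in sequentially. D v w - D (X n) (H n) \<in> lev F m"
      using v(2) evH by eventually_elim (intro F.lev_diff y D_lev)
    show "tends F m (\<lambda>n. A (gr (X n)) (pairf 0 (D v w - D (X n) (H n)))) 0"
    proof (rule tends_cong[OF lim])
      show "\<forall>\<^sub>F n in sequentially. A (gr (X n)) (pairf (H n) (D v w)) = A (gr (X n)) (pairf 0 (D v w - D (X n) (H n)))"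
        using v(2) evH
      proof eventually_elim
        case (elim n)
        have "H n \<in> lev V 0" "D v w \<in> lev F 0" "D (X n) (H n) \<in> lev F 0"
          using V.lev_level[OF elim(2)] F.lev_le[OF _ y] D_lev[OF W_Suc_0[OF elim(1)] elim(2)] by auto
        then show ?case
          using A_diff[OF graph_U[OF elim(1)], of "pairf (H n) (D v w)" "pairf (H n) (D (X n) (H n))"]
            D_zero[OF elim] by (simp add: pairf_diff)
      qed
    qed
  qed
  from F.tends_diff[OF F.tends_const[OF y] this] show ?thesis
    by simp
qed

lemma sc0_TD: "sc0 (Tscs V) (Tscs F) (Tgerm V W) (Tmap \<delta> D)"
proof (rule sc0I_tends)
  show "Tmap \<delta> D 0 = 0"
  proof (rule ilv_eqI)
    have "\<delta> 0 = 0"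
      using sc0_sol by (simp only: sc0_def pzero_eq)
    then show "evn (Tmap \<delta> D 0) = evn 0"
      by (simp only: Tmap_simps evn_linear)
    have "D 0 0 = 0"
      using D_scaleR[of 0 0 0 0 0] zero_W[of 1] by simp
    then show "odp (Tmap \<delta> D 0) = odp 0"
      by (simp only: Tmap_simps odp_linear evn_linear)
  qed
  show "sc_scale (Tscs V)"
    by (rule sc_scale_Tscs) unfold_locales
  fix m x
  assume x: "x \<in> Tgerm V W m"
  then show "x \<in> lev (Tscs V) m"
    by (simp add: W_lev)
  show "Tmap \<delta> D x \<in> lev (Tscs F) m"
    using x by (auto intro: sol_lev D_lev)
  fix X
  assume "\<And>n. X n \<in> Tgerm V W m" "tends (Tscs V) m X x"
  then show "tends (Tscs F) m (\<lambda>n. Tmap \<delta> D (X n)) (Tmap \<delta> D x)"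
    using x V.sc_scale_axioms F.sc_scale_axioms
    by (auto simp: tends_Tscs intro!: sol_tends D_tends)
qed

text \<open>The approximations \<open>Z n\<close> of \<open>D v w\<close> lie on the stronger level, so that \<open>hadamard\<close> applies to
  \<open>f\<close> along \<open>(v + H n, \<delta> v + t n Z n)\<close>, and \<open>proper\<close> compares the resulting approximate solutions
  with \<open>\<delta>\<close>.\<close>

lemma sol_hadamard:
  assumes p: "0 < p" and v: "v \<in> W (Suc 0)" and H: "\<forall>\<^sub>F n in sequentially. v + H n \<in> W (Suc 0)"
    and t: "\<And>n. 0 < t n" "t \<longlonglongrightarrow> 0" and w: "tends V 0 (\<lambda>n. (1 / t n) *\<^sub>R H n) w"
  shows "tends F 0 (\<lambda>n. (1 / t n) *\<^sub>R (\<delta> (v + H n) - \<delta> v)) (D v w)"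
proof -
  let ?S = "prs V F"
  note ax = V.sc_scale_axioms F.sc_scale_axioms
  have y: "D v w \<in> lev F 0"
    using v tends_lev[OF w] by (rule D_lev)
  obtain Z where Z: "tends F 0 Z (D v w)" "tends F (Suc 0) (\<lambda>n. t n *\<^sub>R Z n) 0"
    using F.dense_scaled[OF y t] by blast
  have tne: "t n \<noteq> 0" for n
    using t(1)[of n] by simp
  have H0: "tends V k H 0" for k
    using V.tends_scaleR[OF t(2) w] tne by (auto intro: V.tends_level)
  have x: "gr v \<in> U (Suc 0)"
    using v by (rule graph_U)
  define K where "K n = pairf (H n) (t n *\<^sub>R Z n)" for n
  have K0: "tends ?S (Suc 0) K 0"
    using H0 Z(2) ax by (simp add: tends_prs K_def)
  have Kw: "tends ?S 0 (\<lambda>n. (1 / t n) *\<^sub>R K n) (pairf w (D v w))"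
    using w Z(1) tne ax by (simp add: tends_prs K_def)
  have xK: "tends ?S (Suc 0) (\<lambda>n. gr v + K n) (gr v)"
    using S.tends_add[OF S.tends_const[OF U_lev[OF x]] K0] by simp
  have KU: "\<forall>\<^sub>F n in sequentially. gr v + K n \<in> U (Suc 0)"
  proof (rule U_open_tends[OF xK x])
    show "\<forall>\<^sub>F n in sequentially. fstf (gr v + K n) \<in> C"
      using H by eventually_elim (use U_C[OF graph_U] in \<open>auto simp: K_def\<close>)
  qed
  have eqK: "gr v + K n = pairf (v + H n) (\<delta> v + t n *\<^sub>R Z n)" for n
    by (simp add: K_def pairf_add)
  have "tends F 0 (\<lambda>n. (1 / t n) *\<^sub>R (f (gr v + K n) - f (gr v))) (A (gr v) (pairf w (D v w)))"
    by (rule hadamard[OF frech_0 x S.tends_const[OF U_lev[OF x]] K0 _ KU t(1) Kw]) (use x in auto)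
  then have "tends F 0 (\<lambda>n. (1 / t n) *\<^sub>R f (pairf (v + H n) (\<delta> v + t n *\<^sub>R Z n))) 0"
    unfolding D_zero[OF v tends_lev[OF w]] eqK using graph_zero[OF W_0[OF v]] by simp
  then have "tends F 0 (\<lambda>n. (1 / t n) *\<^sub>R (\<delta> v + t n *\<^sub>R Z n - \<delta> (v + H n))) 0"
  proof (rule proper[OF p v H, rotated -1])
    show "tends V 0 (\<lambda>n. v + H n) v"
      using V.tends_add[OF V.tends_const[OF W_V[OF v]] H0] by simp
    show "tends F (Suc 0) (\<lambda>n. \<delta> v + t n *\<^sub>R Z n) (\<delta> v)"
      using F.tends_add[OF F.tends_const[OF sol_lev[OF v]] Z(2)] by simp
    show "\<forall>\<^sub>F n in sequentially. pairf (v + H n) (\<delta> v + t n *\<^sub>R Z n) \<in> U (Suc 0)"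
      using KU unfolding eqK .
  qed (rule t(1))
  \<comment> \<open>In \<open>Z n\<close> minus the rescaled error the approximations cancel, and
    the difference quotient of \<delta> remains.\<close>
  from F.tends_diff[OF Z(1) this]
  have "tends F 0 (\<lambda>n. Z n - (1 / t n) *\<^sub>R (\<delta> v + t n *\<^sub>R Z n - \<delta> (v + H n))) (D v w)"
    by (simp only: diff_zero)
  moreover have "Z n - (1 / t n) *\<^sub>R (\<delta> v + t n *\<^sub>R Z n - \<delta> (v + H n)) = (1 / t n) *\<^sub>R (\<delta> (v + H n) - \<delta> v)" for n
    using tne[of n] by (simp add: scaleR_add_right scaleR_diff_right)
  ultimately show ?thesis
    by (simp only:)
qed

text \<open>Otherwise there are unit directions on which \<open>D v\<close> grows without bound. A
  subsequence of them converges, and \<open>D_tends\<close> keeps the values bounded along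
  it.\<close>

lemma D_bounded:
  assumes v: "v \<in> W (Suc 0)"
  shows "\<exists>K. \<forall>h\<in>lev V 0. nrm F 0 (D v h) \<le> K * nrm V 0 h"
proof (rule ccontr)
  assume neg: "\<not> ?thesis"
  have "\<not> (\<forall>h\<in>lev V 0. nrm F 0 (D v h) \<le> real n * nrm V 0 h)" for n
    using neg unfolding not_ex by (rule spec)
  then obtain H where H: "\<And>n. H n \<in> lev V 0" "\<And>n. \<not> nrm F 0 (D v (H n)) \<le> real n * nrm V 0 (H n)"
    unfolding Ball_def not_all not_imp by metis
  have pos: "0 < nrm V 0 (H n)" for n
  proof -
    have "H n \<noteq> 0"
    proof
      assume "H n = 0"
      then have "D v (H n) = 0"
        using D_scaleR[OF v H(1)[of n], of 0] by simp
      then show False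
        using H(2)[of n] \<open>H n = 0\<close> by simp
    qed
    then show ?thesis
      using V.nonneg[OF H(1)[of n]] V.definite[OF H(1)[of n]] by fastforce
  qed
  define G where "G n = (1 / nrm V 0 (H n)) *\<^sub>R H n" for n
  have G: "G n \<in> lev V 0 \<and> nrm V 0 (G n) \<le> 1" for n
    using H(1)[of n] pos[of n] by (simp add: G_def V.homog)
  then obtain r w where r: "strict_mono (r :: nat \<Rightarrow> nat)" "tends V 0 (\<lambda>n. G (r n)) w"
    using V.compact[of G 1] by blast
  have "tends F 0 (\<lambda>n. D v (G (r n))) (D v w)"
    using v W_V[OF v] by (intro D_tends[OF _ _ _ r(2)] V.tends_const) auto
  then have lim: "(\<lambda>n. nrm F 0 (D v (G (r n)))) \<longlonglongrightarrow> nrm F 0 (D v w)"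
    by (rule F.tends_nrm)
  have big: "real (r n) < nrm F 0 (D v (G (r n)))" for n
    using H(2)[of "r n"] pos[of "r n"] D_scaleR[OF v H(1)[of "r n"], of "1 / nrm V 0 (H (r n))"]
      F.homog[OF D_lev[OF v H(1)[of "r n"]], of "1 / nrm V 0 (H (r n))"]
    by (simp add: G_def pos_less_divide_eq mult.commute)
  have "\<forall>\<^sub>F n in sequentially. nrm F 0 (D v (G (r n))) < nrm F 0 (D v w) + 1"
    using order_tendstoD(2)[OF lim] by simp
  moreover have "\<forall>\<^sub>F n in sequentially. nrm F 0 (D v w) + 1 \<le> real (r n)"
    using filterlim_compose[OF filterlim_real_sequentially filterlim_subseq[OF r(1)]]
    unfolding filterlim_at_top by blast
  ultimately have "\<forall>\<^sub>F n in sequentially. False"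
  proof eventually_elim
    case (elim n)
    with big[of n] show ?case
      by linarith
  qed
  then show False
    by simp
qed

text \<open>Take a sequence of increments violating the estimate and divide by their norms t n. By
  compactness the directions converge to some w along a subsequence. There the difference quotients
  of \<delta> (\<open>sol_hadamard\<close>) and the values of \<open>D v\<close>
  (\<open>D_tends\<close>) have the same limit D v w, a contradiction.\<close>

lemma sol_frechet:
  assumes p: "0 < p" and v: "v \<in> W (Suc 0)" and e: "0 < e"
  shows "\<exists>d>0. \<forall>h. h \<in> lev V (Suc 0) \<and> v + h \<in> W (Suc 0) \<and> 0 < nrm V (Suc 0) h \<and> nrm V (Suc 0) h < d
        \<longrightarrow> nrm F 0 (\<delta> (v + h) - \<delta> v - D v h) \<le> e * nrm V (Suc 0) h"
proof (rule ccontr)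
  assume "\<not> ?thesis"
  then have "\<forall>n. \<exists>h. h \<in> lev V (Suc 0) \<and> v + h \<in> W (Suc 0) \<and> 0 < nrm V (Suc 0) h \<and> nrm V (Suc 0) h < 1 / real (Suc n)
      \<and> \<not> nrm F 0 (\<delta> (v + h) - \<delta> v - D v h) \<le> e * nrm V (Suc 0) h"
    by (metis zero_less_divide_1_iff of_nat_0_less_iff zero_less_Suc)
  then obtain H where H: "\<And>n. H n \<in> lev V (Suc 0)" "\<And>n. v + H n \<in> W (Suc 0)" "\<And>n. 0 < nrm V (Suc 0) (H n)"
    "\<And>n. nrm V (Suc 0) (H n) < 1 / real (Suc n)"
    "\<And>n. \<not> nrm F 0 (\<delta> (v + H n) - \<delta> v - D v (H n)) \<le> e * nrm V (Suc 0) (H n)"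
    by metis
  define t where "t n = nrm V (Suc 0) (H n)" for n
  have tpos: "0 < t n" for n
    using H(3) by (simp add: t_def)
  have H0: "H n \<in> lev V 0" for n
    using H(1) by (rule V.lev_level)
  have t0: "t \<longlonglongrightarrow> 0"
    by (rule Lim_null_comparison[OF _ LIMSEQ_Suc[OF lim_1_over_n]])
      (use H(3,4) in \<open>auto simp: t_def less_imp_le\<close>)
  define G where "G n = (1 / t n) *\<^sub>R H n" for n
  have G: "G n \<in> lev V 0 \<and> nrm V 0 (G n) \<le> 1" for n
    using H0[of n] H(3)[of n] V.homog[OF H(1)[of n], of "1 / t n"] V.nrm_const[of 0 "Suc 0"]
    by (simp add: G_def t_def)
  then obtain r w where r: "strict_mono (r :: nat \<Rightarrow> nat)" "tends V 0 (\<lambda>n. G (r n)) w"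
    using V.compact[of G 1] by blast
  have "tends F 0 (\<lambda>n. (1 / t (r n)) *\<^sub>R (\<delta> (v + H (r n)) - \<delta> v)) (D v w)"
    using H(2) tpos r(2) LIMSEQ_subseq_LIMSEQ[OF t0 r(1)]
    by (intro sol_hadamard[OF p v]) (auto simp: G_def o_def)
  moreover have "tends F 0 (\<lambda>n. D v (G (r n))) (D v w)"
    using v W_V[OF v] by (intro D_tends[OF _ _ _ r(2)] V.tends_const) auto
  ultimately have "tends F 0 (\<lambda>n. (1 / t (r n)) *\<^sub>R (\<delta> (v + H (r n)) - \<delta> v) - D v (G (r n))) (D v w - D v w)"
    by (rule F.tends_diff)
  moreover have "(1 / t n) *\<^sub>R (\<delta> (v + H n) - \<delta> v) - D v (G n) = (1 / t n) *\<^sub>R (\<delta> (v + H n) - \<delta> v - D v (H n))" for n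
    using D_scaleR[OF v H0[of n], of "1 / t n"] by (simp add: G_def scaleR_diff_right)
  ultimately have "(\<lambda>n. nrm F 0 ((1 / t (r n)) *\<^sub>R (\<delta> (v + H (r n)) - \<delta> v - D v (H (r n))))) \<longlonglongrightarrow> 0"
    by (simp add: F.tends_zero_iff)
  from order_tendstoD(2)[OF this e] obtain n where
    "nrm F 0 ((1 / t (r n)) *\<^sub>R (\<delta> (v + H (r n)) - \<delta> v - D v (H (r n)))) < e"
    by (auto simp: eventually_sequentially)
  moreover have "\<delta> (v + H n) - \<delta> v - D v (H n) \<in> lev F 0" for n
    by (intro F.lev_diff sol_lev[OF W_0[OF H(2)]] sol_lev[OF W_0[OF v]] D_lev[OF v H0])
  ultimately show False
    using H(5)[of "r n"] tpos[of "r n"] by (simp add: F.homog t_def[symmetric] pos_divide_less_eq)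
qed

theorem sol_sc1:
  assumes "0 < p"
  shows "sc1 V F W \<delta> D"
  unfolding sc1_def
proof (intro conjI ballI)
  fix v
  assume "v \<in> W 1"
  then have v: "v \<in> W (Suc 0)"
    by simp
  show "is_scD V F W \<delta> v (D v)"
    unfolding is_scD_def
    using D_lev[OF v] D_add[OF v] D_scaleR[OF v] D_bounded[OF v] sol_frechet[OF assms v] by simp
qed (rule sc0_sol sc0_TD)+

end

section \<open>Derivatives of the tangent map\<close>

context sc_map
begin

text \<open>Tangent vectors at points of the cone are unrestricted. The cone of the tangent problem
  therefore constrains the base point only, and it still spans.\<close>

lemma sc_map_Tscs:
  assumes "sc1 (Tscs (prs V F)) (Tscs F) (Tgerm (prs V F) U) (Tmap f A) A2"
  shows "sc_map (Tscs V) (Tscs F) {v. evn v \<in> C} (Tgerm (prs V F) U) (Tmap f A) A2"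
proof -
  interpret TV: const_scale "Tscs V"
    by (rule const_scale_Tscs) unfold_locales
  interpret TF: sc_scale "Tscs F"
    by (rule sc_scale_Tscs) unfold_locales
  show ?thesis
  proof
    show "a + b \<in> {v. evn v \<in> C}" if "a \<in> {v. evn v \<in> C}" "b \<in> {v. evn v \<in> C}" for a b
      using that C_add by simp
    show "t *\<^sub>R a \<in> {v. evn v \<in> C}" if "0 \<le> t" "a \<in> {v. evn v \<in> C}" for t a
      using that C_scaleR by simp
    show "\<exists>a\<in>lev (Tscs V) 0 \<inter> {v. evn v \<in> C}. \<exists>b\<in>lev (Tscs V) 0 \<inter> {v. evn v \<in> C}. v = a - b"
      if v: "v \<in> lev (Tscs V) 0" for v
    proof -
      have "evn v \<in> lev V 0"
        using v V.lev_level unfolding Tscs_simps by blast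
      then obtain a b where ab: "a \<in> lev V 0" "a \<in> C" "b \<in> lev V 0" "b \<in> C" "evn v = a - b"
        using C_span by blast
      \<comment> \<open>The tangent component is free, so all of it can be given to one of the two
        cone elements.\<close>
      have "v = ilv a (odp v) - ilv b 0"
        by (rule ilv_eqI) (use ab in simp_all)
      moreover have "ilv a (odp v) \<in> lev (Tscs V) 0" "ilv b 0 \<in> lev (Tscs V) 0"
        using v V.lev_level[OF ab(1)] V.lev_level[OF ab(3)] by simp_all
      ultimately show ?thesis
        using ab by (intro bexI[of _ "ilv a (odp v)"] bexI[of _ "ilv b 0"]) simp_all
    qed
    show "fstf x \<in> {v. evn v \<in> C}" if "x \<in> Tgerm (prs V F) U m" for x m
      using that U_C by (auto simp del: prs_simps)
    show "x \<in> lev (prs (Tscs V) (Tscs F)) m" if "x \<in> Tgerm (prs V F) U m" for x m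
      using that U_lev unfolding Tscs_prs[symmetric] by (auto simp del: prs_simps)
    show "Tgerm (prs V F) U (Suc m) \<subseteq> Tgerm (prs V F) U m" for m
      using U_Suc S.lev_Suc by (auto simp del: prs_simps)
    show "\<exists>r>0. \<forall>y\<in>lev (prs (Tscs V) (Tscs F)) m. fstf y \<in> {v. evn v \<in> C} \<longrightarrow>
        nrm (prs (Tscs V) (Tscs F)) m (y - x) < r \<longrightarrow> y \<in> Tgerm (prs V F) U m"
      if x: "x \<in> Tgerm (prs V F) U m" for x m
    proof -
      obtain r where r: "r > 0" "\<And>y. y \<in> lev (prs V F) (Suc m) \<Longrightarrow> fstf y \<in> C \<Longrightarrow>
          nrm (prs V F) (Suc m) (y - evn x) < r \<Longrightarrow> y \<in> U (Suc m)"
        using U_open[of "evn x" "Suc m"] x unfolding Tgerm_simps by blast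
      have "y \<in> Tgerm (prs V F) U m" if y: "y \<in> lev (Tscs (prs V F)) m" "evn (fstf y) \<in> C"
        "nrm (Tscs (prs V F)) m (y - x) < r" for y
      proof -
        have "0 \<le> nrm (prs V F) m (odp y - odp x)"
          using x y by (intro S.nonneg S.lev_diff) (simp_all del: prs_simps)
        then have "evn y \<in> U (Suc m)"
          using y by (intro r(2)) (simp_all del: prs_simps)
        then show ?thesis
          using y by (simp del: prs_simps)
      qed
      then show ?thesis
        unfolding Tscs_prs[symmetric] using r(1) by auto
    qed
    show "sc1 (prs (Tscs V) (Tscs F)) (Tscs F) (Tgerm (prs V F) U) (Tmap f A) A2"
      using assms unfolding Tscs_prs .
  qed
qed

lemma tends_1_over_n_scaleR:
  assumes "h \<in> lev (prs V F) m"
  shows "tends (prs V F) m (\<lambda>n. (1 / real (Suc n)) *\<^sub>R h) 0"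
  using S.tends_scaleR[OF LIMSEQ_Suc[OF lim_1_over_n] S.tends_const[OF assms]] by simp

text \<open>Two kinds of direction keep the point in the domain: those pointing into the cone, and
  those along the fibre, which leave the first component fixed. This is \<open>hadamard\<close> at a
  constant point with increments h/(n+1).\<close>

lemma A_direction:
  assumes D: "frech (prs V F) F U f A m" and x: "x \<in> U (Suc m)" and h: "h \<in> lev (prs V F) (Suc m)"
    and C: "fstf h \<in> C \<or> fstf h = 0"
  shows "tends F m (\<lambda>n. real (Suc n) *\<^sub>R (f (x + (1 / real (Suc n)) *\<^sub>R h) - f x)) (A x h)"
proof -
  let ?t = "\<lambda>n. 1 / real (Suc n)"
  have tpos: "0 < ?t n" for n
    by simp
  have lim: "tends (prs V F) (Suc m) (\<lambda>n. ?t n *\<^sub>R h) 0"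
    by (rule tends_1_over_n_scaleR) fact
  have xc: "tends (prs V F) (Suc m) (\<lambda>n. x) x"
    using U_lev[OF x] by (rule S.tends_const)
  have "tends (prs V F) (Suc m) (\<lambda>n. x + ?t n *\<^sub>R h) x"
    using S.tends_add[OF xc lim] by simp
  moreover have "fstf (x + ?t n *\<^sub>R h) \<in> C" for n
    using C U_C[OF x] C_add C_scaleR[OF less_imp_le[OF tpos]] by auto
  ultimately have U: "\<forall>\<^sub>F n in sequentially. x + ?t n *\<^sub>R h \<in> U (Suc m)"
    using x by (intro U_open_tends) auto
  have hc: "tends (prs V F) m (\<lambda>n. (1 / ?t n) *\<^sub>R (?t n *\<^sub>R h)) h"
    using S.tends_const[OF S.lev_Suc[OF h]] by simp
  have "\<forall>\<^sub>F n in sequentially. x \<in> U (Suc m)"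
    using x by simp
  from hadamard[OF D x xc lim this U tpos hc] show ?thesis
    by simp
qed

end

locale sc_map2 = sc_map V F C U f A
  for V :: "'v::real_vector scs" and F :: "'e::real_vector scs" and C U f A +
  fixes A2
  assumes sc1_T: "sc1 (Tscs (prs V F)) (Tscs F) (Tgerm (prs V F) U) (Tmap f A) A2"
begin

sublocale T: sc_map "Tscs V" "Tscs F" "{v. evn v \<in> C}" "Tgerm (prs V F) U" "Tmap f A" A2
  using sc1_T by (rule sc_map_Tscs)

lemma tends_TF: "tends (Tscs F) m X x \<longleftrightarrow> tends F (Suc m) (\<lambda>n. evn (X n)) (evn x) \<and> tends F m (\<lambda>n. odp (X n)) (odp x)"
  using F.sc_scale_axioms by (rule tends_Tscs)

lemma tends_TV: "tends (Tscs V) m X x \<longleftrightarrow> tends V (Suc m) (\<lambda>n. evn (X n)) (evn x) \<and> tends V m (\<lambda>n. odp (X n)) (odp x)"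
  using V.sc_scale_axioms by (rule tends_Tscs)

lemma tends_S: "tends (prs V F) m X x \<longleftrightarrow> tends V m (\<lambda>n. fstf (X n)) (fstf x) \<and> tends F m (\<lambda>n. sndf (X n)) (sndf x)"
  using V.sc_scale_axioms F.sc_scale_axioms by (rule tends_prs)

lemma tends_TS: "tends (prs (Tscs V) (Tscs F)) m X x \<longleftrightarrow>
    tends (prs V F) (Suc m) (\<lambda>n. evn (X n)) (evn x) \<and> tends (prs V F) m (\<lambda>n. odp (X n)) (odp x)"
  unfolding Tscs_prs[symmetric] using S.sc_scale_axioms by (rule tends_Tscs)

lemma lev_TS: "x \<in> lev (prs (Tscs V) (Tscs F)) m \<longleftrightarrow> evn x \<in> lev (prs V F) (Suc m) \<and> odp x \<in> lev (prs V F) m"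
  unfolding Tscs_prs[symmetric] by (simp del: prs_simps)

text \<open>The first component of Tf(x, h) is f(x), so for inward directions both sides are limits
  of the same difference quotients of f. Writing the first component of a direction as a difference
  of cone elements extends this by linearity, and density of level 1 together with continuity gives
  all directions.\<close>

lemma evn_A2:
  assumes x: "x \<in> Tgerm (prs V F) U (Suc m)" and h: "h \<in> lev (prs (Tscs V) (Tscs F)) 0"
  shows "evn (A2 x h) = A (evn x) (evn h)"
proof -
  let ?TS = "prs (Tscs V) (Tscs F)"
  have x1: "x \<in> Tgerm (prs V F) U (Suc 0)"
    using x by (rule T.U_Suc_0)
  have ex: "evn x \<in> U (Suc 0)"
    using x U_Suc_0 unfolding Tgerm_simps by blast
  have inward: "evn (A2 x k) = A (evn x) (evn k)" if k: "k \<in> lev ?TS (Suc 0)" "fstf k \<in> {v. evn v \<in> C}" for k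
  proof (rule F.tends_unique)
    let ?q = "\<lambda>n. real (Suc n) *\<^sub>R (f (evn x + (1 / real (Suc n)) *\<^sub>R evn k) - f (evn x))"
    have "tends (Tscs F) 0 (\<lambda>n. real (Suc n) *\<^sub>R (Tmap f A (x + (1 / real (Suc n)) *\<^sub>R k) - Tmap f A x)) (A2 x k)"
      using k(2) by (intro T.A_direction[OF T.frech_0 x1 k(1)]) blast
    then have "tends F (Suc 0) ?q (evn (A2 x k))"
      unfolding tends_TF by (simp del: of_nat_Suc)
    then show "tends F 0 ?q (evn (A2 x k))"
      by (rule F.tends_Suc)
    show "tends F 0 ?q (A (evn x) (evn k))"
    proof (rule A_direction[OF frech_0 ex])
      show "evn k \<in> lev (prs V F) (Suc 0)"
        using k(1) unfolding lev_TS by (blast intro: S.lev_Suc)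
      show "fstf (evn k) \<in> C \<or> fstf (evn k) = 0"
        using k(2) by simp
    qed
  qed
  have strong: "evn (A2 x k) = A (evn x) (evn k)" if k: "k \<in> lev ?TS (Suc 0)" for k
  proof -
    have "fstf k \<in> lev (Tscs V) (Suc 0)"
      using k by (simp only: prs_simps)
    then have "fstf k \<in> lev (Tscs V) 0"
      by (rule T.V.lev_level)
    then obtain a b where ab: "a \<in> lev (Tscs V) 0" "a \<in> {v. evn v \<in> C}" "b \<in> lev (Tscs V) 0" "b \<in> {v. evn v \<in> C}"
      "fstf k = a - b"
      using T.C_span by blast
    define k1 where "k1 = pairf a (sndf k)"
    define k2 where "k2 = pairf b (0 :: nat \<Rightarrow> 'e)"
    have k12: "k = k1 - k2"
      by (rule pairf_eqI) (simp_all add: k1_def k2_def ab)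
    have lev1: "k1 \<in> lev ?TS (Suc 0)"
      using T.V.lev_level[OF ab(1), of "Suc 0"] k unfolding k1_def prs_simps fstf_simps sndf_simps by blast
    have lev2: "k2 \<in> lev ?TS (Suc 0)"
      using T.V.lev_level[OF ab(3), of "Suc 0"] unfolding k2_def prs_simps fstf_simps sndf_simps by simp
    have "evn (A2 x (k1 - k2)) = evn (A2 x k1) - evn (A2 x k2)"
      using T.A_diff[OF x1 T.S.lev_Suc[OF lev1] T.S.lev_Suc[OF lev2]] by simp
    also have "\<dots> = A (evn x) (evn k1) - A (evn x) (evn k2)"
      using inward[OF lev1] inward[OF lev2] ab by (simp add: k1_def k2_def)
    also have "\<dots> = A (evn x) (evn k1 - evn k2)"
    proof -
      have "evn k1 \<in> lev (prs V F) 0" "evn k2 \<in> lev (prs V F) 0"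
        using lev1 lev2 S.lev_le[of 0 "Suc (Suc 0)"] unfolding lev_TS by blast+
      from A_diff[OF ex this] show ?thesis
        by simp
    qed
    finally show ?thesis
      unfolding k12 by simp
  qed
  obtain X where X: "\<And>n. X n \<in> lev ?TS (Suc 0)" "tends ?TS 0 X h"
    using T.S.dense_seq[OF h] by blast
  show ?thesis
  proof (rule F.tends_unique)
    have "tends (Tscs F) 0 (\<lambda>n. A2 x (X n)) (A2 x h)"
      using x1 by (intro T.A_tends[OF _ x1 _ X(2)] T.S.tends_const T.U_lev) auto
    then have "tends F (Suc 0) (\<lambda>n. evn (A2 x (X n))) (evn (A2 x h))"
      unfolding tends_TF by blast
    then show "tends F 0 (\<lambda>n. A (evn x) (evn (X n))) (evn (A2 x h))"
      using F.tends_Suc strong[OF X(1)] by simp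
    have "tends (prs V F) 0 (\<lambda>n. evn (X n)) (evn h)"
      using X(2) S.tends_Suc unfolding tends_TS by blast
    then show "tends F 0 (\<lambda>n. A (evn x) (evn (X n))) (A (evn x) (evn h))"
      using ex by (intro A_tends[OF _ ex] S.tends_const U_lev) auto
  qed
qed

text \<open>The second component of Tf is linear in the tangent vector, so its difference quotients
  in a direction (0, h) are constant and equal to Df(x)h. Density extends the identity from level 1
  to level 0.\<close>

lemma odp_A2:
  assumes x: "x \<in> Tgerm (prs V F) U (Suc m)" and h: "h \<in> lev (prs V F) 0"
  shows "odp (A2 x (ilv 0 h)) = A (evn x) h"
proof -
  let ?TS = "prs (Tscs V) (Tscs F)"
  have x1: "x \<in> Tgerm (prs V F) U (Suc 0)"
    using x by (rule T.U_Suc_0)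
  have ex: "evn x \<in> U (Suc 0)" and ox: "odp x \<in> lev (prs V F) 0"
    using x1 U_Suc_0 S.lev_Suc unfolding Tgerm_simps by blast+
  have strong: "odp (A2 x (ilv 0 k)) = A (evn x) k" if k: "k \<in> lev (prs V F) (Suc 0)" for k
  proof (rule F.tends_unique)
    let ?k = "ilv 0 k"
    have k0: "k \<in> lev (prs V F) 0"
      using k by (rule S.lev_Suc)
    have lev: "?k \<in> lev ?TS (Suc 0)"
      unfolding lev_TS evn_ilv odp_ilv using k S.lev_zero by blast
    \<comment> \<open>The direction (0, k) does not move the base point, which alone is subject to
      the cone condition.\<close>
    have C: "fstf (x + (1 / real (Suc n)) *\<^sub>R ?k) \<in> {v. evn v \<in> C}" for n
      using U_C[OF ex] by simp
    have lim: "tends ?TS (Suc 0) (\<lambda>n. (1 / real (Suc n)) *\<^sub>R ?k) 0"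
      using lev by (rule T.tends_1_over_n_scaleR)
    have xc: "tends ?TS (Suc 0) (\<lambda>n. x) x"
      using T.U_lev[OF x1] by (rule T.S.tends_const)
    have "tends ?TS (Suc 0) (\<lambda>n. x + (1 / real (Suc n)) *\<^sub>R ?k) x"
      using T.S.tends_add[OF xc lim] by simp
    then have TU: "\<forall>\<^sub>F n in sequentially. x + (1 / real (Suc n)) *\<^sub>R ?k \<in> Tgerm (prs V F) U (Suc 0)"
      using x1 C by (intro T.U_open_tends) auto
    have kc: "tends ?TS 0 (\<lambda>n. (1 / (1 / real (Suc n))) *\<^sub>R ((1 / real (Suc n)) *\<^sub>R ?k)) ?k"
      using T.S.tends_const[OF T.S.lev_Suc[OF lev]] by simp
    have "\<forall>\<^sub>F n in sequentially. x \<in> Tgerm (prs V F) U (Suc 0)"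
      using x1 by simp
    from T.hadamard[OF T.frech_0 x1 xc lim this TU _ kc]
    have "tends (Tscs F) 0 (\<lambda>n. (1 / (1 / real (Suc n))) *\<^sub>R (Tmap f A (x + (1 / real (Suc n)) *\<^sub>R ?k) - Tmap f A x)) (A2 x ?k)"
      by simp
    then have "tends F 0 (\<lambda>n. real (Suc n) *\<^sub>R (A (evn x) (odp x + (1 / real (Suc n)) *\<^sub>R k) - A (evn x) (odp x))) (odp (A2 x ?k))"
      unfolding tends_TF by (simp del: of_nat_Suc)
    moreover have "real (Suc n) *\<^sub>R (A (evn x) (odp x + (1 / real (Suc n)) *\<^sub>R k) - A (evn x) (odp x)) = A (evn x) k" for n
      using A_add[OF ex ox S.lev_scaleR[OF k0]] A_scaleR[OF ex k0] by (simp del: of_nat_Suc)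
    ultimately show "tends F 0 (\<lambda>n. A (evn x) k) (odp (A2 x ?k))"
      by (simp only:)
    show "tends F 0 (\<lambda>n. A (evn x) k) (A (evn x) k)"
      using A_lev[OF ex k0] by (rule F.tends_const)
  qed
  obtain X where X: "\<And>n. X n \<in> lev (prs V F) (Suc 0)" "tends (prs V F) 0 X h"
    using S.dense_seq[OF h] by blast
  have TX: "tends ?TS 0 (\<lambda>n. ilv 0 (X n)) (ilv 0 h)"
    unfolding tends_TS evn_ilv odp_ilv using X(2) S.tends_const[OF S.lev_zero] by blast
  show ?thesis
  proof (rule F.tends_unique)
    have "tends (Tscs F) 0 (\<lambda>n. A2 x (ilv 0 (X n))) (A2 x (ilv 0 h))"
      using x1 by (intro T.A_tends[OF _ x1 _ TX] T.S.tends_const T.U_lev) auto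
    then have "tends F 0 (\<lambda>n. odp (A2 x (ilv 0 (X n)))) (odp (A2 x (ilv 0 h)))"
      unfolding tends_TF by blast
    then show "tends F 0 (\<lambda>n. A (evn x) (X n)) (odp (A2 x (ilv 0 h)))"
      by (simp only: strong[OF X(1)])
    show "tends F 0 (\<lambda>n. A (evn x) (X n)) (A (evn x) h)"
      using ex by (intro A_tends[OF _ ex _ X(2)] S.tends_const U_lev) auto
  qed
qed

end

section \<open>The solution germ of the tangent problem\<close>

locale sc_problem2 = sc_problem V F C U f A W \<delta> "Suc q" + sc_map2 V F C U f A A2
  for V :: "'v::real_vector scs" and F :: "'e::real_vector scs" and C U f A W \<delta> q A2 +
  assumes frech_T: "m < q \<Longrightarrow> frech (Tscs (prs V F)) (Tscs F) (Tgerm (prs V F) U) (Tmap f A) A2 m"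
begin

abbreviation TD where "TD \<equiv> Tmap \<delta> D"

abbreviation TW where "TW \<equiv> Tgerm V W"

lemma TD_graph: "evn (pairf v (TD v)) = gr (evn v)" "odp (pairf v (TD v)) = pairf (odp v) (D (evn v) (odp v))"
  by simp_all

lemma T_graph_U:
  assumes "v \<in> TW m"
  shows "pairf v (TD v) \<in> Tgerm (prs V F) U m"
  unfolding Tgerm_simps TD_graph prs_simps fstf_simps sndf_simps
  using assms graph_U D_lev unfolding Tgerm_simps by blast

lemma TD_tends:
  assumes "v \<in> TW m" "\<forall>\<^sub>F n in sequentially. X n \<in> TW m" "tends (Tscs V) k X v"
  shows "tends (Tscs F) m (\<lambda>n. TD (X n)) (TD v)"
  using sc0_tends[OF sc0_TD T.V.tends_level[OF assms(3)] assms(1,2)] T.F.sc_scale_axioms by blast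

lemma T_gr_tends:
  assumes "v \<in> TW m" "\<forall>\<^sub>F n in sequentially. X n \<in> TW m" "tends (Tscs V) k X v"
  shows "tends (prs (Tscs V) (Tscs F)) m (\<lambda>n. pairf (X n) (TD (X n))) (pairf v (TD v))"
  using TD_tends[OF assms] T.V.tends_level[OF assms(3)] T.V.sc_scale_axioms T.F.sc_scale_axioms
  by (simp add: tends_prs)

lemma TW_ev:
  assumes "\<forall>\<^sub>F n in sequentially. X n \<in> TW m"
  shows "\<forall>\<^sub>F n in sequentially. evn (X n) \<in> W (Suc m)" "\<forall>\<^sub>F n in sequentially. odp (X n) \<in> lev V m"
  using assms by (auto elim: eventually_mono)

lemma W_ev_Suc: "\<forall>\<^sub>F n in sequentially. X n \<in> W (Suc m) \<Longrightarrow> \<forall>\<^sub>F n in sequentially. X n \<in> W m"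
  by (auto elim: eventually_mono dest: W_Suc)

text \<open>The triangular form of the fibre derivative of Tf: both diagonal entries are the fibre
  derivative of f, acting on level m+1 and on level m. The off-diagonal term involves only the first
  component of y.\<close>

lemma A2_split:
  assumes x: "x \<in> Tgerm (prs V F) U (Suc m)" and y: "y \<in> lev (Tscs F) 0"
  shows "evn (A2 x (pairf 0 y)) = A (evn x) (pairf 0 (evn y))"
    and "odp (A2 x (pairf 0 y)) = odp (A2 x (pairf 0 (ilv (evn y) 0))) + A (evn x) (pairf 0 (odp y))"
proof -
  have lev: "evn y \<in> lev F (Suc 0)" "odp y \<in> lev F 0"
    using y unfolding Tscs_simps by blast+
  have h: "pairf 0 y \<in> lev (prs (Tscs V) (Tscs F)) 0" "pairf 0 (ilv (evn y) 0) \<in> lev (prs (Tscs V) (Tscs F)) 0"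
    "ilv 0 (pairf 0 (odp y)) \<in> lev (prs (Tscs V) (Tscs F)) 0"
    unfolding lev_TS using lev by simp_all
  show "evn (A2 x (pairf 0 y)) = A (evn x) (pairf 0 (evn y))"
    using evn_A2[OF x h(1)] by simp
  have eq: "pairf (0 :: nat \<Rightarrow> 'v) y = pairf 0 (ilv (evn y) 0) + ilv 0 (pairf 0 (odp y))"
    by (rule ilv_eqI) (simp_all add: pairf_add)
  have "A2 x (pairf 0 y) = A2 x (pairf 0 (ilv (evn y) 0)) + A2 x (ilv 0 (pairf 0 (odp y)))"
    unfolding eq[symmetric] using T.A_add[OF x h(2,3)] unfolding eq[symmetric] .
  moreover have "odp (A2 x (ilv 0 (pairf 0 (odp y)))) = A (evn x) (pairf 0 (odp y))"
    using lev by (intro odp_A2[OF x]) simp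
  ultimately show "odp (A2 x (pairf 0 y)) = odp (A2 x (pairf 0 (ilv (evn y) 0))) + A (evn x) (pairf 0 (odp y))"
    by simp
qed

text \<open>Forward substitution: solve the first row on level m+1, move the off-diagonal term to
  the right-hand side, and solve the second row on level m.\<close>

lemma T_lin_surj:
  assumes v: "v \<in> TW (Suc m)" and b: "b \<in> lev (Tscs F) m"
  shows "\<exists>y\<in>lev (Tscs F) m. A2 (pairf v (TD v)) (pairf 0 y) = b"
proof -
  let ?x = "pairf v (TD v)"
  have v1: "evn v \<in> W (Suc (Suc m))"
    using v unfolding Tgerm_simps by blast
  have x: "?x \<in> Tgerm (prs V F) U (Suc m)"
    using v by (rule T_graph_U)
  have b12: "evn b \<in> lev F (Suc m)" "odp b \<in> lev F m"
    using b unfolding Tscs_simps by blast+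
  obtain y1 where y1: "y1 \<in> lev F (Suc m)" "A (gr (evn v)) (pairf 0 y1) = evn b"
    using lin_surj[OF v1 b12(1)] by blast
  have "pairf 0 (ilv y1 0) \<in> lev (prs (Tscs V) (Tscs F)) m"
    unfolding lev_TS using y1 by simp
  from T.A_lev[OF x this] have "odp (A2 ?x (pairf 0 (ilv y1 0))) \<in> lev F m"
    unfolding Tscs_simps by blast
  then obtain y2 where y2: "y2 \<in> lev F m" "A (gr (evn v)) (pairf 0 y2) = odp b - odp (A2 ?x (pairf 0 (ilv y1 0)))"
    using lin_surj[OF W_Suc[OF v1] F.lev_diff[OF b12(2)]] by blast
  have lev: "ilv y1 y2 \<in> lev (Tscs F) m"
    using y1 y2 by simp
  then have lev0: "ilv y1 y2 \<in> lev (Tscs F) 0"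
    by (rule T.F.lev_le[OF le0])
  have "A2 ?x (pairf 0 (ilv y1 y2)) = b"
  proof (rule ilv_eqI)
    show "evn (A2 ?x (pairf 0 (ilv y1 y2))) = evn b"
      unfolding A2_split(1)[OF x lev0] TD_graph evn_ilv by (rule y1(2))
    show "odp (A2 ?x (pairf 0 (ilv y1 y2))) = odp b"
      unfolding A2_split(2)[OF x lev0] TD_graph evn_ilv odp_ilv y2(2) by simp
  qed
  with lev show ?thesis
    by blast
qed

text \<open>The same substitution for sequences: \<open>lin_proper\<close> on level m+1 sends the
  first components to 0, continuity of A2 then sends the off-diagonal term to 0, and
  \<open>lin_proper\<close> on level m handles the second components.\<close>

lemma T_lin_proper:
  assumes v: "v \<in> TW (Suc m)" and X: "\<forall>\<^sub>F n in sequentially. X n \<in> TW (Suc m)" "tends (Tscs V) m X v"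
    and Y: "\<forall>\<^sub>F n in sequentially. Y n \<in> lev (Tscs F) m"
    and lim: "tends (Tscs F) m (\<lambda>n. A2 (pairf (X n) (TD (X n))) (pairf 0 (Y n))) 0"
  shows "tends (Tscs F) m Y 0"
proof -
  let ?x = "\<lambda>n. pairf (X n) (TD (X n))"
  have v1: "evn v \<in> W (Suc (Suc m))"
    using v unfolding Tgerm_simps by blast
  have X1: "\<forall>\<^sub>F n in sequentially. evn (X n) \<in> W (Suc (Suc m))"
    using X(1) by (rule TW_ev)
  have xU: "\<forall>\<^sub>F n in sequentially. ?x n \<in> Tgerm (prs V F) U (Suc m)"
    using X(1) by eventually_elim (rule T_graph_U)
  have tX: "tends V k (\<lambda>n. evn (X n)) (evn v)" for k
    using X(2) unfolding tends_TV by (blast intro: V.tends_level)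
  have Y0: "\<forall>\<^sub>F n in sequentially. Y n \<in> lev (Tscs F) 0"
    using Y by eventually_elim (rule T.F.lev_le[OF le0])
  have lim1: "tends F (Suc m) (\<lambda>n. evn (A2 (?x n) (pairf 0 (Y n)))) 0"
    and lim2: "tends F m (\<lambda>n. odp (A2 (?x n) (pairf 0 (Y n)))) 0"
    using lim unfolding tends_TF by simp_all
  have "tends F (Suc m) (\<lambda>n. A (gr (evn (X n))) (pairf 0 (evn (Y n)))) 0"
  proof (rule tends_cong[OF lim1])
    show "\<forall>\<^sub>F n in sequentially. evn (A2 (?x n) (pairf 0 (Y n))) = A (gr (evn (X n))) (pairf 0 (evn (Y n)))"
      using xU Y0 by eventually_elim (simp only: A2_split(1) TD_graph)
  qed
  moreover have "\<forall>\<^sub>F n in sequentially. evn (Y n) \<in> lev F (Suc m)"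
    using Y by (auto elim: eventually_mono)
  ultimately have Y1: "tends F (Suc m) (\<lambda>n. evn (Y n)) 0"
    by (rule lin_proper[OF v1 X1 tX, rotated])
  have "tends (Tscs F) m (\<lambda>n. A2 (?x n) (pairf 0 (ilv (evn (Y n)) 0))) (A2 (pairf v (TD v)) 0)"
  proof (rule T.A_tends[OF _ T_graph_U[OF v] xU])
    show "tends (prs (Tscs V) (Tscs F)) (Suc m) ?x (pairf v (TD v))"
      using v X by (rule T_gr_tends)
    show "tends (prs (Tscs V) (Tscs F)) m (\<lambda>n. pairf 0 (ilv (evn (Y n)) 0)) 0"
      using Y1 unfolding tends_TS tends_S by (simp add: V.tends_const F.tends_const)
  qed
  then have "tends F m (\<lambda>n. odp (A2 (?x n) (pairf 0 (ilv (evn (Y n)) 0)))) 0"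
    unfolding tends_TF T.A_zero[OF T_graph_U[OF v]] by simp
  from F.tends_diff[OF lim2 this]
  have lim3: "tends F m (\<lambda>n. odp (A2 (?x n) (pairf 0 (Y n))) - odp (A2 (?x n) (pairf 0 (ilv (evn (Y n)) 0)))) 0"
    by simp
  have "tends F m (\<lambda>n. A (gr (evn (X n))) (pairf 0 (odp (Y n)))) 0"
  proof (rule tends_cong[OF lim3])
    show "\<forall>\<^sub>F n in sequentially. odp (A2 (?x n) (pairf 0 (Y n))) - odp (A2 (?x n) (pairf 0 (ilv (evn (Y n)) 0)))
        = A (gr (evn (X n))) (pairf 0 (odp (Y n)))"
      using xU Y0
    proof eventually_elim
      case (elim n)
      show ?case
        using A2_split(2)[OF elim] unfolding TD_graph by simp
    qed
  qed
  moreover have "\<forall>\<^sub>F n in sequentially. odp (Y n) \<in> lev F m"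
    using Y by (auto elim: eventually_mono)
  ultimately have "tends F m (\<lambda>n. odp (Y n)) 0"
    by (rule lin_proper[OF W_Suc[OF v1] W_ev_Suc[OF X1] tX, rotated])
  with Y1 show ?thesis
    unfolding tends_TF by simp
qed

text \<open>Write X = (X1, X2) and Y = (Y1, Y2). By \<open>proper\<close> one level up, Y1 is
  o(t)-close to \<delta>(X1). Differentiability of Tf allows Y1 to be replaced by \<delta>(X1) in
  Df(X1, Y1)(X2, Y2) at the cost of o(t). By linearity the result is the fibre derivative of Y2 - D
  X1 X2, and \<open>lin_proper\<close> finishes.\<close>

lemma T_proper:
  assumes m: "m < q" and v: "v \<in> TW (Suc m)"
    and X: "\<forall>\<^sub>F n in sequentially. X n \<in> TW (Suc m)" "tends (Tscs V) m X v"
    and Y: "tends (Tscs F) (Suc m) Y (TD v)"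
    and U: "\<forall>\<^sub>F n in sequentially. pairf (X n) (Y n) \<in> Tgerm (prs V F) U (Suc m)"
    and t: "\<And>n. 0 < t n"
    and lim: "tends (Tscs F) m (\<lambda>n. (1 / t n) *\<^sub>R Tmap f A (pairf (X n) (Y n))) 0"
  shows "tends (Tscs F) m (\<lambda>n. (1 / t n) *\<^sub>R (Y n - TD (X n))) 0"
proof -
  let ?TS = "prs (Tscs V) (Tscs F)"
  have v1: "evn v \<in> W (Suc (Suc m))"
    using v unfolding Tgerm_simps by blast
  have X1: "\<forall>\<^sub>F n in sequentially. evn (X n) \<in> W (Suc (Suc m))"
    using X(1) by (rule TW_ev)
  have tX1: "tends V k (\<lambda>n. evn (X n)) (evn v)" and tX2: "tends V k (\<lambda>n. odp (X n)) (odp v)" for k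
    using X(2) unfolding tends_TV by (blast intro: V.tends_level)+
  have tY1: "tends F (Suc (Suc m)) (\<lambda>n. evn (Y n)) (\<delta> (evn v))"
    and tY2: "tends F (Suc m) (\<lambda>n. odp (Y n)) (D (evn v) (odp v))"
    using Y unfolding tends_TF Tmap_simps by blast+
  have lim1: "tends F (Suc m) (\<lambda>n. (1 / t n) *\<^sub>R f (pairf (evn (X n)) (evn (Y n)))) 0"
    and lim2: "tends F m (\<lambda>n. (1 / t n) *\<^sub>R A (pairf (evn (X n)) (evn (Y n))) (pairf (odp (X n)) (odp (Y n)))) 0"
    using lim unfolding tends_TF by simp_all
  have U1: "\<forall>\<^sub>F n in sequentially. pairf (evn (X n)) (evn (Y n)) \<in> U (Suc (Suc m))"
    using U by (auto elim: eventually_mono)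
  \<comment> \<open>The bound m < q becomes m + 1 < Suc q, the range in which \<open>proper\<close>
    holds for the given problem.\<close>
  have E: "tends F (Suc m) (\<lambda>n. (1 / t n) *\<^sub>R (evn (Y n) - \<delta> (evn (X n)))) 0"
    using m by (intro proper[OF _ v1 X1 tX1 tY1 U1 t lim1]) simp
  have sol: "tends F (Suc (Suc m)) (\<lambda>n. \<delta> (evn (X n))) (\<delta> (evn v))"
    using v1 X1 tX1 by (rule sol_tends)
  \<comment> \<open>\<open>G\<close> has the exact solution in its base component but the old
    tangent component \<open>odp (Y n)\<close>; \<open>H\<close> is the correction leading back to
    Y.\<close>
  define G where "G n = pairf (X n) (ilv (\<delta> (evn (X n))) (odp (Y n)))" for n
  define H where "H n = pairf (0 :: nat \<Rightarrow> 'v) (ilv (evn (Y n) - \<delta> (evn (X n))) 0)" for n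
  have GH: "G n + H n = pairf (X n) (Y n)" for n
    unfolding G_def H_def pairf_add
    by (rule arg_cong2[where f = pairf]) (auto intro: ilv_eqI)
  have evG: "evn (G n) = gr (evn (X n))" and odG: "odp (G n) = pairf (odp (X n)) (odp (Y n))" for n
    by (simp_all add: G_def)
  have GU: "\<forall>\<^sub>F n in sequentially. G n \<in> Tgerm (prs V F) U (Suc m)"
    using X1 U
  proof eventually_elim
    case (elim n)
    have "odp (pairf (X n) (Y n)) \<in> lev (prs V F) (Suc m)"
      using elim(2) unfolding Tgerm_simps by blast
    then show ?case
      unfolding Tgerm_simps evG odG using graph_U[OF elim(1)] by simp
  qed
  have tG: "tends ?TS (Suc m) G (pairf v (TD v))"
    unfolding tends_TS tends_S evG odG using tX1 tX2 sol tY2 by simp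
  have tH: "tends ?TS (Suc m) H 0"
    unfolding tends_TS tends_S H_def using F.tends_diff[OF tY1 sol] by (simp add: V.tends_const F.tends_const)
  \<comment> \<open>The mixed situation for which \<open>hadamard\<close> is made: \<open>H\<close>
    itself is small on level m+1, but after division by t only on level m. The limiting direction is
    0, so the limit of the quotients vanishes.\<close>
  have tH': "tends ?TS m (\<lambda>n. (1 / t n) *\<^sub>R H n) 0"
    unfolding tends_TS tends_S H_def using E by (simp add: V.tends_const F.tends_const)
  have GHU: "\<forall>\<^sub>F n in sequentially. G n + H n \<in> Tgerm (prs V F) U (Suc m)"
    unfolding GH by (rule U)
  have fr: "frech ?TS (Tscs F) (Tgerm (prs V F) U) (Tmap f A) A2 m"
    using frech_T[OF m] unfolding Tscs_prs .
  have "tends (Tscs F) m (\<lambda>n. (1 / t n) *\<^sub>R (Tmap f A (G n + H n) - Tmap f A (G n))) 0"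
    using T.hadamard[OF fr T_graph_U[OF v] tG tH GU GHU t tH'] unfolding T.A_zero[OF T_graph_U[OF v]] .
  then have "tends F m (\<lambda>n. (1 / t n) *\<^sub>R A (pairf (evn (X n)) (evn (Y n))) (pairf (odp (X n)) (odp (Y n)))
      - (1 / t n) *\<^sub>R A (gr (evn (X n))) (pairf (odp (X n)) (odp (Y n)))) 0"
    unfolding GH tends_TF by (simp add: evG odG scaleR_diff_right)
  from F.tends_diff[OF lim2 this]
  have lim3: "tends F m (\<lambda>n. (1 / t n) *\<^sub>R A (gr (evn (X n))) (pairf (odp (X n)) (odp (Y n)))) 0"
    by simp
  have ev: "\<forall>\<^sub>F n in sequentially. odp (X n) \<in> lev V 0 \<and> odp (Y n) \<in> lev F m"
    using tends_ev[OF tX2[of 0]] tends_ev[OF F.tends_Suc[OF tY2]] by eventually_elim simp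
  have "tends F m (\<lambda>n. (1 / t n) *\<^sub>R (odp (Y n) - D (evn (X n)) (odp (X n)))) 0"
  proof (rule lin_proper[OF W_Suc[OF v1] W_ev_Suc[OF X1] tX1])
    show "\<forall>\<^sub>F n in sequentially. (1 / t n) *\<^sub>R (odp (Y n) - D (evn (X n)) (odp (X n))) \<in> lev F m"
      using ev X1
    proof eventually_elim
      case (elim n)
      then show ?case
        using D_lev[OF W_Suc[OF elim(2)], of "odp (X n)" 0] by simp
    qed
    show "tends F m (\<lambda>n. A (gr (evn (X n))) (pairf 0 ((1 / t n) *\<^sub>R (odp (Y n) - D (evn (X n)) (odp (X n)))))) 0"
    proof (rule tends_cong[OF lim3])
      show "\<forall>\<^sub>F n in sequentially. (1 / t n) *\<^sub>R A (gr (evn (X n))) (pairf (odp (X n)) (odp (Y n)))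
          = A (gr (evn (X n))) (pairf 0 ((1 / t n) *\<^sub>R (odp (Y n) - D (evn (X n)) (odp (X n)))))"
        using ev X1
      proof eventually_elim
        case (elim n)
        let ?w = "odp (X n)" and ?y = "odp (Y n)" and ?x = "gr (evn (X n))"
        have x: "?x \<in> U (Suc (Suc m))"
          using elim(2) by (rule graph_U)
        have w: "?w \<in> lev V 0"
          using elim by simp
        have z: "D (evn (X n)) ?w \<in> lev F 0"
          using W_Suc_0[OF elim(2)] w by (rule D_lev)
        have y: "?y \<in> lev F 0"
          using elim(1) F.lev_le[OF le0] by blast
        have "A ?x (pairf ?w ?y) = A ?x (pairf 0 (?y - D (evn (X n)) ?w))"
          using A_diff[OF x, of "pairf ?w ?y" "pairf ?w (D (evn (X n)) ?w)"] w y z D_zero[OF elim(2) w]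
          by (simp add: pairf_diff)
        moreover have "A ?x (pairf 0 ((1 / t n) *\<^sub>R (?y - D (evn (X n)) ?w)))
            = (1 / t n) *\<^sub>R A ?x (pairf 0 (?y - D (evn (X n)) ?w))"
          using A_scaleR[OF x, of "pairf 0 (?y - D (evn (X n)) ?w)" "1 / t n"] y z by (simp add: pairf_scaleR)
        ultimately show ?case
          by simp
      qed
    qed
  qed
  with E show ?thesis
    unfolding tends_TF by simp
qed

text \<open>The induction step: the conclusion is an \<open>sc_problem\<close> again, now for Tf and
  the tangent of \<delta>, with q in place of \<open>Suc q\<close>.\<close>

theorem sc_problem_Tscs:
  "sc_problem (Tscs V) (Tscs F) {v. evn v \<in> C} (Tgerm (prs V F) U) (Tmap f A) A2 (Tgerm V W) (Tmap \<delta> D) q"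
proof
  show "0 \<in> TW m" for m
    using zero_W by simp
  show "v \<in> lev (Tscs V) m" if "v \<in> TW m" for v m
    using that W_lev by simp
  show "TW (Suc m) \<subseteq> TW m" for m
    using W_Suc V.lev_Suc by auto
  show "pairf v (TD v) \<in> Tgerm (prs V F) U m" if "v \<in> TW m" for v m
    using that by (rule T_graph_U)
  show "Tmap f A (pairf v (TD v)) = 0" if "v \<in> TW 0" for v
  proof (rule ilv_eqI)
    have v: "evn v \<in> W (Suc 0)" "odp v \<in> lev V 0"
      using that unfolding Tgerm_simps by blast+
    show "evn (Tmap f A (pairf v (TD v))) = evn 0"
      using graph_zero[OF W_0[OF v(1)]] by simp
    show "odp (Tmap f A (pairf v (TD v))) = odp 0"
      using D_zero[OF v] by simp
  qed
  show "frech (prs (Tscs V) (Tscs F)) (Tscs F) (Tgerm (prs V F) U) (Tmap f A) A2 m" if "m < q" for m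
    using frech_T[OF that] unfolding Tscs_prs .
  show "sc0 (Tscs V) (Tscs F) TW TD"
    by (rule sc0_TD)
  show "tends (Tscs F) m (\<lambda>n. (1 / t n) *\<^sub>R (Y n - TD (X n))) 0"
    if "m < q" "v \<in> TW (Suc m)" "\<forall>\<^sub>F n in sequentially. X n \<in> TW (Suc m)" "tends (Tscs V) m X v"
      "tends (Tscs F) (Suc m) Y (TD v)" "\<forall>\<^sub>F n in sequentially. pairf (X n) (Y n) \<in> Tgerm (prs V F) U (Suc m)"
      "\<And>n. 0 < t n" "tends (Tscs F) m (\<lambda>n. (1 / t n) *\<^sub>R Tmap f A (pairf (X n) (Y n))) 0"
    for m v X Y t
    using that by (rule T_proper)
  show "tends (Tscs F) m Y 0"
    if "v \<in> TW (Suc m)" "\<forall>\<^sub>F n in sequentially. X n \<in> TW (Suc m)" "tends (Tscs V) m X v"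
      "\<forall>\<^sub>F n in sequentially. Y n \<in> lev (Tscs F) m"
      "tends (Tscs F) m (\<lambda>n. A2 (pairf (X n) (TD (X n))) (pairf 0 (Y n))) 0"
    for m v X Y
    using that by (rule T_lin_proper)
  show "\<exists>y\<in>lev (Tscs F) m. A2 (pairf v (TD v)) (pairf 0 y) = b"
    if "v \<in> TW (Suc m)" "b \<in> lev (Tscs F) m" for m v b
    using that by (rule T_lin_surj)
qed

end

section \<open>Contraction germs\<close>

text \<open>Apply the differentiability of Tf at points (x, 0) with increments (h, 0). On level m of
  the tangent scale the first component is measured on level m+1, and by \<open>evn_A2\<close> the
  first component of the remainder is the remainder of f. One tangent order is thus traded for one
  level.\<close>

lemma (in sc_map2) frech_up:
  assumes "frech (Tscs (prs V F)) (Tscs F) (Tgerm (prs V F) U) (Tmap f A) A2 m"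
  shows "frech (prs V F) F U f A (Suc m)"
  unfolding frech_def
proof (intro ballI allI impI)
  fix x and e :: real
  assume x: "x \<in> U (Suc (Suc m))" and e: "0 < e"
  let ?S = "prs V F" and ?x = "ilv x 0"
  have xT: "?x \<in> Tgerm ?S U (Suc m)"
    unfolding Tgerm_simps evn_ilv odp_ilv using x S.lev_zero by blast
  obtain d where d: "0 < d" "\<And>h. h \<in> lev (Tscs ?S) (Suc m) \<Longrightarrow> ?x + h \<in> Tgerm ?S U (Suc m) \<Longrightarrow>
      0 < nrm (Tscs ?S) (Suc m) h \<Longrightarrow> nrm (Tscs ?S) (Suc m) h < d \<Longrightarrow>
      nrm (Tscs F) m (Tmap f A (?x + h) - Tmap f A ?x - A2 ?x h) \<le> e * nrm (Tscs ?S) (Suc m) h"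
    using assms[unfolded frech_def, THEN bspec, OF xT, THEN spec, THEN mp, OF e] by blast
  have "nrm F (Suc m) (f (x + h) - f x - A x h) \<le> e * nrm ?S (Suc (Suc m)) h"
    if h: "h \<in> lev ?S (Suc (Suc m))" and xh: "x + h \<in> U (Suc (Suc m))"
      and n: "0 < nrm ?S (Suc (Suc m)) h" "nrm ?S (Suc (Suc m)) h < d" for h
  proof -
    let ?h = "ilv h 0"
    have hT: "?h \<in> lev (Tscs ?S) (Suc m)"
      unfolding Tscs_simps evn_ilv odp_ilv using h S.lev_zero by blast
    have eq: "?x + ?h = ilv (x + h) 0"
      by (rule ilv_eqI) simp_all
    have xhT: "?x + ?h \<in> Tgerm ?S U (Suc m)"
      unfolding eq Tgerm_simps evn_ilv odp_ilv using xh S.lev_zero by blast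
    have nh: "nrm (Tscs ?S) (Suc m) ?h = nrm ?S (Suc (Suc m)) h"
      by simp
    let ?z = "Tmap f A (?x + ?h) - Tmap f A ?x - A2 ?x ?h"
    have z: "nrm (Tscs F) m ?z \<le> e * nrm ?S (Suc (Suc m)) h"
      using d(2)[OF hT xhT] n unfolding nh by blast
    have hT': "?h \<in> lev (prs (Tscs V) (Tscs F)) (Suc m)"
      using hT unfolding Tscs_prs .
    have "?z \<in> lev (Tscs F) m"
      using T.f_lev[OF T.U_Suc[OF xhT]] T.f_lev[OF T.U_Suc[OF xT]] T.A_lev[OF xT T.S.lev_Suc[OF hT']]
      by (intro T.F.lev_diff)
    then have "odp ?z \<in> lev F m"
      unfolding Tscs_simps by blast
    then have "0 \<le> nrm F m (odp ?z)"
      by (rule F.nonneg)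
    then have "nrm F (Suc m) (evn ?z) \<le> nrm (Tscs F) m ?z"
      unfolding Tscs_simps by simp
    moreover have "evn ?z = f (x + h) - f x - A x h"
      using evn_A2[OF xT T.S.lev_le[OF le0 hT']] by simp
    ultimately show ?thesis
      using z by simp
  qed
  with d(1) show "\<exists>d>0. \<forall>h. h \<in> lev ?S (Suc (Suc m)) \<and> x + h \<in> U (Suc (Suc m)) \<and> 0 < nrm ?S (Suc (Suc m)) h
      \<and> nrm ?S (Suc (Suc m)) h < d \<longrightarrow> nrm F (Suc m) (f (x + h) - f x - A x h) \<le> e * nrm ?S (Suc (Suc m)) h"
    by blast
qed

text \<open>\<open>contraction\<close> is the hypothesis on B(v,u) = u - f(v,u) for the single value
  epsilon = 1/2. The radius depends on the level, so \<open>W_small\<close> keeps the graph over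
  \<open>W m\<close> inside it; the strict inequality leaves room for points near the graph.\<close>

locale sc_contraction = sc_map V F C U f A
  for V :: "'v::real_vector scs" and F :: "'e::real_vector scs" and C U f A +
  fixes W :: "nat \<Rightarrow> (nat \<Rightarrow> 'v) set" and \<delta> :: "(nat \<Rightarrow> 'v) \<Rightarrow> nat \<Rightarrow> 'e" and rad :: "nat \<Rightarrow> real"
  assumes zero_W: "0 \<in> W m"
    and W_lev: "v \<in> W m \<Longrightarrow> v \<in> lev V m"
    and W_decr: "W (Suc m) \<subseteq> W m"
    and graph_U: "v \<in> W m \<Longrightarrow> pairf v (\<delta> v) \<in> U m"
    and graph_zero: "v \<in> W 0 \<Longrightarrow> f (pairf v (\<delta> v)) = 0"
    and sc0_sol: "sc0 V F W \<delta>"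
    and compact_embed: "(\<And>n. X n \<in> lev F (Suc m) \<and> nrm F (Suc m) (X n) \<le> K) \<Longrightarrow>
      \<exists>r y. strict_mono (r :: nat \<Rightarrow> nat) \<and> tends F m (\<lambda>n. X (r n)) y"
    and complete: "(\<And>n. X n \<in> lev F m) \<Longrightarrow> (\<And>e. 0 < e \<Longrightarrow> \<exists>K. \<forall>i\<ge>K. \<forall>j\<ge>K. nrm F m (X i - X j) < e) \<Longrightarrow>
      \<exists>y. tends F m X y"
    and contraction: "pairf v u \<in> U m \<Longrightarrow> pairf v u' \<in> U m \<Longrightarrow> nrm V m v + nrm F m u < rad m \<Longrightarrow>
      nrm V m v + nrm F m u' < rad m \<Longrightarrow>
      nrm F m ((u - f (pairf v u)) - (u' - f (pairf v u'))) \<le> nrm F m (u - u') / 2"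
    and W_small: "v \<in> W m \<Longrightarrow> nrm V m v + nrm F m (\<delta> v) < rad m"
begin

abbreviation gr where "gr v \<equiv> pairf v (\<delta> v)"

lemma W_Suc: "v \<in> W (Suc m) \<Longrightarrow> v \<in> W m"
  using W_decr by auto

lemma W_0: "v \<in> W m \<Longrightarrow> v \<in> W 0"
  using lift_Suc_antimono_le[of W 0 m] W_decr by auto

lemma sol_lev: "v \<in> W m \<Longrightarrow> \<delta> v \<in> lev F m"
  using sc0_lev[OF sc0_sol] .

lemma A0_lev: "v \<in> W (Suc m) \<Longrightarrow> h \<in> lev F m \<Longrightarrow> A (gr v) (pairf 0 h) \<in> lev F m"
  by (rule A_lev[OF graph_U]) simp_all

lemma ev_contraction:
  assumes v: "v \<in> W m" and x: "tends F m X (\<delta> v)" "\<forall>\<^sub>F n in sequentially. pairf v (X n) \<in> U m"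
  shows "\<forall>\<^sub>F n in sequentially. nrm F m ((X n - f (pairf v (X n))) - (\<delta> v - f (gr v))) \<le> nrm F m (X n - \<delta> v) / 2"
proof -
  have "(\<lambda>n. nrm V m v + nrm F m (X n)) \<longlonglongrightarrow> nrm V m v + nrm F m (\<delta> v)"
    by (intro tendsto_intros F.tends_nrm x)
  from order_tendstoD(2)[OF this W_small[OF v]] x(2) show ?thesis
    by eventually_elim (rule contraction[OF _ graph_U[OF v] _ W_small[OF v]])
qed

text \<open>The difference quotients are bounded in the strong norm by the contraction estimate on the
  stronger level, so by compactness they converge on the weaker level, where the contraction
  estimate passes to the limit.\<close>

lemma lin_contraction_strong:
  assumes v: "v \<in> W (Suc m)" and h: "h \<in> lev F (Suc m)"
  shows "nrm F m (h - A (gr v) (pairf 0 h)) \<le> nrm F m h / 2"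
proof -
  let ?t = "\<lambda>n. 1 / real (Suc n)"
  \<comment> \<open>\<open>q n\<close> is the difference quotient of B(v, .) at \<delta> v in
    direction h.\<close>
  define q where "q n = h - real (Suc n) *\<^sub>R (f (gr v + ?t n *\<^sub>R pairf 0 h) - f (gr v))" for n
  have h0: "h \<in> lev F n" if "n \<le> Suc m" for n
    using that h by (rule F.lev_le)
  have x: "gr v \<in> U (Suc m)"
    using v by (rule graph_U)
  \<comment> \<open>Class sc^1 yields this limit on level 0 only. It serves to identify the limit
    that compactness produces on level m.\<close>
  have "tends F 0 (\<lambda>n. real (Suc n) *\<^sub>R (f (gr v + ?t n *\<^sub>R pairf 0 h) - f (gr v))) (A (gr v) (pairf 0 h))"
    using h0[of "Suc 0"] V.lev_zero by (intro A_direction[OF frech_0 U_Suc_0[OF x]]) simp_all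
  from F.tends_diff[OF F.tends_const this] have q0: "tends F 0 q (h - A (gr v) (pairf 0 h))"
    unfolding q_def using h0[of 0] by blast
  have eq: "gr v + ?t n *\<^sub>R pairf 0 h = pairf v (\<delta> v + ?t n *\<^sub>R h)" for n
    by (simp add: pairf_scaleR pairf_add)
  have lim: "tends F (Suc m) (\<lambda>n. \<delta> v + ?t n *\<^sub>R h) (\<delta> v)"
    using F.tends_add[OF F.tends_const[OF sol_lev[OF v]] F.tends_scaleR[OF LIMSEQ_Suc[OF lim_1_over_n] F.tends_const[OF h]]]
    by simp
  have "tends (prs V F) (Suc m) (\<lambda>n. pairf v (\<delta> v + ?t n *\<^sub>R h)) (gr v)"
    using lim V.sc_scale_axioms F.sc_scale_axioms W_lev[OF v] by (simp add: tends_prs V.tends_const)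
  then have U: "\<forall>\<^sub>F n in sequentially. pairf v (\<delta> v + ?t n *\<^sub>R h) \<in> U (Suc m)"
    using x U_C[OF x] by (intro U_open_tends) auto
  then have U': "\<forall>\<^sub>F n in sequentially. pairf v (\<delta> v + ?t n *\<^sub>R h) \<in> U m"
    by (auto elim: eventually_mono dest: U_Suc)
  have qbound: "nrm F k (q n) \<le> nrm F k h / 2" and qlev: "q n \<in> lev F k"
    if k: "k \<le> Suc m" and Un: "pairf v (\<delta> v + ?t n *\<^sub>R h) \<in> U k" "gr v \<in> U k"
      and c: "nrm F k ((\<delta> v + ?t n *\<^sub>R h - f (pairf v (\<delta> v + ?t n *\<^sub>R h))) - (\<delta> v - f (gr v)))
        \<le> nrm F k (\<delta> v + ?t n *\<^sub>R h - \<delta> v) / 2" for k n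
  proof -
    have hk: "h \<in> lev F k"
      using k by (rule h0)
    show ql: "q n \<in> lev F k"
      unfolding q_def eq using f_lev[OF Un(1)] f_lev[OF Un(2)] hk by (intro F.lev_diff F.lev_scaleR)
    have "(\<delta> v + ?t n *\<^sub>R h - f (pairf v (\<delta> v + ?t n *\<^sub>R h))) - (\<delta> v - f (gr v)) = ?t n *\<^sub>R q n"
      unfolding q_def eq by (simp add: scaleR_diff_right del: of_nat_Suc)
    then have "nrm F k (?t n *\<^sub>R q n) \<le> nrm F k (?t n *\<^sub>R h) / 2"
      using c by (simp only: add_diff_cancel_left')
    then have "\<bar>?t n\<bar> * nrm F k (q n) \<le> \<bar>?t n\<bar> * nrm F k h / 2"
      unfolding F.homog[OF ql] F.homog[OF hk] .
    moreover have "\<bar>?t n\<bar> = ?t n"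
      by simp
    ultimately have "?t n * nrm F k (q n) \<le> ?t n * (nrm F k h / 2)"
      by (simp only: times_divide_eq_right)
    then show "nrm F k (q n) \<le> nrm F k h / 2"
      by (rule mult_left_le_imp_le) simp
  qed
  have "\<forall>\<^sub>F n in sequentially. q n \<in> lev F (Suc m) \<and> nrm F (Suc m) (q n) \<le> nrm F (Suc m) h / 2
      \<and> nrm F m (q n) \<le> nrm F m h / 2"
    using U U' ev_contraction[OF v lim U] ev_contraction[OF W_Suc[OF v] F.tends_Suc[OF lim] U']
  proof eventually_elim
    case (elim n)
    then show ?case
      using qbound[OF le_refl elim(1) x elim(3)] qlev[OF le_refl elim(1) x elim(3)]
        qbound[OF _ elim(2) U_Suc[OF x] elim(4)] by simp
  qed
  then obtain M where M: "\<And>n. M \<le> n \<Longrightarrow> q n \<in> lev F (Suc m) \<and> nrm F (Suc m) (q n) \<le> nrm F (Suc m) h / 2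
      \<and> nrm F m (q n) \<le> nrm F m h / 2"
    unfolding eventually_sequentially by blast
  then have "q (n + M) \<in> lev F (Suc m) \<and> nrm F (Suc m) (q (n + M)) \<le> nrm F (Suc m) h / 2" for n
    by simp
  then obtain r y where r: "strict_mono (r :: nat \<Rightarrow> nat)" "tends F m (\<lambda>n. q (r n + M)) y"
    using compact_embed[of "\<lambda>n. q (n + M)" m "nrm F (Suc m) h / 2"] by blast
  have "strict_mono (\<lambda>n. r n + M)"
    using r(1) by (simp add: strict_mono_def)
  from F.tends_unique[OF F.tends_le[OF le0 r(2)] tends_subseq[OF q0 this]]
  have y: "y = h - A (gr v) (pairf 0 h)" .
  have "nrm F m y \<le> nrm F m h / 2"
    using F.tends_nrm[OF r(2)] by (rule LIMSEQ_le_const2) (use M in auto)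
  then show ?thesis
    unfolding y .
qed

text \<open>Both sides of the estimate are continuous in h on level m, and level m+1 is dense
  there.\<close>

lemma lin_contraction:
  assumes v: "v \<in> W (Suc m)" and h: "h \<in> lev F m"
  shows "nrm F m (h - A (gr v) (pairf 0 h)) \<le> nrm F m h / 2"
proof -
  obtain X where X: "\<And>n. X n \<in> lev F (Suc m)" "tends F m X h"
    using F.dense_seq[OF h] by blast
  have x: "gr v \<in> U (Suc m)"
    using v by (rule graph_U)
  have "tends F m (\<lambda>n. A (gr v) (pairf 0 (X n))) (A (gr v) (pairf 0 h))"
  proof (rule A_tends[OF S.tends_const[OF U_lev[OF x]] x])
    show "tends (prs V F) m (\<lambda>n. pairf 0 (X n)) (pairf 0 h)"
      using X(2) V.sc_scale_axioms F.sc_scale_axioms by (simp add: tends_prs V.tends_const)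
  qed (use x in simp)
  from F.tends_diff[OF X(2) this]
  have "(\<lambda>n. nrm F m (X n - A (gr v) (pairf 0 (X n)))) \<longlonglongrightarrow> nrm F m (h - A (gr v) (pairf 0 h))"
    by (rule F.tends_nrm)
  moreover have "(\<lambda>n. nrm F m (X n) / 2) \<longlonglongrightarrow> nrm F m h / 2"
    by (intro tendsto_intros F.tends_nrm X) simp
  ultimately show ?thesis
    by (rule LIMSEQ_le) (use lin_contraction_strong[OF v X(1)] in blast)
qed

lemma lin_coercive:
  assumes v: "v \<in> W (Suc m)" and h: "h \<in> lev F m"
  shows "nrm F m h \<le> 2 * nrm F m (A (gr v) (pairf 0 h))"
  using F.triangle[of "h - A (gr v) (pairf 0 h)" m "A (gr v) (pairf 0 h)"] lin_contraction[OF assms] A0_lev[OF assms] h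
  by simp

lemma lin_proper:
  assumes X: "\<forall>\<^sub>F n in sequentially. X n \<in> W (Suc m)" and Y: "\<forall>\<^sub>F n in sequentially. Y n \<in> lev F m"
    and lim: "tends F m (\<lambda>n. A (gr (X n)) (pairf 0 (Y n))) 0"
  shows "tends F m Y 0"
proof (rule F.tends_evI)
  show "\<forall>\<^sub>F n in sequentially. Y n \<in> lev F m \<and> nrm F m (Y n - 0) \<le> 2 * nrm F m (A (gr (X n)) (pairf 0 (Y n)))"
    using X Y by eventually_elim (use lin_coercive in simp)
  show "(\<lambda>n. 2 * nrm F m (A (gr (X n)) (pairf 0 (Y n)))) \<longlonglongrightarrow> 0"
    using tendsto_mult_left[OF tends_lim[OF lim], of 2] by simp
qed simp

text \<open>\<open>K\<close> is the fibre derivative of B along the graph. As K shrinks norms by the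
  factor 1/2, the iteration y \<mapsto> b + K y started at 0 converges (the Neumann series), and its
  limit solves y - K y = b.\<close>

lemma lin_surj:
  assumes v: "v \<in> W (Suc m)" and b: "b \<in> lev F m"
  shows "\<exists>y\<in>lev F m. A (gr v) (pairf 0 y) = b"
proof -
  define K where "K h = h - A (gr v) (pairf 0 h)" for h
  have Kbound: "nrm F m (K h) \<le> nrm F m h / 2" and Klev: "K h \<in> lev F m" if "h \<in> lev F m" for h
    using that lin_contraction[OF v] A0_lev[OF v] by (simp_all add: K_def)
  have x: "gr v \<in> U (Suc m)"
    using v by (rule graph_U)
  have Kdiff: "K (h - k) = K h - K k" if "h \<in> lev F m" "k \<in> lev F m" for h k
    using A_diff[OF x, of "pairf 0 h" "pairf 0 k"] F.lev_le[OF le0] that by (simp add: K_def pairf_diff)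
  define y where "y n = ((\<lambda>z. b + K z) ^^ n) 0" for n
  have y_Suc: "y (Suc n) = b + K (y n)" for n
    by (simp add: y_def)
  have y_lev: "y n \<in> lev F m" for n
    by (induction n) (use b Klev in \<open>simp_all add: y_def\<close>)
  have step: "nrm F m (y (Suc n) - y n) \<le> (1 / 2) ^ n * nrm F m b" for n
  proof (induction n)
    case 0
    have "K 0 = 0"
      using A_zero[OF x] by (simp add: K_def)
    then show ?case
      by (simp add: y_def)
  next
    case (Suc n)
    have "y (Suc (Suc n)) - y (Suc n) = (b + K (y (Suc n))) - (b + K (y n))"
      by (rule arg_cong2[where f = minus]) (rule y_Suc)+
    also have "\<dots> = K (y (Suc n) - y n)"
      unfolding Kdiff[OF y_lev y_lev] by simp
    finally show ?case
      using Kbound[of "y (Suc n) - y n"] y_lev Suc by (simp del: funpow.simps)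
  qed
  have dist: "nrm F m (y (n + j) - y n) \<le> 2 * (1 / 2) ^ n * nrm F m b" for n j
  proof -
    \<comment> \<open>The factor is the closed form of the sum of (1/2)^i over n \<le> i < n + j;
      the weaker bound without the subtracted term would not be inductive in j.\<close>
    have "nrm F m (y (n + j) - y n) \<le> (2 * (1 / 2) ^ n - 2 * (1 / 2) ^ (n + j)) * nrm F m b"
    proof (induction j)
      case (Suc j)
      have "nrm F m (y (n + Suc j) - y n) \<le> nrm F m (y (Suc (n + j)) - y (n + j)) + nrm F m (y (n + j) - y n)"
        using F.nrm_triangle3[of "y (Suc (n + j))" m "y (n + j)" "y n"] y_lev by simp
      also have "\<dots> \<le> (1 / 2) ^ (n + j) * nrm F m b + (2 * (1 / 2) ^ n - 2 * (1 / 2) ^ (n + j)) * nrm F m b"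
        by (intro add_mono step Suc)
      finally show ?case
        by (simp add: algebra_simps)
    qed simp
    also have "\<dots> \<le> 2 * (1 / 2) ^ n * nrm F m b"
      using F.nonneg[OF b] by (intro mult_right_mono) auto
    finally show ?thesis .
  qed
  have "\<exists>k. tends F m y k"
  proof (rule complete)
    fix e :: real
    assume e: "0 < e"
    \<comment> \<open>The constant 4 is twice the constant of \<open>dist\<close>, since y i and y j
      are both compared with y k.\<close>
    have "(\<lambda>n. 4 * nrm F m b * (1 / 2) ^ n) \<longlonglongrightarrow> 4 * nrm F m b * 0"
      by (intro tendsto_mult_left LIMSEQ_realpow_zero) simp_all
    then have "\<forall>\<^sub>F n in sequentially. 4 * nrm F m b * (1 / 2) ^ n < e"
      using order_tendstoD(2)[of _ "4 * nrm F m b * 0" sequentially e] e by simp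
    then obtain k where k: "4 * nrm F m b * (1 / 2) ^ k < e"
      unfolding eventually_sequentially by blast
    have "nrm F m (y i - y j) < e" if "k \<le> i" "k \<le> j" for i j
    proof -
      have "nrm F m (y i - y j) \<le> nrm F m (y i - y k) + nrm F m (y j - y k)"
        using F.nrm_triangle3[of "y i" m "y k" "y j"] F.nrm_minus_commute[of "y k" m "y j"] y_lev by simp
      then show ?thesis
        using dist[of k "i - k"] dist[of k "j - k"] that k by (simp add: mult_ac)
    qed
    then show "\<exists>K. \<forall>i\<ge>K. \<forall>j\<ge>K. nrm F m (y i - y j) < e"
      by blast
  qed (rule y_lev)
  then obtain l where l: "tends F m y l"
    by blast
  have l_lev: "l \<in> lev F m"
    using l by (rule tends_lev)
  have "tends F m (\<lambda>n. K (y n)) (K l)"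
  proof (rule F.tends_evI)
    show "\<forall>\<^sub>F n in sequentially. K (y n) \<in> lev F m \<and> nrm F m (K (y n) - K l) \<le> nrm F m (y n - l) / 2"
    proof (rule always_eventually, rule allI)
      fix n
      show "K (y n) \<in> lev F m \<and> nrm F m (K (y n) - K l) \<le> nrm F m (y n - l) / 2"
        using Kbound[of "y n - l"] Klev[OF y_lev] Kdiff[OF y_lev l_lev] y_lev l_lev by simp
    qed
    show "(\<lambda>n. nrm F m (y n - l) / 2) \<longlonglongrightarrow> 0"
      using tendsto_divide[OF tends_lim[OF l] tendsto_const, of 2] by simp
  qed (rule Klev[OF l_lev])
  then have "tends F m (\<lambda>n. y (Suc n)) (b + K l)"
    unfolding y_Suc using b by (intro F.tends_add F.tends_const)
  moreover have "tends F m (\<lambda>n. y (Suc n)) l"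
    using tends_subseq[OF l, of Suc] by (simp add: strict_mono_Suc_iff)
  ultimately have "b + K l = l"
    by (rule F.tends_unique)
  then have "A (gr v) (pairf 0 l) = b"
    by (simp add: K_def algebra_simps)
  with l_lev show ?thesis
    by blast
qed

text \<open>As f vanishes at (X n, \<delta>(X n)), the contraction estimate between Y n and
  \<delta>(X n) gives ||Y n - \<delta>(X n)||_m \<le> 2 ||f(X n, Y n)||_m, a linear bound that
  survives division by t n.\<close>

lemma proper:
  assumes v: "v \<in> W (Suc m)" and X: "\<forall>\<^sub>F n in sequentially. X n \<in> W (Suc m)" "tends V m X v"
    and Y: "tends F (Suc m) Y (\<delta> v)" and U: "\<forall>\<^sub>F n in sequentially. pairf (X n) (Y n) \<in> U (Suc m)"
    and t: "\<And>n. 0 < t n" and lim: "tends F m (\<lambda>n. (1 / t n) *\<^sub>R f (pairf (X n) (Y n))) 0"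
  shows "tends F m (\<lambda>n. (1 / t n) *\<^sub>R (Y n - \<delta> (X n))) 0"
proof (rule F.tends_evI)
  have Ym: "tends F m Y (\<delta> v)"
    using Y by (rule F.tends_Suc)
  have "(\<lambda>n. nrm V m (X n) + nrm F m (Y n)) \<longlonglongrightarrow> nrm V m v + nrm F m (\<delta> v)"
    by (intro tendsto_add V.tends_nrm F.tends_nrm Ym X)
  from order_tendstoD(2)[OF this W_small[OF W_Suc[OF v]]] X(1) U tends_ev[OF Ym] tends_ev[OF lim]
  show "\<forall>\<^sub>F n in sequentially. (1 / t n) *\<^sub>R (Y n - \<delta> (X n)) \<in> lev F m \<and>
      nrm F m ((1 / t n) *\<^sub>R (Y n - \<delta> (X n)) - 0) \<le> 2 * nrm F m ((1 / t n) *\<^sub>R f (pairf (X n) (Y n)))"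
  proof eventually_elim
    case (elim n)
    let ?f = "f (pairf (X n) (Y n))"
    have Xm: "X n \<in> W m"
      using elim(2) by (rule W_Suc)
    have lev: "Y n - \<delta> (X n) \<in> lev F m" "?f \<in> lev F m"
      using elim(4) sol_lev[OF Xm] f_lev[OF U_Suc[OF elim(3)]] by simp_all
    have "nrm F m (Y n - ?f - (\<delta> (X n) - f (gr (X n)))) \<le> nrm F m (Y n - \<delta> (X n)) / 2"
      using U_Suc[OF elim(3)] graph_U[OF Xm] elim(1) W_small[OF Xm] by (rule contraction)
    then have "nrm F m (Y n - \<delta> (X n) - ?f) \<le> nrm F m (Y n - \<delta> (X n)) / 2"
      unfolding graph_zero[OF W_0[OF Xm]] by (simp add: algebra_simps)
    moreover have "nrm F m (Y n - \<delta> (X n)) \<le> nrm F m (Y n - \<delta> (X n) - ?f) + nrm F m ?f"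
      using F.triangle[OF F.lev_diff[OF lev] lev(2)] by simp
    ultimately have "nrm F m (Y n - \<delta> (X n)) \<le> 2 * nrm F m ?f"
      by simp
    then have "\<bar>1 / t n\<bar> * nrm F m (Y n - \<delta> (X n)) \<le> \<bar>1 / t n\<bar> * (2 * nrm F m ?f)"
      by (rule mult_left_mono) simp
    then show ?case
      using F.homog[OF lev(1), of "1 / t n"] F.homog[OF lev(2), of "1 / t n"] lev(1) by simp
  qed
  show "(\<lambda>n. 2 * nrm F m ((1 / t n) *\<^sub>R f (pairf (X n) (Y n)))) \<longlonglongrightarrow> 0"
    using tendsto_mult_left[OF tends_lim[OF lim], of 2] by simp
qed simp

theorem sc_problem_contraction:
  assumes "\<And>m. m < p \<Longrightarrow> frech (prs V F) F U f A m"
  shows "sc_problem V F C U f A W \<delta> p"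
proof
  show "0 \<in> W m" for m
    by (rule zero_W)
  show "W (Suc m) \<subseteq> W m" for m
    by (rule W_decr)
  show "v \<in> lev V m" if "v \<in> W m" for v m
    using that by (rule W_lev)
  show "gr v \<in> U m" if "v \<in> W m" for v m
    using that by (rule graph_U)
  show "f (gr v) = 0" if "v \<in> W 0" for v
    using that by (rule graph_zero)
  show "sc0 V F W \<delta>"
    by (rule sc0_sol)
  show "frech (prs V F) F U f A m" if "m < p" for m
    using that by (rule assms)
  show "tends F m (\<lambda>n. (1 / t n) *\<^sub>R (Y n - \<delta> (X n))) 0"
    if "v \<in> W (Suc m)" "\<forall>\<^sub>F n in sequentially. X n \<in> W (Suc m)" "tends V m X v"
      "tends F (Suc m) Y (\<delta> v)" "\<forall>\<^sub>F n in sequentially. pairf (X n) (Y n) \<in> U (Suc m)"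
      "\<And>n. 0 < t n" "tends F m (\<lambda>n. (1 / t n) *\<^sub>R f (pairf (X n) (Y n))) 0"
    for m v X Y t
    using that by (rule proper)
  show "tends F m Y 0"
    if "\<forall>\<^sub>F n in sequentially. X n \<in> W (Suc m)"
      "\<forall>\<^sub>F n in sequentially. Y n \<in> lev F m" "tends F m (\<lambda>n. A (gr (X n)) (pairf 0 (Y n))) 0"
    for m X Y
    using that by (rule lin_proper)
  show "\<exists>y\<in>lev F m. A (gr v) (pairf 0 y) = b" if "v \<in> W (Suc m)" "b \<in> lev F m" for m v b
    using that by (rule lin_surj)
qed

end

section \<open>Iterating the tangent construction up to order k\<close>

lemma tan_it_scs [simp]:
  "fst (tan_it S F U f Ds j) = (Tscs ^^ j) S"
  "fst (snd (tan_it S F U f Ds j)) = (Tscs ^^ j) F"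
  by (induction j) (simp_all add: case_prod_unfold)

text \<open>Stage j consists of T^j f and T^j \<delta> and is an \<open>sc_problem\<close> with p =
  k - j. This is positive for j < k, so \<open>sol_sc1\<close> makes T^j \<delta> of class sc^1 with
  derivative \<open>E j\<close>.\<close>

theorem scK_solution:
  fixes V :: "'v::real_vector scs" and F :: "'e::real_vector scs"
  assumes contr: "sc_contraction V F C U f (Ds 0) W \<delta> rad"
    and Ds: "\<forall>j<k. case tan_it (prs V F) F U f Ds j of (S', F', U', f') \<Rightarrow> sc1 S' F' U' f' (Ds j)"
  shows "scK k V F W \<delta>"
proof -
  define VV where "VV j = (Tscs ^^ j) V" for j
  define FF where "FF j = (Tscs ^^ j) F" for j
  define CC where "CC j = ((\<lambda>C. {v. evn v \<in> C}) ^^ j) C" for j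
  define UU where "UU j = fst (snd (snd (tan_it (prs V F) F U f Ds j)))" for j
  define ff where "ff j = snd (snd (snd (tan_it (prs V F) F U f Ds j)))" for j
  define WW where "WW = rec_nat W (\<lambda>j. Tgerm (VV j))"
  \<comment> \<open>T^j \<delta> is built along with its derivative: the derivative at stage j is
    the linearized solution operator belonging to \<open>Ds j\<close> and the graph of
    \<open>dd j\<close>.\<close>
  define dd where "dd = rec_nat \<delta> (\<lambda>j g. Tmap g (sol_D (FF j) (Ds j) g))"
  define E where "E j = sol_D (FF j) (Ds j) (dd j)" for j
  have SS: "(Tscs ^^ j) (prs V F) = prs (VV j) (FF j)" for j
    by (induction j) (simp_all add: VV_def FF_def Tscs_prs)
  have tan: "tan_it (prs V F) F U f Ds j = (prs (VV j) (FF j), FF j, UU j, ff j)" for j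
    by (simp add: prod_eq_iff SS FF_def UU_def ff_def)
  have zero: "VV 0 = V" "FF 0 = F" "CC 0 = C" "UU 0 = U" "ff 0 = f" "WW 0 = W" "dd 0 = \<delta>"
    by (simp_all add: VV_def FF_def CC_def UU_def ff_def WW_def dd_def)
  have step: "VV (Suc j) = Tscs (VV j)" "FF (Suc j) = Tscs (FF j)" "CC (Suc j) = {v. evn v \<in> CC j}"
    "WW (Suc j) = Tgerm (VV j) (WW j)" "dd (Suc j) = Tmap (dd j) (E j)" for j
    by (simp_all add: VV_def FF_def CC_def WW_def dd_def E_def)
  have "UU (Suc j) = Tgerm (prs (VV j) (FF j)) (UU j)" "ff (Suc j) = Tmap (ff j) (Ds j)" for j
    using tan[of "Suc j"] tan[of j] by simp_all
  note step = step this
  have sc1_stage: "sc1 (prs (VV j) (FF j)) (FF j) (UU j) (ff j) (Ds j)" if "j < k" for j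
    using Ds that tan[of j] by auto
  interpret sc_contraction V F C U f "Ds 0" W \<delta> rad
    by (rule contr)
  have map: "sc_map (VV j) (FF j) (CC j) (UU j) (ff j) (Ds j)" if "j < k" for j
    using that
  proof (induction j)
    case 0
    show ?case
      unfolding zero by (rule sc_map_axioms)
  next
    case (Suc j)
    have "sc_map (VV j) (FF j) (CC j) (UU j) (ff j) (Ds j)"
      using Suc by simp
    moreover have "sc1 (Tscs (prs (VV j) (FF j))) (Tscs (FF j)) (Tgerm (prs (VV j) (FF j)) (UU j)) (Tmap (ff j) (Ds j)) (Ds (Suc j))"
      using sc1_stage[OF Suc.prems] unfolding step Tscs_prs .
    ultimately show ?case
      unfolding step by (rule sc_map.sc_map_Tscs)
  qed
  have map2: "sc_map2 (VV j) (FF j) (CC j) (UU j) (ff j) (Ds j) (Ds (Suc j))" if "Suc j < k" for j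
    using map[of j] sc1_stage[OF that] that unfolding step
    by (simp add: sc_map2_def sc_map2_axioms_def Tscs_prs)
  \<comment> \<open>By m uses of \<open>frech_up\<close>, differentiability of stage j + m on level
    0, which is part of sc^1, becomes differentiability of stage j on level m.\<close>
  have fr: "frech (prs (VV j) (FF j)) (FF j) (UU j) (ff j) (Ds j) m" if "j + m < k" for j m
    using that
  proof (induction m arbitrary: j)
    case 0
    then show ?case
      using sc_map.frech_0[OF map] by simp
  next
    case (Suc m)
    then have "frech (prs (VV (Suc j)) (FF (Suc j))) (FF (Suc j)) (UU (Suc j)) (ff (Suc j)) (Ds (Suc j)) m"
      by simp
    then show ?case
      using Suc.prems sc_map2.frech_up[OF map2]
      unfolding step Tscs_prs[symmetric] by simp
  qed
  have problem: "sc_problem (VV j) (FF j) (CC j) (UU j) (ff j) (Ds j) (WW j) (dd j) (k - j)" if "j < k" for j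
    using that
  proof (induction j)
    case 0
    show ?case
      using fr[of 0] unfolding zero by (intro sc_problem_contraction) simp
  next
    case (Suc j)
    define q where "q = k - Suc j"
    have q: "k - j = Suc q" "m < q \<Longrightarrow> Suc j + m < k" for m
      using Suc.prems by (simp_all add: q_def)
    have "sc_problem2 (VV j) (FF j) (CC j) (UU j) (ff j) (Ds j) (WW j) (dd j) q (Ds (Suc j))"
      unfolding sc_problem2_def sc_problem2_axioms_def
    proof (intro conjI allI impI)
      show "sc_problem (VV j) (FF j) (CC j) (UU j) (ff j) (Ds j) (WW j) (dd j) (Suc q)"
        using Suc.IH Suc.prems unfolding q(1)[symmetric] by simp
      show "sc_map2 (VV j) (FF j) (CC j) (UU j) (ff j) (Ds j) (Ds (Suc j))"
        using Suc.prems by (rule map2)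
      show "frech (Tscs (prs (VV j) (FF j))) (Tscs (FF j)) (Tgerm (prs (VV j) (FF j)) (UU j)) (Tmap (ff j) (Ds j)) (Ds (Suc j)) m"
        if "m < q" for m
        using fr[OF q(2)[OF that]]
        unfolding step Tscs_prs .
    qed
    from sc_problem2.sc_problem_Tscs[OF this] show ?case
      unfolding q_def[symmetric] step E_def .
  qed
  have tan': "tan_it V F W \<delta> E j = (VV j, FF j, WW j, dd j)" for j
    by (induction j) (simp_all add: zero step)
  have "case tan_it V F W \<delta> E j of (S', F', U', f') \<Rightarrow> sc1 S' F' U' f' (E j)" if "j < k" for j
    using sc_problem.sol_sc1[OF problem[OF that]] that unfolding tan' E_def by simp
  then show ?thesis
    unfolding scK_def using sc0_sol by blast
qed

section \<open>From sc-Banach spaces to scales of sequences\<close>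

lemma lift_scs_simps [simp]:
  "x \<in> lev (lift_scs L N) m \<longleftrightarrow> x 0 \<in> L m \<and> (\<forall>i>0. x i = 0)"
  "nrm (lift_scs L N) m x = N m (x 0)"
  by (simp_all add: lift_scs_def)

lemma lift_germ_simps [simp]: "x \<in> lift_germ U m \<longleftrightarrow> x 0 \<in> U m \<and> (\<forall>i>0. x i = 0)"
  by (simp add: lift_germ_def)

definition emb :: "'a::zero \<Rightarrow> nat \<Rightarrow> 'a" where
  "emb a = (\<lambda>i. if i = 0 then a else 0)"

lemma emb_simps [simp]: "emb a 0 = a" "0 < i \<Longrightarrow> emb a i = 0" "lift_fun f x = emb (f (x 0))"
  by (simp_all add: emb_def lift_fun_def fun_eq_iff)

lemma lift_scs_sum: "lift_scs (sumL L) (sumN N) = prs (lift_scs constL constN) (lift_scs L N)"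
  by (auto simp: lift_scs_def prs_def sumL_def sumN_def constL_def constN_def fstf_def sndf_def
      fun_eq_iff prod_eq_iff mem_Times_iff split: prod.split)

lemma sc_banachD:
  assumes "sc_banach L N"
  shows "L (Suc m) \<subseteq> L m" "subspace (L m)" "x \<in> L m \<Longrightarrow> 0 \<le> N m x" "x \<in> L m \<Longrightarrow> N m x = 0 \<longleftrightarrow> x = 0"
    "x \<in> L m \<Longrightarrow> y \<in> L m \<Longrightarrow> N m (x + y) \<le> N m x + N m y" "x \<in> L m \<Longrightarrow> N m (c *\<^sub>R x) = \<bar>c\<bar> * N m x"
    "(\<forall>k. X k \<in> L m) \<Longrightarrow> (\<forall>e>0. \<exists>K. \<forall>i\<ge>K. \<forall>j\<ge>K. N m (X i - X j) < e) \<Longrightarrow>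
      \<exists>y\<in>L m. (\<lambda>k. N m (X k - y)) \<longlonglongrightarrow> 0"
    "(\<forall>k. X k \<in> L (Suc m) \<and> N (Suc m) (X k) \<le> 1) \<Longrightarrow>
      \<exists>r y. strict_mono (r :: nat \<Rightarrow> nat) \<and> y \<in> L m \<and> (\<lambda>k. N m (X (r k) - y)) \<longlonglongrightarrow> 0"
    "x \<in> L m \<Longrightarrow> 0 < e \<Longrightarrow> \<exists>y\<in>L (Suc m). N m (y - x) < e"
proof -
  note sc = assms[unfolded sc_banach_def]
  show "L (Suc m) \<subseteq> L m" "subspace (L m)" "x \<in> L m \<Longrightarrow> 0 \<le> N m x" "x \<in> L m \<Longrightarrow> N m x = 0 \<longleftrightarrow> x = 0"
    "x \<in> L m \<Longrightarrow> y \<in> L m \<Longrightarrow> N m (x + y) \<le> N m x + N m y" "x \<in> L m \<Longrightarrow> N m (c *\<^sub>R x) = \<bar>c\<bar> * N m x"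
    using sc by simp_all
  show "(\<forall>k. X k \<in> L m) \<Longrightarrow> (\<forall>e>0. \<exists>K. \<forall>i\<ge>K. \<forall>j\<ge>K. N m (X i - X j) < e) \<Longrightarrow>
      \<exists>y\<in>L m. (\<lambda>k. N m (X k - y)) \<longlonglongrightarrow> 0"
    using sc by simp
  have "\<forall>m n (X :: nat \<Rightarrow> 'a). m < n \<and> (\<forall>k. X k \<in> L n \<and> N n (X k) \<le> 1)
        \<longrightarrow> (\<exists>(r :: nat \<Rightarrow> nat) y. strict_mono r \<and> y \<in> L m \<and> (\<lambda>k. N m (X (r k) - y)) \<longlonglongrightarrow> 0)"
    using sc by (elim conjE) assumption
  then show "(\<forall>k. X k \<in> L (Suc m) \<and> N (Suc m) (X k) \<le> 1) \<Longrightarrow>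
      \<exists>r y. strict_mono (r :: nat \<Rightarrow> nat) \<and> y \<in> L m \<and> (\<lambda>k. N m (X (r k) - y)) \<longlonglongrightarrow> 0"
    using lessI[of m] by presburger
  have "\<forall>m. \<forall>x\<in>L m. \<forall>e>0. \<exists>y\<in>(\<Inter>j. L j). N m (y - x) < e"
    using sc by (elim conjE) assumption
  then show "x \<in> L m \<Longrightarrow> 0 < e \<Longrightarrow> \<exists>y\<in>L (Suc m). N m (y - x) < e"
    by blast
qed

text \<open>Compactness implies boundedness of the inclusion: otherwise there are vectors of norm 1
  on level m+1 whose level-m norms exceed every n, contradicting convergence of a subsequence on
  level m.\<close>

lemma sc_banach_embed:
  assumes "sc_banach L N"
  shows "\<exists>c. \<forall>x\<in>L (Suc m). N m x \<le> c * N (Suc m) x"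
proof (rule ccontr)
  note sc = sc_banachD[OF assms]
  assume neg: "\<not> ?thesis"
  have "\<not> (\<forall>x\<in>L (Suc m). N m x \<le> real n * N (Suc m) x)" for n
    using neg unfolding not_ex by (rule spec)
  then obtain X where X: "\<And>n. X n \<in> L (Suc m)" "\<And>n. real n * N (Suc m) (X n) < N m (X n)"
    unfolding Ball_def not_all not_imp not_le by metis
  have Xm: "X n \<in> L m" for n
    using X(1) sc(1) by blast
  have pos: "0 < N (Suc m) (X n)" for n
  proof -
    have "X n \<noteq> 0"
      using X(2)[of n] sc(4)[of 0 m] sc(4)[of 0 "Suc m"] subspace_0[OF sc(2)] by force
    then show ?thesis
      using sc(3,4)[OF X(1)[of n]] by linarith
  qed
  define G where "G n = (1 / N (Suc m) (X n)) *\<^sub>R X n" for n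
  have G: "G n \<in> L (Suc m) \<and> N (Suc m) (G n) \<le> 1" for n
    using pos[of n] sc(6)[OF X(1)[of n]] subspace_scale[OF sc(2) X(1)] by (simp add: G_def)
  then obtain r y where r: "strict_mono (r :: nat \<Rightarrow> nat)" "y \<in> L m" "(\<lambda>k. N m (G (r k) - y)) \<longlonglongrightarrow> 0"
    using sc(8)[of G m] by blast
  have big: "real (r n) < N m (G (r n) - y) + N m y" for n
  proof -
    have "real (r n) < N m (G (r n))"
      using X(2)[of "r n"] pos[of "r n"] sc(6)[OF Xm[of "r n"]] by (simp add: G_def pos_less_divide_eq)
    moreover have "G (r n) \<in> L m"
      using G sc(1) by blast
    ultimately show ?thesis
      using sc(5)[of "G (r n) - y" m y] subspace_diff[OF sc(2)] r(2) by simp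
  qed
  have "\<forall>\<^sub>F n in sequentially. N m (G (r n) - y) < 1"
    using order_tendstoD(2)[OF r(3)] by simp
  moreover have "\<forall>\<^sub>F n in sequentially. 1 + N m y \<le> real (r n)"
    using filterlim_compose[OF filterlim_real_sequentially filterlim_subseq[OF r(1)]]
    unfolding filterlim_at_top by blast
  ultimately have "\<forall>\<^sub>F n in sequentially. False"
  proof eventually_elim
    case (elim n)
    with big[of n] show ?case
      by linarith
  qed
  then show False
    by simp
qed

lemma lift_lev_eqI: "(\<forall>i>0. x i = 0) \<Longrightarrow> (\<forall>i>0. y i = 0) \<Longrightarrow> x 0 = y 0 \<Longrightarrow> x = (y :: nat \<Rightarrow> 'a::zero)"
  by (rule ext) (metis gr0I)

lemmas fun_apply = plus_fun_apply zero_fun_apply scaleR_fun_apply minus_apply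

lemma sc_scale_lift:
  assumes "sc_banach L N"
  shows "sc_scale (lift_scs L N)"
proof
  note sc = sc_banachD[OF assms]
  fix m and x y :: "nat \<Rightarrow> 'a" and c e :: real
  show "subspace (lev (lift_scs L N) m)"
    using sc(2)[of m] unfolding subspace_def by (simp add: fun_apply)
  show "lev (lift_scs L N) (Suc m) \<subseteq> lev (lift_scs L N) m"
    using sc(1)[of m] by auto
  show "\<exists>c. \<forall>x\<in>lev (lift_scs L N) (Suc m). nrm (lift_scs L N) m x \<le> c * nrm (lift_scs L N) (Suc m) x"
    unfolding Ball_def lift_scs_simps using sc_banach_embed[OF assms, of m] by blast
  assume x: "x \<in> lev (lift_scs L N) m"
  then have x0: "x 0 \<in> L m"
    by simp
  show "0 \<le> nrm (lift_scs L N) m x"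
    using sc(3)[OF x0] by simp
  show "x = 0" if "nrm (lift_scs L N) m x = 0"
    using that x sc(4)[OF x0] by (intro lift_lev_eqI) (simp_all add: fun_apply)
  show "nrm (lift_scs L N) m (x + y) \<le> nrm (lift_scs L N) m x + nrm (lift_scs L N) m y"
    if "y \<in> lev (lift_scs L N) m"
    using that sc(5)[OF x0, of "y 0"] by (simp add: fun_apply)
  show "nrm (lift_scs L N) m (c *\<^sub>R x) = \<bar>c\<bar> * nrm (lift_scs L N) m x"
    using sc(6)[OF x0] by (simp add: fun_apply)
  show "\<exists>y\<in>lev (lift_scs L N) (Suc m). nrm (lift_scs L N) m (y - x) < e" if e: "0 < e"
  proof -
    obtain z where "z \<in> L (Suc m)" "N m (z - x 0) < e"
      using sc(9)[OF x0 e] by blast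
    then show ?thesis
      by (intro bexI[of _ "emb z"]) (simp_all add: fun_apply)
  qed
qed

lemma const_scale_lift: "const_scale (lift_scs constL constN :: 'a::euclidean_space scs)"
proof
  let ?V = "lift_scs constL constN :: 'a scs"
  fix m n and x y :: "nat \<Rightarrow> 'a" and c e K :: real and X :: "nat \<Rightarrow> nat \<Rightarrow> 'a"
  show "subspace (lev ?V m)"
    unfolding subspace_def by (simp add: fun_apply constL_def)
  show "lev ?V (Suc m) \<subseteq> lev ?V m" "lev ?V m = lev ?V n" "nrm ?V m = nrm ?V n"
    by (auto simp: constL_def constN_def fun_eq_iff)
  show "\<exists>c. \<forall>x\<in>lev ?V (Suc m). nrm ?V m x \<le> c * nrm ?V (Suc m) x"
    by (intro exI[of _ 1]) (simp add: constN_def)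
  show "\<exists>r x. strict_mono (r :: nat \<Rightarrow> nat) \<and> tends ?V 0 (\<lambda>n. X (r n)) x"
    if X: "\<And>n. X n \<in> lev ?V 0 \<and> nrm ?V 0 (X n) \<le> K"
  proof -
    have "\<forall>n. X n 0 \<in> cball 0 K"
      using X by (simp add: constN_def)
    then obtain l r where r: "strict_mono (r :: nat \<Rightarrow> nat)" "((\<lambda>n. X n 0) \<circ> r) \<longlonglongrightarrow> l"
      using compact_cball[of 0 K] unfolding compact_def by meson
    have "(\<lambda>n. norm (X (r n) 0 - l)) \<longlonglongrightarrow> 0"
      using r(2) by (simp add: o_def LIM_zero tendsto_norm_zero)
    then have "tends ?V 0 (\<lambda>n. X (r n)) (emb l)"
      using X by (simp add: tends_def fun_apply constL_def constN_def)
    with r(1) show ?thesis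
      by blast
  qed
  assume x: "x \<in> lev ?V m"
  show "0 \<le> nrm ?V m x"
    by (simp add: constN_def)
  show "x = 0" if "nrm ?V m x = 0"
    using that x by (intro lift_lev_eqI) (simp_all add: fun_apply constN_def)
  show "nrm ?V m (x + y) \<le> nrm ?V m x + nrm ?V m y"
    by (simp add: fun_apply constN_def norm_triangle_ineq)
  show "nrm ?V m (c *\<^sub>R x) = \<bar>c\<bar> * nrm ?V m x"
    by (simp add: fun_apply constN_def)
  show "\<exists>y\<in>lev ?V (Suc m). nrm ?V m (y - x) < e" if "0 < e"
    using that x by (intro bexI[of _ x]) (simp_all add: fun_apply constN_def constL_def)
qed

lemma sc0_subset: "sc0 S F U f \<Longrightarrow> (\<And>m. U' m \<subseteq> U m) \<Longrightarrow> sc0 S F U' f"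
  unfolding sc0_def by (meson image_mono subset_iff order_trans)

lemma quadrant_span:
  fixes v :: "real^'n::finite"
  shows "\<exists>a\<in>quadrant J. \<exists>b\<in>quadrant J. v = a - b"
  by (intro bexI[of _ "\<chi> i. \<bar>v $ i\<bar> + v $ i"] bexI[of _ "\<chi> i. \<bar>v $ i\<bar>"])
    (auto simp: quadrant_def vec_eq_iff)

text \<open>The given solution has its graph in \<open>U 0\<close>, whereas the argument needs, over
  the m-th set, the graph in U m and inside the contraction radius of level m. Continuity of
  \<delta> on each level permits shrinking W accordingly.\<close>

theorem theorem2p6:
  fixes L :: "nat \<Rightarrow> ('e::banach) set" and N :: "nat \<Rightarrow> 'e \<Rightarrow> real"
    and J :: "'n::finite set"
    and U :: "nat \<Rightarrow> ((real^'n) \<times> 'e) set" and f :: "(real^'n) \<times> 'e \<Rightarrow> 'e"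
    and W :: "nat \<Rightarrow> (real^'n) set" and \<delta> :: "(real^'n) \<Rightarrow> 'e"
    and k :: nat
  assumes "sc_banach L N"
    and "sc0_contraction_germ L N (quadrant J) U f"
    and "is_sc k (sumL L) (sumN N) L N U f"
    and "nbhd_germ constL constN (quadrant J) W"
    and "is_sc 0 constL constN L N W \<delta>"
    and "\<forall>v\<in>W 0. (v, \<delta> v) \<in> U 0 \<and> f (v, \<delta> v) = 0"
  shows "\<exists>W'. nbhd_germ constL constN (quadrant J) W' \<and> (\<forall>m. W' m \<subseteq> W m) \<and>
           is_sc k constL constN L N W' \<delta>"
\<comment> \<open>For k = 0 there is no derivative \<open>Ds 0\<close> to work with, and the claim
  is the assumed continuity of \<delta> on W itself.\<close>
proof (cases "k = 0")
  case True
  then show ?thesis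
    using assms(4,5) by blast
next
  case False
  let ?V = "lift_scs constL constN :: (real^'n) scs" and ?F = "lift_scs L N"
  let ?C = "{v :: nat \<Rightarrow> real^'n. v 0 \<in> quadrant J}"
  note sc = sc_banachD[OF assms(1)]
  interpret V: const_scale ?V
    by (rule const_scale_lift)
  interpret F: sc_scale ?F
    using assms(1) by (rule sc_scale_lift)
  obtain Ds where Ds: "\<forall>j<k. case tan_it (prs ?V ?F) ?F (lift_germ U) (lift_fun f) Ds j of
      (S', F', U', f') \<Rightarrow> sc1 S' F' U' f' (Ds j)"
    using assms(3) unfolding is_sc_def scK_def lift_scs_sum by blast
  have sc1: "sc1 (prs ?V ?F) ?F (lift_germ U) (lift_fun f) (Ds 0)"
    using Ds False by auto
  have germ: "U (Suc m) \<subseteq> U m" "U m \<subseteq> (quadrant J \<times> UNIV) \<inter> sumL L m" "0 \<in> U m"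
    "x \<in> U m \<Longrightarrow> \<exists>r>0. \<forall>y\<in>(quadrant J \<times> UNIV) \<inter> sumL L m. sumN N m (y - x) < r \<longrightarrow> y \<in> U m" for m x
    using assms(2) unfolding sc0_contraction_germ_def nbhd_germ_def by blast+
  have germ_fst: "fst x \<in> quadrant J" and germ_lev: "x \<in> sumL L m" if "x \<in> U m" for m x
    using subsetD[OF germ(2) that] by (simp_all add: mem_Times_iff)
  have W: "W (Suc m) \<subseteq> W m" "W m \<subseteq> quadrant J" "0 \<in> W m"
    "x \<in> W m \<Longrightarrow> \<exists>r>0. \<forall>y\<in>quadrant J. norm (y - x) < r \<longrightarrow> y \<in> W m" for m x
    using assms(4) unfolding nbhd_germ_def constL_def constN_def by auto
  have W_le: "W m \<subseteq> W i" if "i \<le> m" for i m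
    using that W(1) by (rule lift_Suc_antimono_le[rotated])
  \<comment> \<open>Choosing epsilon = 1/2 on every level gives the constant in
    \<open>sc_contraction\<close>.\<close>
  have "\<forall>m. \<exists>r>0. \<forall>v u u'. (v, u) \<in> U m \<and> (v, u') \<in> U m \<and> norm v + N m u < r \<and> norm v + N m u' < r
      \<longrightarrow> N m ((u - f (v, u)) - (u' - f (v, u'))) \<le> 1 / 2 * N m (u - u')"
    by (rule allI, rule assms(2)[unfolded sc0_contraction_germ_def, THEN conjunct2, THEN conjunct2,
          THEN spec, THEN spec, THEN mp]) simp
  then obtain rad where rad: "\<And>m. 0 < rad m"
    "\<And>m v u u'. (v, u) \<in> U m \<Longrightarrow> (v, u') \<in> U m \<Longrightarrow> norm v + N m u < rad m \<Longrightarrow> norm v + N m u' < rad m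
      \<Longrightarrow> N m ((u - f (v, u)) - (u' - f (v, u'))) \<le> 1 / 2 * N m (u - u')"
    by metis
  have sol: "sc0 ?V ?F (lift_germ W) (lift_fun \<delta>)"
    using assms(5) by (simp only: is_sc_def scK_def)
  have emb_0: "emb (\<delta> 0) = 0"
    using sol by (simp add: sc0_def fun_apply)
  have "emb (\<delta> 0) 0 = 0"
    unfolding emb_0 by (rule zero_fun_apply)
  then have sol_0: "\<delta> 0 = 0"
    by simp
  have sol_lev: "\<delta> v \<in> L m" if "v \<in> W m" for v m
    using sc0_lev[OF sol, of "emb v" m] that by simp
  have sol_cont: "\<exists>d>0. \<forall>y\<in>W m. norm (y - v) < d \<longrightarrow> N m (\<delta> y - \<delta> v) < e"
    if v: "v \<in> W m" and e: "0 < e" for v m e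
  proof -
    have "emb v \<in> lift_germ W m"
      using v by simp
    from sc0_cont[OF sol this e] obtain d where d: "d > 0" "\<And>y. y \<in> lift_germ W m \<Longrightarrow> nrm ?V m (y - emb v) < d \<Longrightarrow>
        nrm ?F m (lift_fun \<delta> y - lift_fun \<delta> (emb v)) < e"
      by blast
    show ?thesis
      using d(1) d(2)[of "emb y" for y] by (intro exI[of _ d]) (auto simp: fun_apply constN_def)
  qed
  define P where "P i v \<longleftrightarrow> (v, \<delta> v) \<in> U i \<and> norm v + N i (\<delta> v) < rad i" for i v
  \<comment> \<open>Imposing the conditions of all levels i \<le> m makes the sets decreasing, since
    the radii of different levels are unrelated. There are finitely many conditions for each m, so
    openness is preserved.\<close>
  define W' where "W' m = {v \<in> W m. \<forall>i\<in>{..m}. P i v}" for m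
  have P_open: "\<forall>\<^sub>F y in nhds v. y \<in> W m \<longrightarrow> P m y" if v: "v \<in> W m" "P m v" for v m
  proof -
    obtain r where r: "0 < r" "\<And>y. y \<in> (quadrant J \<times> UNIV) \<inter> sumL L m \<Longrightarrow> sumN N m (y - (v, \<delta> v)) < r \<Longrightarrow> y \<in> U m"
      using germ(4)[of "(v, \<delta> v)" m] v(2) unfolding P_def by blast
    \<comment> \<open>v and \<delta> v each move by less than e, and their total displacement, below
      2e, has to stay within both the neighborhood U m and the contraction radius.\<close>
    define e where "e = min r (rad m - (norm v + N m (\<delta> v))) / 2"
    have e: "0 < e" "2 * e \<le> r" "2 * e \<le> rad m - (norm v + N m (\<delta> v))"
      using r(1) v(2) by (auto simp: e_def P_def)
    obtain d where d: "0 < d" "\<And>y. y \<in> W m \<Longrightarrow> norm (y - v) < d \<Longrightarrow> N m (\<delta> y - \<delta> v) < e"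
      using sol_cont[OF v(1) e(1)] by blast
    have "P m y" if y: "norm (y - v) < min d e" "y \<in> W m" for y
    proof -
      have lt: "norm (y - v) + N m (\<delta> y - \<delta> v) < 2 * e"
        using d(2)[of y] y by simp
      have "(y, \<delta> y) \<in> (quadrant J \<times> UNIV) \<inter> sumL L m"
        using W(2) sol_lev y by (auto simp: sumL_def)
      then have "(y, \<delta> y) \<in> U m"
        using r(2)[of "(y, \<delta> y)"] lt e(2) by (simp add: sumN_def)
      moreover have "N m (\<delta> y) \<le> N m (\<delta> y - \<delta> v) + N m (\<delta> v)"
        using sc(5)[of "\<delta> y - \<delta> v" m "\<delta> v"] sol_lev[OF y(2)] sol_lev[OF v(1)] subspace_diff[OF sc(2)] by simp
      moreover have "norm y \<le> norm (y - v) + norm v"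
        using norm_triangle_ineq[of "y - v" v] by simp
      ultimately show ?thesis
        using lt e(3) unfolding P_def by linarith
    qed
    then show ?thesis
      unfolding eventually_nhds_metric dist_norm using d(1) e(1) by (intro exI[of _ "min d e"]) auto
  qed
  have W'_germ: "nbhd_germ constL constN (quadrant J) W'"
    unfolding nbhd_germ_def
  proof (intro conjI allI ballI)
    fix m
    show "W' (Suc m) \<subseteq> W' m"
      using W(1)[of m] by (auto simp: W'_def)
    have "N i 0 = 0" for i
      using sc(4)[of 0 i] subspace_0[OF sc(2)] by blast
    then show "0 \<in> W' m"
      using W(3) germ(3) rad(1) by (auto simp: W'_def P_def sol_0 zero_prod_def)
    show "W' m \<subseteq> quadrant J \<inter> constL m"
      using W(2) by (auto simp: W'_def constL_def)
    fix v
    assume v: "v \<in> W' m"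
    have "\<forall>\<^sub>F y in nhds v. y \<in> W i \<longrightarrow> P i y" if "i \<in> {..m}" for i
      using v that W_le[of i m] by (intro P_open) (auto simp: W'_def)
    then have "\<forall>\<^sub>F y in nhds v. \<forall>i\<in>{..m}. y \<in> W i \<longrightarrow> P i y"
      by (intro eventually_ball_finite) auto
    then obtain d where d: "0 < d" "\<And>y i. norm (y - v) < d \<Longrightarrow> i \<in> {..m} \<Longrightarrow> y \<in> W i \<Longrightarrow> P i y"
      unfolding eventually_nhds_metric dist_norm by blast
    obtain r where r: "0 < r" "\<And>y. y \<in> quadrant J \<Longrightarrow> norm (y - v) < r \<Longrightarrow> y \<in> W m"
      using W(4)[of v m] v unfolding W'_def by blast
    have "y \<in> W' m" if "y \<in> quadrant J" "norm (y - v) < min d r" for y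
      using that d(2)[of y] r(2)[of y] W_le[of _ m] by (auto simp: W'_def)
    then show "\<exists>r>0. \<forall>y\<in>quadrant J \<inter> constL m. constN m (y - v) < r \<longrightarrow> y \<in> W' m"
      using d(1) r(1) by (intro exI[of _ "min d r"]) (auto simp: constN_def)
  qed
  have pair0: "pairf v u 0 = (v 0, u 0)" for v :: "nat \<Rightarrow> real^'n" and u :: "nat \<Rightarrow> 'e"
    by (simp add: pairf_def)
  interpret sc_map ?V ?F ?C "lift_germ U" "lift_fun f" "Ds 0"
  proof
    show "a + b \<in> ?C" if "a \<in> ?C" "b \<in> ?C" for a b
      using that by (auto simp: quadrant_def fun_apply)
    show "t *\<^sub>R a \<in> ?C" if "0 \<le> t" "a \<in> ?C" for t a
      using that by (auto simp: quadrant_def fun_apply)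
    show "\<exists>a\<in>lev ?V 0 \<inter> ?C. \<exists>b\<in>lev ?V 0 \<inter> ?C. v = a - b" if v: "v \<in> lev ?V 0" for v
    proof -
      obtain a b where "a \<in> quadrant J" "b \<in> quadrant J" "v 0 = a - b"
        using quadrant_span by blast
      moreover from this have "v = emb a - emb b"
        using v by (intro lift_lev_eqI) (simp_all add: fun_apply)
      ultimately show ?thesis
        by (intro bexI[of _ "emb a"] bexI[of _ "emb b"]) (simp_all add: constL_def)
    qed
    show "fstf x \<in> ?C" if "x \<in> lift_germ U m" for x m
      using that by (auto simp: fstf_def intro: germ_fst)
    show "x \<in> lev (prs ?V ?F) m" if "x \<in> lift_germ U m" for x m
      using that germ_lev unfolding lift_scs_sum[symmetric] by simp
    show "lift_germ U (Suc m) \<subseteq> lift_germ U m" for m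
      using germ(1)[of m] by auto
    show "\<exists>r>0. \<forall>y\<in>lev (prs ?V ?F) m. fstf y \<in> ?C \<longrightarrow> nrm (prs ?V ?F) m (y - x) < r \<longrightarrow> y \<in> lift_germ U m"
      if x: "x \<in> lift_germ U m" for x m
    proof -
      obtain r where r: "0 < r" "\<And>y. y \<in> (quadrant J \<times> UNIV) \<inter> sumL L m \<Longrightarrow> sumN N m (y - x 0) < r \<Longrightarrow> y \<in> U m"
        using germ(4)[of "x 0" m] x unfolding lift_germ_simps by blast
      show ?thesis
        unfolding lift_scs_sum[symmetric] using r
        by (intro exI[of _ r]) (auto simp: fun_apply fstf_def mem_Times_iff)
    qed
    show "sc1 (prs ?V ?F) ?F (lift_germ U) (lift_fun f) (Ds 0)"
      by (rule sc1)
  qed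
  have W'_W: "W' m \<subseteq> W m" for m
    by (auto simp: W'_def)
  have "sc_contraction ?V ?F ?C (lift_germ U) (lift_fun f) (Ds 0) (lift_germ W') (lift_fun \<delta>) rad"
  proof
    show "0 \<in> lift_germ W' m" for m
      using W'_germ by (simp add: nbhd_germ_def fun_apply)
    show "v \<in> lev ?V m" if "v \<in> lift_germ W' m" for v m
      using that by (simp add: constL_def)
    show "lift_germ W' (Suc m) \<subseteq> lift_germ W' m" for m
      using W(1)[of m] by (auto simp: W'_def)
    show "pairf v (lift_fun \<delta> v) \<in> lift_germ U m" if "v \<in> lift_germ W' m" for v m
      using that by (simp add: W'_def P_def pairf_def zero_prod_def)
    show "lift_fun f (pairf v (lift_fun \<delta> v)) = 0" if "v \<in> lift_germ W' 0" for v
      using that assms(6) by (intro lift_lev_eqI) (simp_all add: W'_def fun_apply pair0)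
    show "sc0 ?V ?F (lift_germ W') (lift_fun \<delta>)"
      using sol by (rule sc0_subset) (use subsetD[OF W'_W] in auto)
    show "\<exists>r y. strict_mono (r :: nat \<Rightarrow> nat) \<and> tends ?F m (\<lambda>n. X (r n)) y"
      if X: "\<And>n. X n \<in> lev ?F (Suc m) \<and> nrm ?F (Suc m) (X n) \<le> K" for X m K
    proof -
      \<comment> \<open>Compactness is given for the unit ball, so the sequence is divided by c and
        its limit multiplied back; the maximum with 1 makes c positive.\<close>
      define c where "c = max K 1"
      have c: "1 \<le> c" "K \<le> c"
        by (simp_all add: c_def)
      have "\<forall>n. (1 / c) *\<^sub>R X n 0 \<in> L (Suc m) \<and> N (Suc m) ((1 / c) *\<^sub>R X n 0) \<le> 1"
        using X c sc(6)[of "X n 0" "Suc m" "1 / c" for n] order_trans[OF _ c(2)] subspace_scale[OF sc(2)]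
        by simp
      then obtain r y where r: "strict_mono (r :: nat \<Rightarrow> nat)" "y \<in> L m" "(\<lambda>n. N m ((1 / c) *\<^sub>R X (r n) 0 - y)) \<longlonglongrightarrow> 0"
        using sc(8)[of "\<lambda>n. (1 / c) *\<^sub>R X n 0" m] by blast
      have "tends ?F m (\<lambda>n. (1 / c) *\<^sub>R X (r n)) (emb y)"
        using r X subsetD[OF sc(1)] subspace_scale[OF sc(2)]
        by (auto simp: tends_def fun_apply intro!: always_eventually)
      from F.tends_scaleR[OF tendsto_const this, of c] have "tends ?F m (\<lambda>n. X (r n)) (c *\<^sub>R emb y)"
        using c by simp
      with r(1) show ?thesis
        by blast
    qed
    show "\<exists>y. tends ?F m X y"
      if X: "\<And>n. X n \<in> lev ?F m" and "\<And>e. 0 < e \<Longrightarrow> \<exists>K. \<forall>i\<ge>K. \<forall>j\<ge>K. nrm ?F m (X i - X j) < e" for X m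
    proof -
      have "\<exists>y\<in>L m. (\<lambda>n. N m (X n 0 - y)) \<longlonglongrightarrow> 0"
        using that by (intro sc(7)) (simp_all add: fun_apply)
      then obtain y where "y \<in> L m" "(\<lambda>n. N m (X n 0 - y)) \<longlonglongrightarrow> 0"
        by blast
      then have "tends ?F m X (emb y)"
        using X by (simp add: tends_def fun_apply)
      then show ?thesis
        by blast
    qed
    show "nrm ?F m ((u - lift_fun f (pairf v u)) - (u' - lift_fun f (pairf v u'))) \<le> nrm ?F m (u - u') / 2"
      if "pairf v u \<in> lift_germ U m" "pairf v u' \<in> lift_germ U m" "nrm ?V m v + nrm ?F m u < rad m"
        "nrm ?V m v + nrm ?F m u' < rad m" for v u m u'
      using rad(2)[of "v 0" "u 0" m "u' 0"] that by (simp add: pair0 fun_apply constN_def)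
    show "nrm ?V m v + nrm ?F m (lift_fun \<delta> v) < rad m" if "v \<in> lift_germ W' m" for v m
      using that by (simp add: W'_def P_def constN_def)
  qed
  then have "is_sc k constL constN L N W' \<delta>"
    unfolding is_sc_def using Ds by (rule scK_solution)
  with W'_germ W'_W show ?thesis
    by blast
qed

end
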